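(* Fix $P>0$, $\bar r\in[0,\infty)$ and $\bar s\in(0,1]$. For each $K\ge 2$ consider the Gaussian broadcast channel with $K$ transmit antennas and $K$ single-antenna users, with $r=r_K$ feedback bits per user, of which $s=s_K$ users (users $1,\dots,s$, with $1\le s\le K$) are "on". Suppose the channel knowledge at the transmitter follows the quantization-cell (QUB) model, and zeroforcing dirty paper coding is used with equal power $P/s$ per on user and with the inflation factors $W_i$ specified in the context. Let $R_i$ ($1\le i\le s$) be the resulting achievable rate of user $i$, as defined in the context. If $K\to\infty$ with $r/K\to\bar r$ and $s/K\to\bar s$, then $$\lim_{K\to\infty}\frac1K\sum_{i=1}^{s}R_i=\rho(P,\bar s,\bar r),$$ where $$\rho(P,\bar s,\bar r)=\bar s\left\{\log \mathrm{NR}-\int_0^1\log\left(\mathrm{NR}\cdot x^{\infty}(t)-\frac{P}{\bar s}(1-2^{-\bar r})(1-t\bar s)\left(\frac{\frac{P}{\bar s}(1-2^{-\bar r})\,t\bar s}{1+\frac{P}{\bar s}(1-2^{-\bar r})(1-t\bar s)+P2^{-\bar r}}+1\right)^{2}\right)dt\right\},$$ $$\mathrm{NR}=1+\frac{P}{\bar s}(1-2^{-\bar r})+P2^{-\bar r},\qquad x^{\infty}(t)=1+\frac{\left(\frac{P}{\bar s}\right)^2(1-2^{-\bar r})^2(1-t\bar s)(t\bar s)}{\left(1+P2^{-\bar r}+\frac{P}{\bar s}(1-2^{-\bar r})(1-t\bar s)\right)^2}.$$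
   Context: All logarithms are to base $2$; $A^*$ denotes conjugate transpose; $\|\cdot\|$ is the Euclidean norm. Channel and QUB feedback model. For each user $i=1,\dots,K$, $h_i\in\mathbb{C}^{K}$ is a random channel vector with i.i.d. $\mathcal{CN}(0,1)$ (circularly symmetric complex normal, mean $0$, variance $1$) entries, $\tilde h_i=h_i/\|h_i\|$ is its direction, and $\hat h_i\in\mathbb{C}^K$ is the unit-norm quantized direction known at the transmitter. The joint law of $(h_i,\hat h_i)$ is as follows: $\hat h_i$ is uniformly distributed on the unit sphere of $\mathbb{C}^K$; $$\tilde h_i=\sqrt{1-d_c^2(i)}\,\hat h_i+\sqrt{d_c^2(i)}\,\tilde e_i ,$$ where, conditionally on $\hat h_i$, the unit vector $\tilde e_i$ is isotropically (uniformly) distributed on the unit sphere of the orthogonal complement of $\hat h_i$, and $d_c^2(i)=\sin^2\angle(\tilde h_i,\hat h_i)\in[0,1]$ is independent of $\tilde e_i$ and of $\hat h_i$. The quantization cell around $\hat h_i$ is a spherical cap whose area is $2^{-r}$ times that of the unit sphere, so $\Pr(d_c^2(i)\le x)=2^{r}x^{K-1}$ for $0\le x\le 2^{-r/(K-1)}$. The norm $\|h_i\|$ is independent of $(\tilde h_i,\hat h_i)$, with $\|h_i\|^2$ distributed as the squared norm of a vector of $K$ i.i.d. $\mathcal{CN}(0,1)$ entries. The pairs $(h_i,\hat h_i)$, $i=1,\dots,K$, are mutually independent. Write $H=[h_1\cdots h_K]$, $\hat H=[\hat h_1\cdots\hat h_K]$; $\mathbb{E}_{H|\hat H}$ is conditional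 expectation given $\hat H$ and $\mathbb{E}_{\hat H}$ is expectation over $\hat H$. Beamforming vectors. $\omega_1,\dots,\omega_K$ are the columns of the unitary factor $Q$ in the QR decomposition of $\hat H$ (the Gram–Schmidt orthonormalization of $\hat h_1,\hat h_2,\dots$ in this order), so that $\hat h_i^*\omega_j=0$ for all $j>i$. Inflation factor. For $1\le i\le s$ put $\mathrm{nr}_i=1+\frac Ps\sum_{j=1}^{s}|h_i^*\omega_j|^2$ and let $W_i\in\mathbb{C}^{1\times(i-1)}$ be $$W_i=\frac Ps\,\mathbb{E}_{H|\hat H}\big(\omega_i^*h_ih_i^*[\omega_1\cdots\omega_{i-1}]\big)M_i^{-1},\qquad M_i=\mathbb{E}_{H|\hat H}\Big(\mathrm{nr}_i\, I_{i-1}-\frac Ps[\omega_1\cdots\omega_{i-1}]^*h_ih_i^*[\omega_1\cdots\omega_{i-1}]\Big)$$ (for $i=1$ the factor $W_1$ is empty and terms involving it are zero). Achievable rate with this inflation factor: $$R_i=\mathbb{E}_{\hat H}\,\mathbb{E}_{H|\hat H}\log\frac{\mathrm{nr}_i}{\mathrm{nr}_i\,(1+\|W_i\|^2)-\frac Ps\big|h_i^*\big(\omega_i+[\omega_1\cdots\omega_{i-1}]W_i^*\big)\big|^2}.$$ *)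

theory Defs
  imports
    "HOL-Probability.Probability"
    "Jordan_Normal_Form.Gram_Schmidt"
    "Jordan_Normal_Form.Schur_Decomposition"
    "Jordan_Normal_Form.Gauss_Jordan_Elimination"
begin

unbundle no vec_syntax
unbundle no inner_syntax

(* Vectors and matrices are those of Jordan_Normal_Form, whose dimension is a natural number, so
   that the number K of antennas and users can tend to infinity.  There v \<bullet>c w is the sum of
   v_k * cnj w_k, so w^* v is written v \<bullet>c w.  All indices start at 0: user i here is
   user i + 1 of the mathematical text. *)

type_synonym cvec = "complex Matrix.vec"
type_synonym cmat = "complex Matrix.mat"

definition cvec_norm :: "cvec \<Rightarrow> real" where
  "cvec_norm v = sqrt (\<Sum>k<dim_vec v. (cmod (v $ k))\<^sup>2)"

definition direction :: "cvec \<Rightarrow> cvec" where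
  "direction v = complex_of_real (1 / cvec_norm v) \<cdot>\<^sub>v v"

(* The angle between complex directions: cos = |u^* v| / (|u| |v|). *)
definition sin2_angle :: "cvec \<Rightarrow> cvec \<Rightarrow> real" where
  "sin2_angle u v = 1 - (cmod (u \<bullet>c v) / (cvec_norm u * cvec_norm v))\<^sup>2"

(* C^n with its Borel sigma-algebra, which is generated by the coordinates. *)
definition cvec_space :: "nat \<Rightarrow> cvec measure" where
  "cvec_space n =
     vimage_algebra (carrier_vec n) (\<lambda>v. \<lambda>k\<in>{..<n}. v $ k) (Pi\<^sub>M {..<n} (\<lambda>_. borel))"

(* The unit sphere of a subspace S of C^n carries exactly one probability measure that is invariant
   under the unitary maps of S; this is the uniform (isotropic) distribution.  Every unitary map
   of S is the restriction of a unitary U of C^n that preserves S. *)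
definition uniform_on_unit_sphere :: "nat \<Rightarrow> cvec set \<Rightarrow> cvec measure \<Rightarrow> bool" where
  "uniform_on_unit_sphere n S \<mu> \<longleftrightarrow>
     prob_space \<mu> \<and> sets \<mu> = sets (cvec_space n) \<and>
     (AE x in \<mu>. x \<in> S \<and> cvec_norm x = 1) \<and>
     (\<forall>U\<in>carrier_mat n n. U * mat_adjoint U = 1\<^sub>m n \<and> (\<lambda>x. U *\<^sub>v x) ` S = S \<longrightarrow>
        distr \<mu> (cvec_space n) (\<lambda>x. U *\<^sub>v x) = \<mu>)"

definition orthogonal_compl :: "nat \<Rightarrow> cvec \<Rightarrow> cvec set" where
  "orthogonal_compl n u = {x \<in> carrier_vec n. x \<bullet>c u = 0}"

(* \<kappa> is a regular conditional distribution of Y (values in L) given X (values in N). *)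
definition is_cond_distr ::
  "'w measure \<Rightarrow> 'a measure \<Rightarrow> ('w \<Rightarrow> 'a) \<Rightarrow> 'b measure \<Rightarrow> ('w \<Rightarrow> 'b) \<Rightarrow> ('a \<Rightarrow> 'b measure) \<Rightarrow> bool" where
  "is_cond_distr M N X L Y \<kappa> \<longleftrightarrow>
     \<kappa> \<in> measurable N (prob_algebra L) \<and>
     (\<forall>B\<in>sets L. AE w in M.
        real_cond_exp M (vimage_algebra (space M) X N) (\<lambda>w. indicat_real B (Y w)) w
          = measure (\<kappa> (X w)) B)"

(* indep_var of the library requires both variables to have the same type of values. *)
definition (in prob_space) indep_rv ::
  "'b measure \<Rightarrow> ('a \<Rightarrow> 'b) \<Rightarrow> 'c measure \<Rightarrow> ('a \<Rightarrow> 'c) \<Rightarrow> bool" where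
  "indep_rv N X L Y \<longleftrightarrow>
     random_variable N X \<and> random_variable L Y \<and>
     indep_set (sets (vimage_algebra (space M) X N)) (sets (vimage_algebra (space M) Y L))"

(* Density of CN(0,1) with respect to Lebesgue measure on the complex plane. *)
definition std_cn_density :: "complex \<Rightarrow> real" where
  "std_cn_density z = exp (- (cmod z)\<^sup>2) / pi"

(* h i is the channel of user i, hh i its quantized direction, e i the unit error direction;
   sin2_angle (direction (h i w)) (hh i w) is d_c^2(i).  r need not be an integer.
   cn_marginal and cn_indep also fix the law of the norm of h i. *)

locale qub_feedback = prob_space M for M :: "'w measure" +
  fixes K :: nat
    and r :: real
    and h hh e :: "nat \<Rightarrow> 'w \<Rightarrow> cvec"
  assumes rv_h: "i < K \<Longrightarrow> h i \<in> measurable M (cvec_space K)"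
    and rv_hh: "i < K \<Longrightarrow> hh i \<in> measurable M (cvec_space K)"
    and rv_e: "i < K \<Longrightarrow> e i \<in> measurable M (cvec_space K)"
    and cn_indep: "i < K \<Longrightarrow> indep_vars (\<lambda>_. borel) (\<lambda>k w. h i w $ k) {..<K}"
    and cn_marginal: "\<lbrakk>i < K; k < K\<rbrakk> \<Longrightarrow> distributed M lborel (\<lambda>w. h i w $ k)
      (\<lambda>z. ennreal (std_cn_density z))"
    and hh_uniform: "i < K \<Longrightarrow>
      uniform_on_unit_sphere K (carrier_vec K) (distr M (cvec_space K) (hh i))"
    and decomposition: "i < K \<Longrightarrow> AE w in M.
      direction (h i w) =
        complex_of_real (sqrt (1 - sin2_angle (direction (h i w)) (hh i w))) \<cdot>\<^sub>v hh i w +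
        complex_of_real (sqrt (sin2_angle (direction (h i w)) (hh i w))) \<cdot>\<^sub>v e i w"
    and e_isotropic: "i < K \<Longrightarrow> \<exists>\<kappa>.
      is_cond_distr M (cvec_space K) (hh i) (cvec_space K) (e i) \<kappa> \<and>
      (\<forall>u\<in>carrier_vec K. cvec_norm u = 1 \<longrightarrow>
         uniform_on_unit_sphere K (orthogonal_compl K u) (\<kappa> u))"
    and dc2_indep: "i < K \<Longrightarrow>
      indep_rv borel (\<lambda>w. sin2_angle (direction (h i w)) (hh i w))
        (cvec_space K \<Otimes>\<^sub>M cvec_space K) (\<lambda>w. (e i w, hh i w))"
    and dc2_cdf: "\<lbrakk>i < K; 0 \<le> x; x \<le> 2 powr (- r / real (K - 1))\<rbrakk> \<Longrightarrow>
      prob {w \<in> space M. sin2_angle (direction (h i w)) (hh i w) \<le> x} = 2 powr r * x ^ (K - 1)"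
    and norm_indep: "i < K \<Longrightarrow>
      indep_rv borel (\<lambda>w. cvec_norm (h i w))
        (cvec_space K \<Otimes>\<^sub>M cvec_space K) (\<lambda>w. (direction (h i w), hh i w))"
    and users_indep:
      "indep_vars (\<lambda>_. cvec_space K \<Otimes>\<^sub>M cvec_space K) (\<lambda>i w. (h i w, hh i w)) {..<K}"

definition complex_cond_exp :: "'w measure \<Rightarrow> 'w measure \<Rightarrow> ('w \<Rightarrow> complex) \<Rightarrow> 'w \<Rightarrow> complex" where
  "complex_cond_exp M F f w =
     Complex (real_cond_exp M F (\<lambda>w. Re (f w)) w) (real_cond_exp M F (\<lambda>w. Im (f w)) w)"

definition mat_cond_exp ::
  "'w measure \<Rightarrow> 'w measure \<Rightarrow> nat \<Rightarrow> nat \<Rightarrow> ('w \<Rightarrow> cmat) \<Rightarrow> 'w \<Rightarrow> cmat" where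
  "mat_cond_exp M F m n X w = mat m n (\<lambda>(j, k). complex_cond_exp M F (\<lambda>w. X w $$ (j, k)) w)"

(* A singular matrix is sent to 0, so that mat_inv is total. *)
definition mat_inv :: "cmat \<Rightarrow> cmat" where
  "mat_inv A =
     (case mat_inverse A of Some B \<Rightarrow> B | None \<Rightarrow> 0\<^sub>m (dim_row A) (dim_col A))"

locale zf_dpc =
  fixes M :: "'w measure"
    and K s :: nat
    and P :: real
    and h hh :: "nat \<Rightarrow> 'w \<Rightarrow> cvec"
begin

(* The sigma-algebra generated by all the quantized directions hh 0, ..., hh (K - 1). *)
definition sigma_hh :: "'w measure" where
  "sigma_hh = vimage_algebra (space M) (\<lambda>w. \<lambda>i\<in>{..<K}. hh i w) (Pi\<^sub>M {..<K} (\<lambda>_. cvec_space K))"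

(* gram_schmidt of the library orthogonalizes without normalizing. *)
definition omega :: "nat \<Rightarrow> 'w \<Rightarrow> cvec" where
  "omega j w = direction (gram_schmidt K (map (\<lambda>i. hh i w) [0..<K]) ! j)"

definition h_col :: "nat \<Rightarrow> 'w \<Rightarrow> cmat" where
  "h_col i w = mat_of_cols K [h i w]"

definition omega_col :: "nat \<Rightarrow> 'w \<Rightarrow> cmat" where
  "omega_col i w = mat_of_cols K [omega i w]"

definition omega_before :: "nat \<Rightarrow> 'w \<Rightarrow> cmat" where
  "omega_before i w = mat_of_cols K (map (\<lambda>j. omega j w) [0..<i])"

definition nr :: "nat \<Rightarrow> 'w \<Rightarrow> real" where
  "nr i w = 1 + P / real s * (\<Sum>j<s. (cmod (omega j w \<bullet>c h i w))\<^sup>2)"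

definition M_mat :: "nat \<Rightarrow> 'w \<Rightarrow> cmat" where
  "M_mat i = mat_cond_exp M sigma_hh i i (\<lambda>w.
     complex_of_real (nr i w) \<cdot>\<^sub>m 1\<^sub>m i -
     complex_of_real (P / real s) \<cdot>\<^sub>m
       (mat_adjoint (omega_before i w) * h_col i w * mat_adjoint (h_col i w) * omega_before i w))"

(* For the first user (i = 0) this is the empty 1 x 0 matrix. *)
definition W :: "nat \<Rightarrow> 'w \<Rightarrow> cmat" where
  "W i w =
     complex_of_real (P / real s) \<cdot>\<^sub>m
       (mat_cond_exp M sigma_hh 1 i (\<lambda>w.
          mat_adjoint (omega_col i w) * h_col i w * mat_adjoint (h_col i w) * omega_before i w) w
        * mat_inv (M_mat i w))"

definition W_norm :: "nat \<Rightarrow> 'w \<Rightarrow> real" where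
  "W_norm i w = cvec_norm (row (W i w) 0)"

definition signal_term :: "nat \<Rightarrow> 'w \<Rightarrow> complex" where
  "signal_term i w =
     (mat_adjoint (h_col i w) * (omega_col i w + omega_before i w * mat_adjoint (W i w))) $$ (0, 0)"

definition rate :: "nat \<Rightarrow> real" where
  "rate i = (\<integral>w. real_cond_exp M sigma_hh (\<lambda>w.
     log 2 (nr i w /
       (nr i w * (1 + (W_norm i w)\<^sup>2) - P / real s * (cmod (signal_term i w))\<^sup>2))) w \<partial>M)"

end

definition NR :: "real \<Rightarrow> real \<Rightarrow> real \<Rightarrow> real" where
  "NR P sb rb = 1 + P / sb * (1 - 2 powr (- rb)) + P * 2 powr (- rb)"

definition x_inf :: "real \<Rightarrow> real \<Rightarrow> real \<Rightarrow> real \<Rightarrow> real" where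
  "x_inf P sb rb t =
     1 + (P / sb)\<^sup>2 * (1 - 2 powr (- rb))\<^sup>2 * (1 - t * sb) * (t * sb) /
       (1 + P * 2 powr (- rb) + P / sb * (1 - 2 powr (- rb)) * (1 - t * sb))\<^sup>2"

definition rho :: "real \<Rightarrow> real \<Rightarrow> real \<Rightarrow> real" where
  "rho P sb rb =
     sb * (log 2 (NR P sb rb) -
       integral {0..1} (\<lambda>t. log 2
         (NR P sb rb * x_inf P sb rb t -
          P / sb * (1 - 2 powr (- rb)) * (1 - t * sb) *
          (P / sb * (1 - 2 powr (- rb)) * (t * sb) /
             (1 + P / sb * (1 - 2 powr (- rb)) * (1 - t * sb) + P * 2 powr (- rb)) + 1)\<^sup>2)))"

end

theory Submission
  imports Defs
begin

text \<open>
  Fix a user i and write u for its quantized direction, e for its error direction, p = P/s,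
  D for 2 to the power -r/(K-1), and c^2 = 1 - sum over k < i of |omega_k^* u|^2, so that omega_i^* u = c.
  Given the quantized directions, E(h h^*) = K (1 - D) u u^* + D I.  Hence M_i is a rank-one
  perturbation of a multiple of the identity, and W_i is an explicit multiple of u^* [omega_k]_k<i.

  Both nr and the denominator inside the logarithm of the rate are at least 1, where ln is
  1-Lipschitz, so estimates in L1 suffice.  Three quantities have to be replaced by constants, each with a
  variance of order 1/K after normalization: |h|^2, the sum over j < s of |omega_j^* e|^2, and c^2.  For the last two
  this is a computation of fourth moments of the uniform distribution on a sphere, which follow
  from invariance under reflections and polarization.  The cross term between u and e in nr
  vanishes because u lies in the span of omega_0, ..., omega_(s-1) and e is orthogonal to u.

  With mu = p K (1 - D) and b = 1 + p D (s - 1), the limiting denominator collapses to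
  (b + mu) b / (b + mu c^2), so the rate of user i is log (1 + mu/b (1 - i/K)) up to an error that is of
  order K^(-1/2) uniformly in i.  The average over the users is then a Riemann sum, and the same
  algebraic identity simplifies the integrand of rho.
\<close>

subsection \<open>Hermitian forms on coordinate functions\<close>

text \<open>The second moment K (1 - D) u u^* + D I is exact, not asymptotic: the spherical cap has
  E d = D (K - 1) / K for d = \<open>d i\<close>, the squared sine of the angle between h and u, and
  its factor K - 1 cancels the K - 1 complex dimensions over which the error energy is spread. The
  row of conditional means in W_i is then a left eigenvector of M_i, which is why the inverse acts
  on it as a scalar. The obstacle is conditioning on all quantized directions at once. The model
  gives independence user by user, the conditional law of e only given the same user's u, and no
  integrability. Decoupling and disintegration are therefore stated for nonnegative integrals, and
  integrability is read off from finite results. Two facts make the beam vectors tractable: omega_0,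
  ..., omega_(i-1) depend only on the earlier users, so they form a frame independent of u; and once
  all directions are fixed, every omega_j is a constant frame for e. The lower bound 1 on the
  denominator is pointwise, by Cauchy-Schwarz against the coordinates of the inflated beam, so no
  tail estimate for small denominators arises.\<close>

definition cip :: "nat \<Rightarrow> (nat \<Rightarrow> complex) \<Rightarrow> (nat \<Rightarrow> complex) \<Rightarrow> complex" where
  "cip n f g = (\<Sum>k<n. f k * cnj (g k))"

definition sqn :: "nat \<Rightarrow> (nat \<Rightarrow> complex) \<Rightarrow> real" where
  "sqn n f = (\<Sum>k<n. (cmod (f k))\<^sup>2)"

text \<open>Working with functions on the naturals rather than with vectors frees these identities
  of dimension side conditions; entries from index n on are never read.\<close>

lemma cip_add_left: "cip n (\<lambda>k. f k + g k) y = cip n f y + cip n g y"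
  by (simp add: cip_def sum.distrib algebra_simps)
lemma cip_diff_left: "cip n (\<lambda>k. f k - g k) y = cip n f y - cip n g y"
  by (simp add: cip_def sum_subtractf algebra_simps)
lemma cip_scale_left: "cip n (\<lambda>k. c * f k) y = c * cip n f y"
  by (simp add: cip_def sum_distrib_left algebra_simps)
lemma cip_sum_left: "cip n (\<lambda>k. \<Sum>j\<in>A. f j k) y = (\<Sum>j\<in>A. cip n (f j) y)"
  unfolding cip_def sum_distrib_right by (rule sum.swap)
lemma cip_add_right: "cip n y (\<lambda>k. f k + g k) = cip n y f + cip n y g"
  by (simp add: cip_def sum.distrib algebra_simps)
lemma cip_diff_right: "cip n y (\<lambda>k. f k - g k) = cip n y f - cip n y g"
  by (simp add: cip_def sum_subtractf algebra_simps)
lemma cip_scale_right: "cip n y (\<lambda>k. c * f k) = cnj c * cip n y f"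
  by (simp add: cip_def sum_distrib_left algebra_simps)
lemma cip_sum_right: "cip n y (\<lambda>k. \<Sum>j\<in>A. f j k) = (\<Sum>j\<in>A. cip n y (f j))"
  unfolding cip_def cnj_sum sum_distrib_left by (rule sum.swap)
lemmas cip_linear = cip_add_left cip_diff_left cip_scale_left cip_sum_left
  cip_add_right cip_diff_right cip_scale_right cip_sum_right

lemma cnj_cip: "cnj (cip n f g) = cip n g f"
  by (simp add: cip_def mult.commute)

lemma cip_self: "cip n f f = complex_of_real (sqn n f)"
  by (simp add: cip_def sqn_def complex_norm_square[symmetric] del: of_real_power)

lemma cip_cong: "(\<And>k. k < n \<Longrightarrow> f k = f' k) \<Longrightarrow> (\<And>k. k < n \<Longrightarrow> g k = g' k) \<Longrightarrow> cip n f g = cip n f' g'"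
  unfolding cip_def by (rule sum.cong) auto

lemma sqn_cong: "(\<And>k. k < n \<Longrightarrow> f k = f' k) \<Longrightarrow> sqn n f = sqn n f'"
  unfolding sqn_def by (rule sum.cong) auto

lemma sqn_eq_Re_cip: "sqn n f = Re (cip n f f)"
  by (simp add: cip_self)

lemma sqn_nonneg: "0 \<le> sqn n f"
  by (simp add: sqn_def sum_nonneg)

lemma sqn_zero_iff: "sqn n f = 0 \<longleftrightarrow> (\<forall>k<n. f k = 0)"
  by (auto simp: sqn_def sum_nonneg_eq_0_iff)

lemma sqn_scale: "sqn n (\<lambda>k. c * f k) = (cmod c)\<^sup>2 * sqn n f"
  by (simp add: sqn_def sum_distrib_left norm_mult power_mult_distrib)

lemma cip_Cauchy_Schwarz: "(cmod (cip n f g))\<^sup>2 \<le> sqn n f * sqn n g"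
proof -
  have "cmod (cip n f g) \<le> (\<Sum>k<n. cmod (f k) * cmod (g k))"
    unfolding cip_def by (rule order_trans[OF norm_sum]) (simp add: norm_mult)
  hence "(cmod (cip n f g))\<^sup>2 \<le> (\<Sum>k<n. cmod (f k) * cmod (g k))\<^sup>2"
    by (rule power_mono) simp
  also have "\<dots> \<le> sqn n f * sqn n g"
    unfolding sqn_def by (rule Cauchy_Schwarz_ineq_sum)
  finally show ?thesis .
qed

lemma cmod_add_sq: "(cmod (z + w))\<^sup>2 = (cmod z)\<^sup>2 + (cmod w)\<^sup>2 + 2 * Re (z * cnj w)"
  by (simp only: cmod_power2) (simp add: power2_eq_square algebra_simps)

lemma sqn_add: "sqn n (\<lambda>k. f k + g k) = sqn n f + sqn n g + 2 * Re (cip n f g)"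
  unfolding sqn_def cip_def cmod_add_sq by (simp add: sum.distrib sum_distrib_left)

lemma sqn_diff: "sqn n (\<lambda>k. f k - g k) = sqn n f + sqn n g - 2 * Re (cip n f g)"
proof -
  have "sqn n (\<lambda>k. f k + (-1) * g k) = sqn n f + sqn n (\<lambda>k. (-1) * g k) + 2 * Re (cip n f (\<lambda>k. (-1) * g k))"
    by (rule sqn_add)
  thus ?thesis unfolding sqn_scale cip_scale_right by simp
qed

lemma Re_mult_cnj_polar: "4 * Re (z * cnj w) = (cmod (z + w))\<^sup>2 - (cmod (z - w))\<^sup>2"
  by (simp only: cmod_power2) (simp add: power2_eq_square algebra_simps)

section \<open>The Borel space of complex vectors\<close>

lemma space_cvec_space [simp]: "space (cvec_space n) = carrier_vec n"
  by (simp add: cvec_space_def)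

lemma measurable_cvec_coord [measurable]:
  "k < n \<Longrightarrow> (\<lambda>v. v $ k) \<in> borel_measurable (cvec_space n)"
proof -
  assume k: "k < n"
  have "(\<lambda>v. \<lambda>k\<in>{..<n}. v $ k) \<in> measurable (cvec_space n) (Pi\<^sub>M {..<n} (\<lambda>_. borel :: complex measure))"
    unfolding cvec_space_def by (rule measurable_vimage_algebra1) (auto simp: space_PiM)
  from measurable_compose[OF this measurable_component_singleton[of k]] k
  have "(\<lambda>v. (\<lambda>k\<in>{..<n}. v $ k) k) \<in> borel_measurable (cvec_space n)" by simp
  thus ?thesis using k by simp
qed

lemma measurable_cvec_spaceI:
  assumes "\<And>x. x \<in> space N \<Longrightarrow> f x \<in> carrier_vec n"
    and "\<And>k. k < n \<Longrightarrow> (\<lambda>x. f x $ k) \<in> borel_measurable N"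
  shows "f \<in> measurable N (cvec_space n)"
  unfolding cvec_space_def
proof (rule measurable_vimage_algebra2)
  show "f \<in> space N \<rightarrow> carrier_vec n" using assms by auto
  show "(\<lambda>x. \<lambda>k\<in>{..<n}. f x $ k) \<in> measurable N (Pi\<^sub>M {..<n} (\<lambda>_. borel))"
    by (rule measurable_restrict) (use assms in auto)
qed

lemma measurable_cip [measurable (raw)]:
  assumes "\<And>k. k < n \<Longrightarrow> (\<lambda>x. f x k) \<in> borel_measurable N" "\<And>k. k < n \<Longrightarrow> (\<lambda>x. g x k) \<in> borel_measurable N"
  shows "(\<lambda>x. cip n (f x) (g x)) \<in> borel_measurable N"
  unfolding cip_def using assms
  by (auto intro!: borel_measurable_sum borel_measurable_times borel_measurable_continuous_onI
       measurable_compose[of _ N borel cnj borel] continuous_intros)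

lemma measurable_sqn [measurable (raw)]:
  assumes "\<And>k. k < n \<Longrightarrow> (\<lambda>x. f x k) \<in> borel_measurable N"
  shows "(\<lambda>x. sqn n (f x)) \<in> borel_measurable N"
  unfolding sqn_def using assms by auto

lemma scalar_prod_eq_cip:
  "dim_vec v = n \<Longrightarrow> dim_vec w = n \<Longrightarrow> v \<bullet>c w = cip n (($) v) (($) w)"
  by (simp add: scalar_prod_def cip_def atLeast0LessThan)

lemma cvec_norm_eq_sqn: "cvec_norm v = sqrt (sqn (dim_vec v) (($) v))"
  by (simp add: cvec_norm_def sqn_def)

text \<open>The unitary is the Householder reflection I - 2 y y^* with y a unit vector orthogonal to
  u. It preserves the form with u and is an involution, hence maps the complement of u onto itself.
  Such reflections can exchange two vectors or flip the sign of one, which is all that the moment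
  computations need.\<close>

lemma uniform_reflection:
  assumes U: "uniform_on_unit_sphere n (orthogonal_compl n u) \<mu>"
    and u: "u \<in> carrier_vec n" and y: "sqn n y = 1" "cip n y (($) u) = 0"
    and f: "f \<in> borel_measurable (cvec_space n)"
  shows "(\<integral>x. f (vec n (\<lambda>k. x $ k - 2 * cip n (($) x) y * y k)) \<partial>\<mu>) = (\<integral>x. f x \<partial>\<mu>)" (is "_ = _")
    and "integrable \<mu> (\<lambda>x. f (vec n (\<lambda>k. x $ k - 2 * cip n (($) x) y * y k)) :: real) \<longleftrightarrow> integrable \<mu> f"
proof -
  define R where "R x = vec n (\<lambda>k. x $ k - 2 * cip n (($) x) y * y k)" for x
  define A where "A = mat n n (\<lambda>(k,l). (if k = l then 1 else 0) - 2 * y k * cnj (y l))"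
  have A: "A \<in> carrier_mat n n" by (simp add: A_def)
  have sets: "sets \<mu> = sets (cvec_space n)" using U by (simp add: uniform_on_unit_sphere_def)
  hence sp: "space \<mu> = carrier_vec n" by (metis sets_eq_imp_space_eq space_cvec_space)
  have yy: "(\<Sum>l<n. y l * cnj (y l)) = 1" using y cip_self[of n y] by (simp add: cip_def)
  have AR: "A *\<^sub>v x = R x" if "x \<in> carrier_vec n" for x
  proof (rule eq_vecI)
    show "dim_vec (A *\<^sub>v x) = dim_vec (R x)" by (simp add: A_def R_def)
    fix k assume "k < dim_vec (R x)"
    hence k: "k < n" by (simp add: R_def)
    have "(A *\<^sub>v x) $ k = (\<Sum>l<n. ((if k = l then 1 else 0) - 2 * y k * cnj (y l)) * x $ l)"
      using k that by (simp add: A_def scalar_prod_def atLeast0LessThan)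
    also have "\<dots> = (\<Sum>l<n. (if k = l then x $ l else 0)) - (\<Sum>l<n. 2 * y k * (x $ l * cnj (y l)))"
      by (subst sum_subtractf[symmetric], rule sum.cong) (auto simp: algebra_simps)
    also have "\<dots> = x $ k - 2 * y k * cip n (($) x) y"
      using k by (simp add: cip_def sum_distrib_left)
    finally show "(A *\<^sub>v x) $ k = R x $ k" using k by (simp add: R_def mult_ac)
  qed
  have AA: "A * mat_adjoint A = 1\<^sub>m n"
  proof (rule eq_matI)
    show "dim_row (A * mat_adjoint A) = dim_row (1\<^sub>m n)" "dim_col (A * mat_adjoint A) = dim_col (1\<^sub>m n)"
      by (simp_all add: A_def mat_adjoint_def)
    fix i j assume "i < dim_row (1\<^sub>m n :: complex mat)" "j < dim_col (1\<^sub>m n :: complex mat)"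
    hence ij: "i < n" "j < n" by simp_all
    have "(A * mat_adjoint A) $$ (i,j) = (\<Sum>l<n. A $$ (i,l) * cnj (A $$ (j,l)))"
      using ij by (simp add: A_def mat_adjoint_def scalar_prod_def atLeast0LessThan mat_of_rows_def)
    also have "\<dots> = (\<Sum>l<n. ((if i = l then 1 else 0) - 2 * y i * cnj (y l)) * ((if j = l then 1 else 0) - 2 * cnj (y j) * y l))"
      using ij by (intro sum.cong) (auto simp: A_def)
    also have "\<dots> = (\<Sum>l<n. (if i = l then (if j = l then 1 else 0) else 0)
        - (if i = l then 2 * cnj (y j) * y l else 0) - (if j = l then 2 * y i * cnj (y l) else 0)
        + 4 * y i * cnj (y j) * (y l * cnj (y l)))"
      by (rule sum.cong) (auto simp: algebra_simps)
    also have "\<dots> = (if i = j then 1 else 0) - 2 * cnj (y j) * y i - 2 * y i * cnj (y j) + 4 * y i * cnj (y j) * (\<Sum>l<n. y l * cnj (y l))"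
      using ij by (auto simp: sum.distrib sum_subtractf sum_distrib_left)
    also have "\<dots> = (if i = j then 1 else 0)" unfolding yy by simp
    finally show "(A * mat_adjoint A) $$ (i,j) = 1\<^sub>m n $$ (i,j)" using ij by simp
  qed
  have Rcip: "cip n (($) (R x)) z = cip n (($) x) z - 2 * cip n (($) x) y * cip n y z" for x z
  proof -
    have "cip n (($) (R x)) z = cip n (\<lambda>k. x $ k - (2 * cip n (($) x) y) * y k) z"
      by (rule cip_cong) (auto simp: R_def)
    thus ?thesis by (simp add: cip_diff_left cip_scale_left)
  qed
  have RR: "R (R x) = x" if "x \<in> carrier_vec n" for x
  proof (rule eq_vecI)
    show "dim_vec (R (R x)) = dim_vec x" using that by (simp add: R_def)
    fix k assume "k < dim_vec x"
    hence k: "k < n" using that by simp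
    have "cip n (($) (R x)) y = - cip n (($) x) y"
      unfolding Rcip using y(1) by (simp add: cip_self)
    thus "R (R x) $ k = x $ k" using k by (simp add: R_def[of "R x"]) (simp add: R_def)
  qed
  have RS: "R x \<in> orthogonal_compl n u" if "x \<in> orthogonal_compl n u" for x
  proof -
    have x: "x \<in> carrier_vec n" "cip n (($) x) (($) u) = 0"
      using that u by (auto simp: orthogonal_compl_def scalar_prod_eq_cip[of _ n])
    have "R x \<in> carrier_vec n" by (simp add: R_def)
    moreover have "cip n (($) (R x)) (($) u) = 0" unfolding Rcip using x y by simp
    ultimately show ?thesis using u by (simp add: orthogonal_compl_def scalar_prod_eq_cip[of _ n])
  qed
  have img: "(\<lambda>x. A *\<^sub>v x) ` orthogonal_compl n u = orthogonal_compl n u"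
  proof -
    have c: "\<And>x. x \<in> orthogonal_compl n u \<Longrightarrow> x \<in> carrier_vec n" by (simp add: orthogonal_compl_def)
    have "(\<lambda>x. A *\<^sub>v x) ` orthogonal_compl n u = R ` orthogonal_compl n u"
      using AR c by (intro image_cong) auto
    also have "\<dots> = orthogonal_compl n u"
      using RS RR c by (auto simp: image_iff) metis
    finally show ?thesis .
  qed
  have inv: "distr \<mu> (cvec_space n) (\<lambda>x. A *\<^sub>v x) = \<mu>"
    using U A AA img unfolding uniform_on_unit_sphere_def by blast
  have Rm: "R \<in> measurable (cvec_space n) (cvec_space n)"
    by (rule measurable_cvec_spaceI) (simp_all add: R_def)
  hence Rm': "R \<in> measurable \<mu> (cvec_space n)" using sets by (simp cong: measurable_cong_sets)
  have "distr \<mu> (cvec_space n) R = \<mu>"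
    using inv AR sp by (subst distr_cong[of \<mu> \<mu> "cvec_space n" "cvec_space n" R "\<lambda>x. A *\<^sub>v x"]) auto
  with integral_distr[OF Rm' f] integrable_distr_eq[OF Rm' f]
  show "(\<integral>x. f (vec n (\<lambda>k. x $ k - 2 * cip n (($) x) y * y k)) \<partial>\<mu>) = (\<integral>x. f x \<partial>\<mu>)"
    "integrable \<mu> (\<lambda>x. f (vec n (\<lambda>k. x $ k - 2 * cip n (($) x) y * y k))) \<longleftrightarrow> integrable \<mu> f"
    by (simp_all add: R_def)
qed

subsection \<open>Moments of the uniform distribution on a sphere\<close>

text \<open>Polarization: it recovers a product of two squared moduli from fourth powers of single
  linear forms, whose moments isotropy determines.\<close>

lemma cmod_polar4:
  "(cmod (z + w))^4 + (cmod (z - w))^4 + (cmod (z + \<i> * w))^4 + (cmod (z - \<i> * w))^4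
   = 4 * (cmod z)^4 + 4 * (cmod w)^4 + 16 * ((cmod z)\<^sup>2 * (cmod w)\<^sup>2)"
proof -
  have p4: "\<And>x::real. x^4 = (x^2)^2" by simp
  show ?thesis unfolding p4 cmod_power2
    by (simp add: power2_eq_square algebra_simps)
qed

lemma cmod_parallelogram: "(cmod (z + w))\<^sup>2 + (cmod (z - w))\<^sup>2 = 2 * ((cmod z)\<^sup>2 + (cmod w)\<^sup>2)"
  unfolding cmod_power2 by (simp add: power2_eq_square algebra_simps)

text \<open>The sum is the form of v with the Vandermonde vector (1, l, l^2, ...), so this bounds
  how many of these vectors are orthogonal to a given nonzero vector.\<close>

lemma polyfun_zero_count:
  assumes "0 < sqn n v"
  shows "finite {l::nat. (\<Sum>k<n. v k * of_nat l ^ k) = 0}"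
    "card {l::nat. (\<Sum>k<n. v k * of_nat l ^ k) = 0} \<le> n"
proof -
  obtain k where k: "k < n" "v k \<noteq> 0" using assms sqn_zero_iff[of n v] by fastforce
  have e: "(\<Sum>k<n. v k * z ^ k) = (\<Sum>k\<le>n-1. v k * z ^ k)" for z
    using k by (intro sum.cong) auto
  have ex: "\<exists>j\<le>n-1. v j \<noteq> 0" using k by (intro exI[of _ k]) auto
  have *: "finite {z. (\<Sum>k<n. v k * z ^ k) = 0} \<and> card {z. (\<Sum>k<n. v k * z ^ k) = 0} \<le> n - 1"
    unfolding e using ex by (rule polyfun_rootbound)
  have sub: "of_nat ` {l::nat. (\<Sum>k<n. v k * of_nat l ^ k) = 0} \<subseteq> {z. (\<Sum>k<n. v k * z ^ k) = 0}"
    by auto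
  have inj: "inj_on (of_nat :: nat \<Rightarrow> complex) A" for A by (simp add: inj_on_def)
  show "finite {l::nat. (\<Sum>k<n. v k * of_nat l ^ k) = 0}"
    using finite_subset[OF sub] * finite_imageD[OF _ inj] by blast
  show "card {l::nat. (\<Sum>k<n. v k * of_nat l ^ k) = 0} \<le> n"
    using card_mono[OF _ sub] * card_image[OF inj, of "{l::nat. (\<Sum>k<n. v k * of_nat l ^ k) = 0}"] by linarith
qed

text \<open>Two instances occur. For u = 0 the complement is the whole space and \<mu> is the law of
  a quantized direction; for a unit vector u it is the conditional law of the error direction. The
  parameter \<open>\<theta>\<close> below, the squared norm of u, is 0 or 1 accordingly.\<close>

locale uniform_sphere =
  fixes n :: nat and u :: cvec and \<mu> :: "cvec measure"
  assumes U: "uniform_on_unit_sphere n (orthogonal_compl n u) \<mu>" and u: "u \<in> carrier_vec n"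
begin

sublocale prob_space \<mu> using U by (simp add: uniform_on_unit_sphere_def)

lemma sets_\<mu> [measurable_cong]: "sets \<mu> = sets (cvec_space n)"
  using U by (simp add: uniform_on_unit_sphere_def)

lemma AE_unit: "AE x in \<mu>. x \<in> carrier_vec n \<and> cip n (($) x) (($) u) = 0 \<and> sqn n (($) x) = 1"
proof -
  have "AE x in \<mu>. x \<in> orthogonal_compl n u \<and> cvec_norm x = 1"
    using U by (simp add: uniform_on_unit_sphere_def)
  thus ?thesis
    by eventually_elim (use u in \<open>auto simp: orthogonal_compl_def scalar_prod_eq_cip[of _ n] cvec_norm_eq_sqn\<close>)
qed

lemma measurable_cip_coord [measurable]: "(\<lambda>x. cip n (($) x) a) \<in> borel_measurable \<mu>"
  by (rule measurable_cip) auto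

lemma measurable_cip_coord' [measurable]: "(\<lambda>x. cip n (($) x) a) \<in> borel_measurable (cvec_space n)"
  by (rule measurable_cip) auto

lemma cip_reflect:
  "cip n (($) (vec n (\<lambda>k. x $ k - 2 * cip n (($) x) y * y k))) z = cip n (($) x) z - 2 * cip n (($) x) y * cip n y z"
proof -
  have "cip n (($) (vec n (\<lambda>k. x $ k - 2 * cip n (($) x) y * y k))) z
      = cip n (\<lambda>k. x $ k - (2 * cip n (($) x) y) * y k) z"
    by (rule cip_cong) auto
  thus ?thesis by (simp add: cip_diff_left cip_scale_left)
qed

text \<open>
  After multiplying b by a phase that makes the form of a and b real, the reflection in the
  direction a - b exchanges a and b.
\<close>
lemma integral_cip_isotropic:
  fixes F :: "real \<Rightarrow> real"
  assumes a: "cip n a (($) u) = 0" and b: "cip n b (($) u) = 0" and ab: "sqn n a = sqn n b"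
    and F [measurable]: "F \<in> borel_measurable borel"
  shows "(\<integral>x. F (cmod (cip n (($) x) a)) \<partial>\<mu>) = (\<integral>x. F (cmod (cip n (($) x) b)) \<partial>\<mu>)"
proof -
  define z where "z = cip n a b"
  define \<xi> where "\<xi> = (if z = 0 then 1 else z / of_real (cmod z))"
  have \<xi>1: "cmod \<xi> = 1" by (auto simp: \<xi>_def norm_divide)
  have \<xi>z: "cnj \<xi> * z = of_real (cmod z)"
    using complex_norm_square[of z] by (auto simp: \<xi>_def field_simps power2_eq_square)
  define b' where "b' = (\<lambda>k. \<xi> * b k)"
  have sb': "sqn n b' = sqn n a" by (simp add: b'_def sqn_scale \<xi>1 ab)
  have cab': "cip n a b' = of_real (cmod z)" by (simp add: b'_def cip_scale_right z_def[symmetric] \<xi>z)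
  have cxb': "cmod (cip n x b') = cmod (cip n x b)" for x
    by (simp add: b'_def cip_scale_right norm_mult \<xi>1)
  define w where "w = (\<lambda>k. a k - b' k)"
  define N where "N = sqn n w"
  show ?thesis
  proof (cases "N = 0")
    case True
    hence "\<And>k. k < n \<Longrightarrow> a k = b' k" by (simp add: N_def sqn_zero_iff w_def)
    hence "cip n x a = cip n x b'" for x by (intro cip_cong) auto
    thus ?thesis by (simp add: cxb')
  next
    case False
    hence N: "N > 0" using sqn_nonneg[of n w] by (simp add: N_def)
    have Ne: "N = 2 * sqn n a - 2 * cmod z"
      by (simp add: N_def w_def sqn_diff sb' cab')
    define y where "y = (\<lambda>k. of_real (1 / sqrt N) * w k)"
    have y1: "sqn n y = 1" unfolding y_def sqn_scale using N by (simp add: N_def[symmetric] norm_divide power_divide)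
    have b'u: "cip n b' (($) u) = 0" by (simp add: b'_def cip_scale_left b)
    have yu: "cip n y (($) u) = 0" unfolding y_def cip_scale_left by (simp add: w_def cip_linear a b'u)
    have wb': "cip n w b' = - of_real N / 2"
      by (simp add: w_def cip_linear cab' cip_self sb' Ne)
    have yy: "2 * cip n x y * cip n y b' = - cip n x w" for x
    proof -
      have "2 * cip n x y * cip n y b' = 2 * of_real (1 / sqrt N * (1 / sqrt N)) * cip n x w * cip n w b'"
        unfolding y_def cip_scale_left cip_scale_right of_real_mult by simp
      also have "1 / sqrt N * (1 / sqrt N) = 1 / N" using N by (simp add: real_sqrt_mult[symmetric])
      finally show ?thesis using N by (simp add: wb')
    qed
    have "(\<integral>x. F (cmod (cip n (($) x) b')) \<partial>\<mu>)
       = (\<integral>x. F (cmod (cip n (($) (vec n (\<lambda>k. x $ k - 2 * cip n (($) x) y * y k))) b')) \<partial>\<mu>)"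
      by (rule uniform_reflection(1)[OF U u y1 yu, symmetric]) measurable
    also have "\<dots> = (\<integral>x. F (cmod (cip n (($) x) a)) \<partial>\<mu>)"
      unfolding cip_reflect yy by (simp add: w_def cip_diff_right)
    finally show ?thesis by (simp add: cxb')
  qed
qed

lemma integrable_bounded:
  assumes "f \<in> borel_measurable \<mu>" "AE x in \<mu>. \<bar>f x\<bar> \<le> (B::real)"
  shows "integrable \<mu> f"
  using assms by (intro integrable_const_bound[of f B]) auto

lemma AE_cip_bound: "AE x in \<mu>. (cmod (cip n (($) x) a))\<^sup>2 \<le> sqn n a"
  using AE_unit
proof eventually_elim
  case (elim x)
  thus ?case using cip_Cauchy_Schwarz[of n "($) x" a] by simp
qed

lemma integrable_cip2: "integrable \<mu> (\<lambda>x. (cmod (cip n (($) x) a))\<^sup>2)"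
  by (rule integrable_bounded[of _ "sqn n a"]) (use AE_cip_bound[of a] in auto)

lemma integrable_cip22: "integrable \<mu> (\<lambda>x. (cmod (cip n (($) x) a))\<^sup>2 * (cmod (cip n (($) x) b))\<^sup>2)"
proof (rule integrable_bounded[of _ "sqn n a * sqn n b"])
  show "AE x in \<mu>. \<bar>(cmod (cip n (($) x) a))\<^sup>2 * (cmod (cip n (($) x) b))\<^sup>2\<bar> \<le> sqn n a * sqn n b"
    using AE_cip_bound[of a] AE_cip_bound[of b]
    by eventually_elim (simp add: abs_mult, intro mult_mono, auto simp: sqn_nonneg)
qed measurable

lemma integrable_cip4: "integrable \<mu> (\<lambda>x. (cmod (cip n (($) x) a))^4)"
proof -
  have "\<And>x::real. x^4 = x\<^sup>2 * x\<^sup>2" by (simp add: power4_eq_xxxx power2_eq_square)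
  thus ?thesis using integrable_cip22[of a a] by simp
qed

text \<open>Isotropy and scaling reduce every moment to that of one reference unit vector; its
  moments are the two constants.\<close>

lemma homogeneous_moments:
  obtains c2 c4 where
    "\<And>a. cip n a (($) u) = 0 \<Longrightarrow> (\<integral>x. (cmod (cip n (($) x) a))\<^sup>2 \<partial>\<mu>) = c2 * sqn n a"
    "\<And>a. cip n a (($) u) = 0 \<Longrightarrow> (\<integral>x. (cmod (cip n (($) x) a))^4 \<partial>\<mu>) = c4 * (sqn n a)\<^sup>2"
proof -
  \<comment> \<open>The reference vector is any point outside the null set of
    \<open>AE_unit\<close>. One exists because the space has mass 1, so no argument about the
    dimension is required.\<close>
  obtain x0 where x0: "cip n (($) x0) (($) u) = 0" "sqn n (($) x0) = 1"
    using eventually_happens[OF AE_unit] by (auto simp: trivial_limit_def ae_filter_eq_bot_iff prob_space emeasure_space_1)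
  have *: "(\<integral>x. (cmod (cip n (($) x) a))^p \<partial>\<mu>) = (sqrt (sqn n a))^p * (\<integral>x. (cmod (cip n (($) x) (($) x0)))^p \<partial>\<mu>)"
    if "cip n a (($) u) = 0" for a and p :: nat
  proof -
    define b where "b = (\<lambda>k. complex_of_real (sqrt (sqn n a)) * x0 $ k)"
    have "cip n b (($) u) = 0" "sqn n b = sqn n a"
      by (simp_all add: b_def cip_scale_left sqn_scale x0 sqn_nonneg)
    hence "(\<integral>x. (cmod (cip n (($) x) a))^p \<partial>\<mu>) = (\<integral>x. (cmod (cip n (($) x) b))^p \<partial>\<mu>)"
      using integral_cip_isotropic[of a b "\<lambda>x. x^p"] that by simp
    also have "\<dots> = (\<integral>x. (sqrt (sqn n a))^p * (cmod (cip n (($) x) (($) x0)))^p \<partial>\<mu>)"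
      by (simp add: b_def cip_scale_right norm_mult power_mult_distrib sqn_nonneg)
    finally show ?thesis by simp
  qed
  have p4: "\<And>x::real. x^4 = (x\<^sup>2)\<^sup>2" by simp
  show thesis
    by (rule that[of "(\<integral>x. (cmod (cip n (($) x) (($) x0)))\<^sup>2 \<partial>\<mu>)" "(\<integral>x. (cmod (cip n (($) x) (($) x0)))^4 \<partial>\<mu>)"])
       (simp_all add: *[of _ 2] *[of _ 4] sqn_nonneg p4[of "sqrt (sqn n _)"])
qed

text \<open>The combinations of a and b in \<open>cmod_polar4\<close> are again orthogonal to u, so
  each fourth moment is c4 times the square of a squared norm. In the sum of these squares the terms
  linear in the real and imaginary part of the form of a and b cancel.\<close>

lemma joint_moment:
  assumes c4: "\<And>a. cip n a (($) u) = 0 \<Longrightarrow> (\<integral>x. (cmod (cip n (($) x) a))^4 \<partial>\<mu>) = c4 * (sqn n a)\<^sup>2"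
    and a: "cip n a (($) u) = 0" and b: "cip n b (($) u) = 0"
  shows "(\<integral>x. (cmod (cip n (($) x) a))\<^sup>2 * (cmod (cip n (($) x) b))\<^sup>2 \<partial>\<mu>)
    = c4 / 2 * (sqn n a * sqn n b + (cmod (cip n a b))\<^sup>2)"
proof -
  let ?z = "cip n a b"
  define ap where "ap = (\<lambda>k. a k + b k)"
  define am where "am = (\<lambda>k. a k - b k)"
  define aip where "aip = (\<lambda>k. a k + \<i> * b k)"
  define aim where "aim = (\<lambda>k. a k - \<i> * b k)"
  have pt: "16 * ((cmod (cip n x a))\<^sup>2 * (cmod (cip n x b))\<^sup>2)
     = (cmod (cip n x ap))^4 + (cmod (cip n x am))^4 + (cmod (cip n x aip))^4 + (cmod (cip n x aim))^4
       - 4 * (cmod (cip n x a))^4 - 4 * (cmod (cip n x b))^4" for x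
    using cmod_polar4[of "cip n x a" "cip n x b"]
    by (simp add: ap_def am_def aip_def aim_def cip_linear)
  have u0: "cip n ap (($) u) = 0" "cip n am (($) u) = 0" "cip n aip (($) u) = 0" "cip n aim (($) u) = 0"
    by (simp_all add: ap_def am_def aip_def aim_def cip_linear a b)
  let ?s = "sqn n a + sqn n b"
  have ib: "sqn n (\<lambda>k. \<i> * b k) = sqn n b" by (simp add: sqn_scale)
  have sq: "sqn n ap = ?s + 2 * Re ?z" "sqn n am = ?s - 2 * Re ?z"
     "sqn n aip = ?s + 2 * Im ?z" "sqn n aim = ?s - 2 * Im ?z"
    by (simp_all add: ap_def am_def aip_def aim_def sqn_add sqn_diff ib cip_scale_right)
  have "16 * (\<integral>x. (cmod (cip n (($) x) a))\<^sup>2 * (cmod (cip n (($) x) b))\<^sup>2 \<partial>\<mu>)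
     = (\<integral>x. 16 * ((cmod (cip n (($) x) a))\<^sup>2 * (cmod (cip n (($) x) b))\<^sup>2) \<partial>\<mu>)"
    by simp
  also have "\<dots> = c4 * (sqn n ap)\<^sup>2 + c4 * (sqn n am)\<^sup>2 + c4 * (sqn n aip)\<^sup>2 + c4 * (sqn n aim)\<^sup>2
       - 4 * (c4 * (sqn n a)\<^sup>2) - 4 * (c4 * (sqn n b)\<^sup>2)"
    unfolding pt by (simp add: integrable_cip4 c4 u0 a b)
  also have "\<dots> = c4 * (8 * (sqn n a * sqn n b) + 8 * ((Re ?z)\<^sup>2 + (Im ?z)\<^sup>2))"
    unfolding sq by (simp add: power2_eq_square algebra_simps)
  finally show ?thesis unfolding cmod_power2[of "cip n a b"] by (simp add: algebra_simps)
qed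

context
  fixes o' :: "nat \<Rightarrow> nat \<Rightarrow> complex" and l :: nat and \<theta> :: real
  assumes orth: "\<And>j k. j < l \<Longrightarrow> k < l \<Longrightarrow> cip n (o' j) (o' k) = (if j = k then 1 else 0)"
    and th: "(\<Sum>j<l. (cmod (cip n (o' j) (($) u)))\<^sup>2) = \<theta>" "sqn n (($) u) = \<theta>" "\<theta> = 0 \<or> \<theta> = 1"
begin

text \<open>The assumption \<open>th\<close> says that u is 0 or a unit vector in the span of the
  frame. On the support the frame may be replaced by its projections g off u. Their Gram matrix is
  an orthogonal projection of rank l - \<theta>, so its trace and its squared Frobenius norm are
  both l - \<theta>; these are the two sums in the moments.\<close>

lemma frame_moments:
  assumes c2: "\<And>a. cip n a (($) u) = 0 \<Longrightarrow> (\<integral>x. (cmod (cip n (($) x) a))\<^sup>2 \<partial>\<mu>) = c2 * sqn n a"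
    and c4: "\<And>a. cip n a (($) u) = 0 \<Longrightarrow> (\<integral>x. (cmod (cip n (($) x) a))^4 \<partial>\<mu>) = c4 * (sqn n a)\<^sup>2"
  shows "(\<integral>x. (\<Sum>j<l. (cmod (cip n (($) x) (o' j)))\<^sup>2) \<partial>\<mu>) = c2 * (real l - \<theta>)"
    and "(\<integral>x. (\<Sum>j<l. (cmod (cip n (($) x) (o' j)))\<^sup>2)\<^sup>2 \<partial>\<mu>) = c4 / 2 * ((real l - \<theta>)\<^sup>2 + (real l - \<theta>))"
proof -
  define \<gamma> where "\<gamma> j = cip n (o' j) (($) u)" for j
  define g where "g j = (\<lambda>k. o' j k - \<gamma> j * u $ k)" for j
  have th2: "(\<Sum>j<l. (cmod (\<gamma> j))\<^sup>2) = \<theta>" using th by (simp add: \<gamma>_def)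
  have \<gamma>\<theta>: "\<gamma> j * of_real \<theta> = \<gamma> j" if "j < l" for j
  proof -
    have "\<theta> = 0 \<Longrightarrow> \<gamma> j = 0" using th2 that by (simp add: sum_nonneg_eq_0_iff)
    thus ?thesis using th(3) by auto
  qed
  have uu: "cip n (($) u) (($) u) = of_real \<theta>" by (simp add: cip_self th)
  have uo: "cip n (($) u) (o' j) = cnj (\<gamma> j)" for j by (simp add: \<gamma>_def cnj_cip)
  have gu: "cip n (g j) (($) u) = 0" if "j < l" for j
    using that by (simp add: g_def cip_linear uu \<gamma>\<theta> \<gamma>_def[symmetric])
  have gg: "cip n (g j) (g k) = (if j = k then 1 else 0) - \<gamma> j * cnj (\<gamma> k)" if jk: "j < l" "k < l" for j k
  proof -
    have "cip n (g j) (g k) = cip n (g j) (o' k) - cnj (\<gamma> k) * cip n (g j) (($) u)"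
      unfolding g_def[of k] by (simp add: cip_linear)
    also have "\<dots> = (if j = k then 1 else 0) - \<gamma> j * cnj (\<gamma> k)"
      using jk by (simp add: gu) (simp add: g_def cip_linear orth uo)
    finally show ?thesis .
  qed
  have sg: "sqn n (g j) = 1 - (cmod (\<gamma> j))\<^sup>2" if "j < l" for j
    using that by (simp add: sqn_eq_Re_cip gg flip: complex_norm_square)
  have ssg: "(\<Sum>j<l. sqn n (g j)) = real l - \<theta>"
    by (simp add: sg sum_subtractf th2)
  have cg: "(cmod (cip n (g j) (g k)))\<^sup>2 = (if j = k then 1 - 2 * (cmod (\<gamma> j))\<^sup>2 else 0) + (cmod (\<gamma> j))\<^sup>2 * (cmod (\<gamma> k))\<^sup>2"
    if "j < l" "k < l" for j k
  proof (cases "j = k")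
    case True
    have e: "cip n (g j) (g k) = of_real (1 - (cmod (\<gamma> j))\<^sup>2)"
      using gg[OF that] True by (simp flip: complex_norm_square)
    show ?thesis unfolding e norm_of_real using True by (simp add: power2_eq_square algebra_simps)
  next
    case False thus ?thesis using gg[OF that] by (simp add: norm_mult power_mult_distrib)
  qed
  have scg: "(\<Sum>j<l. \<Sum>k<l. (cmod (cip n (g j) (g k)))\<^sup>2) = real l - \<theta>"
  proof -
    have "(\<Sum>j<l. \<Sum>k<l. (cmod (cip n (g j) (g k)))\<^sup>2)
        = (\<Sum>j<l. \<Sum>k<l. (if j = k then 1 - 2 * (cmod (\<gamma> j))\<^sup>2 else 0) + (cmod (\<gamma> j))\<^sup>2 * (cmod (\<gamma> k))\<^sup>2)"
      by (intro sum.cong refl) (simp add: cg)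
    also have "\<dots> = real l - 2 * \<theta> + \<theta> * \<theta>"
      by (simp add: sum.distrib sum_distrib_left[symmetric] sum_distrib_right[symmetric] sum_subtractf th2)
    finally show ?thesis using th(3) by auto
  qed
  have T: "AE x in \<mu>. (\<Sum>j<l. (cmod (cip n (($) x) (o' j)))\<^sup>2) = (\<Sum>j<l. (cmod (cip n (($) x) (g j)))\<^sup>2)"
    using AE_unit by eventually_elim (simp add: g_def cip_linear)
  have "(\<integral>x. (\<Sum>j<l. (cmod (cip n (($) x) (o' j)))\<^sup>2) \<partial>\<mu>) = (\<integral>x. (\<Sum>j<l. (cmod (cip n (($) x) (g j)))\<^sup>2) \<partial>\<mu>)"
    by (rule integral_cong_AE) (use T in auto)
  also have "\<dots> = (\<Sum>j<l. c2 * sqn n (g j))"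
    by (simp add: integrable_cip2 c2 gu)
  finally show "(\<integral>x. (\<Sum>j<l. (cmod (cip n (($) x) (o' j)))\<^sup>2) \<partial>\<mu>) = c2 * (real l - \<theta>)"
    by (simp add: ssg flip: sum_distrib_left)
  have "(\<integral>x. (\<Sum>j<l. (cmod (cip n (($) x) (o' j)))\<^sup>2)\<^sup>2 \<partial>\<mu>) = (\<integral>x. (\<Sum>j<l. (cmod (cip n (($) x) (g j)))\<^sup>2)\<^sup>2 \<partial>\<mu>)"
    by (rule integral_cong_AE) (use T in auto)
  also have "\<dots> = (\<integral>x. (\<Sum>j<l. \<Sum>k<l. (cmod (cip n (($) x) (g j)))\<^sup>2 * (cmod (cip n (($) x) (g k)))\<^sup>2) \<partial>\<mu>)"
    by (simp add: power2_eq_square[of "sum _ _"] sum_product)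
  also have "\<dots> = (\<Sum>j<l. \<Sum>k<l. (\<integral>x. (cmod (cip n (($) x) (g j)))\<^sup>2 * (cmod (cip n (($) x) (g k)))\<^sup>2 \<partial>\<mu>))"
    by (simp add: integrable_cip22)
  also have "\<dots> = (\<Sum>j<l. \<Sum>k<l. c4 / 2 * (sqn n (g j) * sqn n (g k) + (cmod (cip n (g j) (g k)))\<^sup>2))"
    by (intro sum.cong refl joint_moment c4) (simp_all add: gu)
  also have "\<dots> = c4 / 2 * ((\<Sum>j<l. \<Sum>k<l. sqn n (g j) * sqn n (g k)) + (\<Sum>j<l. \<Sum>k<l. (cmod (cip n (g j) (g k)))\<^sup>2))"
    by (simp add: sum.distrib sum_distrib_left distrib_left)
  also have "\<dots> = c4 / 2 * ((\<Sum>j<l. sqn n (g j)) * (\<Sum>j<l. sqn n (g j)) + (\<Sum>j<l. \<Sum>k<l. (cmod (cip n (g j) (g k)))\<^sup>2))"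
    by (simp only: sum_product)
  finally show "(\<integral>x. (\<Sum>j<l. (cmod (cip n (($) x) (o' j)))\<^sup>2)\<^sup>2 \<partial>\<mu>) = c4 / 2 * ((real l - \<theta>)\<^sup>2 + (real l - \<theta>))"
    unfolding ssg scg by (simp add: power2_eq_square)
qed

end

lemma cip_unit_right: "j < n \<Longrightarrow> cip n x (\<lambda>k. if k = j then 1 else 0) = x j"
  by (simp add: cip_def if_distrib[of cnj] if_distrib[of "(*) _"] cong: if_cong)

text \<open>The constants come from applying \<open>frame_moments\<close> to the standard basis, for
  which the sum of squares is almost surely 1. The equation c2 * m = 1 also shows that m, the
  complex dimension of the complement, is not 0.\<close>

lemma moments:
  assumes \<theta>: "sqn n (($) u) = \<theta>" "\<theta> = 0 \<or> \<theta> = 1"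
  defines "m \<equiv> real n - \<theta>"
  shows "m > 0"
    and "\<And>a. cip n a (($) u) = 0 \<Longrightarrow> (\<integral>x. (cmod (cip n (($) x) a))\<^sup>2 \<partial>\<mu>) = sqn n a / m"
    and "\<And>a. cip n a (($) u) = 0 \<Longrightarrow> (\<integral>x. (cmod (cip n (($) x) a))^4 \<partial>\<mu>) = 2 / (m\<^sup>2 + m) * (sqn n a)\<^sup>2"
proof -
  obtain c2 c4 where c2: "\<And>a. cip n a (($) u) = 0 \<Longrightarrow> (\<integral>x. (cmod (cip n (($) x) a))\<^sup>2 \<partial>\<mu>) = c2 * sqn n a"
    and c4: "\<And>a. cip n a (($) u) = 0 \<Longrightarrow> (\<integral>x. (cmod (cip n (($) x) a))^4 \<partial>\<mu>) = c4 * (sqn n a)\<^sup>2"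
    using homogeneous_moments by blast
  define \<epsilon> where "\<epsilon> j = (\<lambda>k::nat. if k = j then 1 else (0::complex))" for j
  have o1: "cip n (\<epsilon> j) (\<epsilon> k) = (if j = k then 1 else 0)" if "j < n" "k < n" for j k
    using cip_unit_right[of k "\<epsilon> j"] that by (auto simp: \<epsilon>_def)
  have x: "cip n (\<epsilon> j) y = cnj (y j)" if "j < n" for j y
    using cip_unit_right[OF that, of y] cnj_cip[of n y "\<epsilon> j"] by (simp add: \<epsilon>_def)
  have o2: "(\<Sum>j<n. (cmod (cip n (\<epsilon> j) (($) u)))\<^sup>2) = \<theta>"
    using \<theta>(1) by (simp add: x sqn_def)
  have T1: "AE x in \<mu>. (\<Sum>j<n. (cmod (cip n (($) x) (\<epsilon> j)))\<^sup>2) = 1"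
    using AE_unit by eventually_elim (simp add: \<epsilon>_def cip_unit_right sqn_def)
  note fm = frame_moments[of n \<epsilon> \<theta>, OF o1 o2 \<theta> c2 c4]
  have "(\<integral>x. (\<Sum>j<n. (cmod (cip n (($) x) (\<epsilon> j)))\<^sup>2) \<partial>\<mu>) = (\<integral>x. 1 \<partial>\<mu>)"
    by (rule integral_cong_AE) (use T1 in auto)
  with fm(1) have e2: "c2 * m = 1" by (simp add: m_def prob_space)
  have "(\<integral>x. (\<Sum>j<n. (cmod (cip n (($) x) (\<epsilon> j)))\<^sup>2)\<^sup>2 \<partial>\<mu>) = (\<integral>x. 1 \<partial>\<mu>)"
    by (rule integral_cong_AE) (use T1 in auto)
  with fm(2) have e4: "c4 / 2 * (m\<^sup>2 + m) = 1" by (simp add: m_def prob_space)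
  have "m \<ge> 0"
  proof (cases "n = 0")
    case True thus ?thesis using \<theta> by (simp add: m_def sqn_def)
  qed (use \<theta>(2) in \<open>auto simp: m_def\<close>)
  with e2 show m: "m > 0" by (cases "m = 0") auto
  show "\<And>a. cip n a (($) u) = 0 \<Longrightarrow> (\<integral>x. (cmod (cip n (($) x) a))\<^sup>2 \<partial>\<mu>) = sqn n a / m"
    using c2 e2 m by (simp add: field_simps)
  have "m\<^sup>2 + m > 0" using m by (simp add: add_pos_pos)
  hence "c4 = 2 / (m\<^sup>2 + m)" using e4 by (simp add: field_simps)
  thus "\<And>a. cip n a (($) u) = 0 \<Longrightarrow> (\<integral>x. (cmod (cip n (($) x) a))^4 \<partial>\<mu>) = 2 / (m\<^sup>2 + m) * (sqn n a)\<^sup>2"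
    using c4 by simp
qed

text \<open>With N = l - \<theta> and m = n - \<theta> the variance is (N^2 + N) / (m^2 + m) - (N /
  m)^2. The quadratic parts compare favourably, and N <= m bounds the linear one by 1 / m.\<close>

lemma frame_variance:
  assumes l: "l \<le> n" and orth: "\<And>j k. j < l \<Longrightarrow> k < l \<Longrightarrow> cip n (o' j) (o' k) = (if j = k then 1 else 0)"
    and th: "(\<Sum>j<l. (cmod (cip n (o' j) (($) u)))\<^sup>2) = \<theta>" "sqn n (($) u) = \<theta>" "\<theta> = 0 \<or> \<theta> = 1"
  shows "(\<integral>x. ((\<Sum>j<l. (cmod (cip n (($) x) (o' j)))\<^sup>2) - (real l - \<theta>) / (real n - \<theta>))\<^sup>2 \<partial>\<mu>) \<le> 1 / (real n - \<theta>)"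
    (is "(\<integral>x. (?T x - ?N / ?m)\<^sup>2 \<partial>\<mu>) \<le> _")
proof -
  have m: "?m > 0" using moments(1)[OF th(2,3)] .
  have c2: "\<And>a. cip n a (($) u) = 0 \<Longrightarrow> (\<integral>x. (cmod (cip n (($) x) a))\<^sup>2 \<partial>\<mu>) = 1 / ?m * sqn n a"
    using moments(2)[OF th(2,3)] by simp
  have fm: "(\<integral>x. ?T x \<partial>\<mu>) = 1 / ?m * ?N" "(\<integral>x. (?T x)\<^sup>2 \<partial>\<mu>) = 2 / (?m\<^sup>2 + ?m) / 2 * (?N\<^sup>2 + ?N)"
    by (rule frame_moments[OF orth th c2 moments(3)[OF th(2,3)]]; assumption)+
  have i1: "integrable \<mu> ?T" by (simp add: integrable_cip2)
  have i2: "integrable \<mu> (\<lambda>x. (?T x)\<^sup>2)"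
    by (simp add: power2_eq_square[of "sum _ _"] sum_product integrable_cip22)
  have "(\<integral>x. (?T x - ?N / ?m)\<^sup>2 \<partial>\<mu>) = (\<integral>x. (?T x)\<^sup>2 - 2 * (?N / ?m) * ?T x + (?N / ?m)\<^sup>2 \<partial>\<mu>)"
    by (simp add: power2_diff algebra_simps)
  also have "\<dots> = (\<integral>x. (?T x)\<^sup>2 \<partial>\<mu>) - 2 * (?N / ?m) * (\<integral>x. ?T x \<partial>\<mu>) + (?N / ?m)\<^sup>2"
    using i1 i2 by (simp add: prob_space)
  also have "\<dots> = (?N\<^sup>2 + ?N) / (?m\<^sup>2 + ?m) - (?N / ?m)\<^sup>2"
  proof -
    have half: "2 / z / 2 = 1 / z" for z :: real by simp
    have "2 / (?m\<^sup>2 + ?m) / 2 = 1 / (?m\<^sup>2 + ?m)" by (rule half)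
    thus ?thesis unfolding fm by (simp add: power2_eq_square)
  qed
  also have "\<dots> \<le> 1 / ?m"
  proof -
    define m N where "m = ?m" and "N = ?N"
    have m0: "m > 0" using m by (simp add: m_def)
    have Nm: "N \<le> m" using l by (simp add: m_def N_def)
    have "(N\<^sup>2 + N) / (m\<^sup>2 + m) = N\<^sup>2 / (m\<^sup>2 + m) + N / (m\<^sup>2 + m)" by (simp add: add_divide_distrib)
    moreover have "N\<^sup>2 / (m\<^sup>2 + m) \<le> N\<^sup>2 / m\<^sup>2" using m0 by (intro divide_left_mono) (auto intro!: mult_pos_pos add_pos_pos)
    moreover have "N / (m\<^sup>2 + m) \<le> (m + 1) / (m\<^sup>2 + m)" using m0 Nm by (intro divide_right_mono) auto
    moreover have "(m + 1) / (m\<^sup>2 + m) = 1 / m"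
    proof -
      have "m\<^sup>2 + m = m * (m + 1)" by (simp add: power2_eq_square algebra_simps)
      thus ?thesis using m0 by simp
    qed
    ultimately have "(N\<^sup>2 + N) / (m\<^sup>2 + m) - (N / m)\<^sup>2 \<le> 1 / m" by (simp add: power_divide)
    thus ?thesis by (simp add: m_def N_def)
  qed
  finally show ?thesis .
qed

text \<open>The reflection in direction a flips the sign of the form with a. Averaging over the two
  signs removes the cross term, by the parallelogram law.\<close>

lemma moment_shift:
  assumes \<theta>: "sqn n (($) u) = \<theta>" "\<theta> = 0 \<or> \<theta> = 1" and a: "cip n a (($) u) = 0"
  shows "(\<integral>x. (cmod (z + c * cip n (($) x) a))\<^sup>2 \<partial>\<mu>) = (cmod z)\<^sup>2 + (cmod c)\<^sup>2 * (sqn n a / (real n - \<theta>))"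
proof (cases "sqn n a = 0")
  case True
  hence "cip n x a = 0" for x by (simp add: cip_def sqn_zero_iff)
  thus ?thesis using True by (simp add: prob_space)
next
  case False
  hence s: "sqn n a > 0" using sqn_nonneg[of n a] by simp
  define y where "y = (\<lambda>k. of_real (1 / sqrt (sqn n a)) * a k)"
  have y1: "sqn n y = 1" unfolding y_def sqn_scale using s by (simp add: norm_divide power_divide)
  have yu: "cip n y (($) u) = 0" unfolding y_def cip_scale_left by (simp add: a)
  have yy: "2 * cip n x y * cip n y a = 2 * cip n x a" for x
  proof -
    have "2 * cip n x y * cip n y a = 2 * of_real (1 / sqrt (sqn n a) * (1 / sqrt (sqn n a)) * sqn n a) * cip n x a"
      unfolding y_def cip_scale_left cip_scale_right cip_self of_real_mult by simp
    also have "1 / sqrt (sqn n a) * (1 / sqrt (sqn n a)) * sqn n a = 1" using s by (simp add: real_sqrt_mult[symmetric])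
    finally show ?thesis by simp
  qed
  let ?f = "\<lambda>x. (cmod (z + c * cip n (($) x) a))\<^sup>2" and ?g = "\<lambda>x. (cmod (z - c * cip n (($) x) a))\<^sup>2"
  have sum: "?f x + ?g x = 2 * ((cmod z)\<^sup>2 + (cmod c)\<^sup>2 * (cmod (cip n (($) x) a))\<^sup>2)" for x
    unfolding cmod_parallelogram by (simp add: norm_mult power_mult_distrib)
  have bd: "0 \<le> ?f x" "0 \<le> ?g x" for x by auto
  have AEb: "AE x in \<mu>. ?f x + ?g x \<le> 2 * ((cmod z)\<^sup>2 + (cmod c)\<^sup>2 * sqn n a)"
    unfolding sum using AE_cip_bound[of a] by eventually_elim (auto intro!: mult_left_mono)
  have if': "integrable \<mu> ?f" "integrable \<mu> ?g"
  proof -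
    have "AE x in \<mu>. \<bar>?f x\<bar> \<le> 2 * ((cmod z)\<^sup>2 + (cmod c)\<^sup>2 * sqn n a)"
      using AEb
    proof eventually_elim
      case (elim x) show ?case using elim bd(1)[of x] bd(2)[of x] by linarith
    qed
    thus "integrable \<mu> ?f" by (intro integrable_bounded) measurable
    have "AE x in \<mu>. \<bar>?g x\<bar> \<le> 2 * ((cmod z)\<^sup>2 + (cmod c)\<^sup>2 * sqn n a)"
      using AEb
    proof eventually_elim
      case (elim x) show ?case using elim bd(1)[of x] bd(2)[of x] by linarith
    qed
    thus "integrable \<mu> ?g" by (intro integrable_bounded) measurable
  qed
  have "(\<integral>x. ?f x \<partial>\<mu>) = (\<integral>x. ?f (vec n (\<lambda>k. x $ k - 2 * cip n (($) x) y * y k)) \<partial>\<mu>)"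
    by (rule uniform_reflection(1)[OF U u y1 yu, symmetric]) measurable
  also have "\<dots> = (\<integral>x. ?g x \<partial>\<mu>)"
    unfolding cip_reflect yy by (simp add: algebra_simps)
  finally have "2 * (\<integral>x. ?f x \<partial>\<mu>) = (\<integral>x. ?f x + ?g x \<partial>\<mu>)" using if' by simp
  also have "\<dots> = 2 * ((cmod z)\<^sup>2 + (cmod c)\<^sup>2 * (sqn n a / (real n - \<theta>)))"
    unfolding sum using moments(2)[OF \<theta> a] integrable_cip2[of a] by (simp add: prob_space)
  finally show ?thesis by simp
qed

text \<open>
  By isotropy all hyperplanes have the same mass, and a unit vector lies in fewer than n of the
  hyperplanes orthogonal to the Vandermonde vectors (1, l, l^2, ...), so this mass is 0.
\<close>
lemma AE_cip_neq_0:
  assumes u0: "sqn n (($) u) = 0" and a: "sqn n a > 0"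
  shows "AE x in \<mu>. cip n (($) x) a \<noteq> 0"
proof -
  have uz: "cip n b (($) u) = 0" for b using u0 by (simp add: cip_def sqn_zero_iff)
  let ?I = "\<lambda>b. \<integral>x. indicator {0} (cmod (cip n (($) x) b)) \<partial>\<mu> :: real"
  have scale: "?I b = ?I a" if b: "sqn n b > 0" for b
  proof -
    define b' where "b' = (\<lambda>k. complex_of_real (sqrt (sqn n a) / sqrt (sqn n b)) * b k)"
    have s: "sqn n a = sqn n b'" unfolding b'_def sqn_scale using b a by (simp add: norm_divide power_divide)
    have "?I a = ?I b'" by (rule integral_cip_isotropic[OF uz uz s, of "indicator {0}"]) measurable
    also have "\<dots> = ?I b"
    proof (intro Bochner_Integration.integral_cong refl)
      fix x
      have "cmod (cip n (($) x) b') = 0 \<longleftrightarrow> cmod (cip n (($) x) b) = 0"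
        unfolding b'_def cip_scale_right using a b by simp
      thus "(indicator {0} (cmod (cip n (($) x) b')) :: real) = indicator {0} (cmod (cip n (($) x) b))"
        unfolding indicator_def by simp
    qed
    finally show ?thesis by simp
  qed
  have n0: "n > 0" using a by (cases n) (auto simp: sqn_def)
  define y where "y l = (\<lambda>k. complex_of_real (real l ^ k))" for l :: nat
  have ypos: "sqn n (y l) > 0" for l
  proof -
    have "y l 0 \<noteq> 0" by (simp add: y_def)
    hence "sqn n (y l) \<noteq> 0" unfolding sqn_zero_iff using n0 by blast
    thus ?thesis using sqn_nonneg[of n "y l"] by linarith
  qed
  have int: "integrable \<mu> (\<lambda>x. indicator {0} (cmod (cip n (($) x) b)) :: real)" for b
    by (rule integrable_bounded[of _ 1]) (auto simp: indicator_def)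
  have le: "real N * ?I a \<le> real n" for N
  proof -
    have "real N * ?I a = (\<Sum>l<N. ?I (y l))" by (simp add: scale ypos)
    also have "\<dots> = (\<integral>x. (\<Sum>l<N. indicator {0} (cmod (cip n (($) x) (y l)))) \<partial>\<mu>)"
      by (simp add: int)
    also have "\<dots> \<le> (\<integral>x. real n \<partial>\<mu>)"
    proof (rule integral_mono_AE)
      show "AE x in \<mu>. (\<Sum>l<N. indicator {0} (cmod (cip n (($) x) (y l)))) \<le> real n"
        using AE_unit
      proof eventually_elim
        case (elim x)
        have e: "cip n (($) x) (y l) = (\<Sum>k<n. x $ k * of_nat l ^ k)" for l
          by (simp add: cip_def y_def)
        have "(\<Sum>l<N. indicator {0} (cmod (cip n (($) x) (y l)))) = real (card ({..<N} \<inter> {l. (\<Sum>k<n. x $ k * of_nat l ^ k) = 0}))"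
          unfolding e by (simp add: indicator_def sum.If_cases)
        also have "\<dots> \<le> real (card {l. (\<Sum>k<n. x $ k * of_nat l ^ k) = 0})"
          using polyfun_zero_count(1)[of n "($) x"] elim by (intro of_nat_mono card_mono) auto
        also have "\<dots> \<le> real n" using polyfun_zero_count(2)[of n "($) x"] elim by simp
        finally show ?case .
      qed
    qed (simp_all add: int)
    finally show ?thesis by (simp add: prob_space)
  qed
  have "?I a \<le> 0"
  proof (rule ccontr)
    assume "\<not> ?I a \<le> 0"
    then obtain N where "real N * ?I a > real n" using reals_Archimedean3[of "?I a"] by auto
    thus False using le[of N] by simp
  qed
  moreover have "?I a \<ge> 0" by (rule Bochner_Integration.integral_nonneg) auto
  ultimately have "?I a = 0" by simp
  hence "AE x in \<mu>. (indicator {0} (cmod (cip n (($) x) a)) :: real) = 0"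
    by (subst (asm) integral_nonneg_eq_0_iff_AE[OF int]) auto
  thus ?thesis by eventually_elim (auto simp: indicator_def split: if_splits)
qed

end

subsection \<open>Gaussian moments, decoupling and disintegration\<close>

text \<open>For c > 0 the value is pi * k! / c^(k+1). The parameter c is carried along because
  scaling in c yields a recursion in k without polar coordinates.\<close>

definition cn_radial :: "nat \<Rightarrow> real \<Rightarrow> ennreal" where
  "cn_radial k c = (\<integral>\<^sup>+z. ennreal ((cmod z)^(2*k) * exp (- c * (cmod z)\<^sup>2)) \<partial>(lborel :: complex measure))"

text \<open>Substitution by sqrt x: of the exponent k + 1, k comes from the modulus and 1 from the
  Jacobian in real dimension 2.\<close>

lemma cn_radial_scale:
  assumes "x > 0"
  shows "cn_radial k 1 = ennreal (x^(k+1)) * cn_radial k x"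
proof -
  have "cn_radial k 1 = (\<integral>\<^sup>+z. ennreal ((cmod z)^(2*k) * exp (- 1 * (cmod z)\<^sup>2))
      \<partial>density (distr lborel borel (\<lambda>z. 0 + sqrt x *\<^sub>R z)) (\<lambda>_. \<bar>sqrt x\<bar>^DIM(complex)))"
    unfolding cn_radial_def by (subst lborel_affine[of "sqrt x" 0]) (use assms in auto)
  also have "\<dots> = (\<integral>\<^sup>+z. ennreal (x^(k+1)) * ennreal ((cmod z)^(2*k) * exp (- x * (cmod z)\<^sup>2)) \<partial>lborel)"
  proof -
    have "(sqrt x ^ k)\<^sup>2 = x ^ k"
      using assms by (metis power_commuting_commutes power_mult mult.commute real_sqrt_pow2 less_imp_le)
    thus ?thesis using assms
      by (simp add: nn_integral_density nn_integral_distr ennreal_mult'[symmetric] power_mult_distrib power_mult algebra_simps)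
  qed
  also have "\<dots> = ennreal (x^(k+1)) * cn_radial k x"
    unfolding cn_radial_def by (rule nn_integral_cmult) measurable
  finally show ?thesis .
qed

lemma nn_integral_power_tail:
  "(\<integral>\<^sup>+x. ennreal (1 / x^(k+2)) * indicator {1..} x \<partial>lborel) = ennreal (1 / real (k+1))"
proof -
  have "(\<integral>\<^sup>+x. ennreal (1 / x^(k+2)) * indicator {1..} x \<partial>lborel)
      = ennreal (0 - (\<lambda>x. - ((1 / x)^(k+1)) / real (k+1)) 1)"
  proof (rule nn_integral_FTC_atLeast[where F = "\<lambda>x. - ((1 / x)^(k+1)) / real (k+1)"])
    fix x :: real assume x: "1 \<le> x"
    have "((\<lambda>x. 1 / x) has_real_derivative - (1 / x\<^sup>2)) (at x)"
      using x by (auto intro!: derivative_eq_intros simp: power2_eq_square)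
    from DERIV_cdivide[OF DERIV_minus[OF DERIV_power[OF this, of "k+1"]], of "real (k+1)"]
    have "((\<lambda>x. - ((1 / x)^(k+1)) / real (k+1)) has_real_derivative
        - (real (k+1) * (- (1 / x\<^sup>2) * (1 / x)^(k+1 - Suc 0))) / real (k+1)) (at x)" by simp
    moreover have "- (real (k+1) * (- (1 / x\<^sup>2) * (1 / x)^(k+1 - Suc 0))) / real (k+1) = 1 / x^(k+2)"
    proof -
      have "- (c * (- y * z)) / c = y * z" if "c \<noteq> 0" for c y z :: real using that by simp
      from this[of "real (k+1)" "1 / x\<^sup>2" "(1 / x)^(k+1 - Suc 0)"]
      show ?thesis by (simp add: power_add power_divide mult.commute power2_eq_square)
    qed
    ultimately show "((\<lambda>x. - ((1 / x)^(k+1)) / real (k+1)) has_real_derivative 1 / x^(k+2)) (at x)" by simp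
    show "0 \<le> 1 / x^(k+2)" using x by simp
  next
    have "((\<lambda>x::real. 1 / x) \<longlongrightarrow> 0) at_top"
      using tendsto_inverse_0_at_top[OF filterlim_ident] by (simp add: inverse_eq_divide)
    from tendsto_divide[OF tendsto_minus[OF tendsto_power[OF this, of "k+1"]] tendsto_const[of "real (k+1)"]]
    show "((\<lambda>x::real. - ((1 / x)^(k+1)) / real (k+1)) \<longlongrightarrow> 0) at_top" by simp
  qed measurable
  thus ?thesis by simp
qed

lemma nn_integral_exp_tail:
  assumes "t > 0"
  shows "(\<integral>\<^sup>+x. ennreal (t * exp (- x * t)) * indicator {1..} x \<partial>lborel) = ennreal (exp (- t))"
proof -
  have "(\<integral>\<^sup>+x. ennreal (t * exp (- x * t)) * indicator {1..} x \<partial>lborel) = ennreal (0 - (\<lambda>x. - exp (- x * t)) 1)"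
  proof (rule nn_integral_FTC_atLeast[where F = "\<lambda>x. - exp (- x * t)"])
    fix x :: real
    show "((\<lambda>x. - exp (- x * t)) has_real_derivative t * exp (- x * t)) (at x)"
      by (auto intro!: derivative_eq_intros)
    show "0 \<le> t * exp (- x * t)" using assms by simp
  next
    have "filterlim (\<lambda>x. - x * t) at_bot at_top"
      using filterlim_tendsto_pos_mult_at_top[OF tendsto_const assms filterlim_ident]
      by (simp add: filterlim_uminus_at_bot mult.commute)
    from tendsto_minus[OF filterlim_compose[OF exp_at_bot this]]
    show "((\<lambda>x. - exp (- x * t)) \<longlongrightarrow> 0) at_top" by simp
  qed measurable
  thus ?thesis by simp
qed

text \<open>Integrate the scaling relation over all x at least 1 and exchange the integrals.\<close>
lemma cn_radial_Suc: "cn_radial (Suc k) 1 = ennreal (real (Suc k)) * cn_radial k 1"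
proof -
  let ?J = "\<integral>\<^sup>+x. cn_radial (Suc k) x * indicator {1..} x \<partial>lborel"
  have "?J = (\<integral>\<^sup>+x. cn_radial (Suc k) 1 * (ennreal (1 / x^(k+2)) * indicator {1..} x) \<partial>lborel)"
  proof (rule nn_integral_cong)
    fix x :: real
    show "cn_radial (Suc k) x * indicator {1..} x = cn_radial (Suc k) 1 * (ennreal (1 / x^(k+2)) * indicator {1..} x)"
    proof (cases "x \<ge> 1")
      case True
      have "cn_radial (Suc k) 1 * ennreal (1 / x^(k+2)) = ennreal (1 / x^(k+2)) * ennreal (x^(k+2)) * cn_radial (Suc k) x"
        using cn_radial_scale[of x "Suc k"] True by (simp add: mult_ac)
      also have "ennreal (1 / x^(k+2)) * ennreal (x^(k+2)) = 1"
        using True by (simp add: ennreal_mult'[symmetric])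
      finally show ?thesis using True by simp
    qed simp
  qed
  also have "\<dots> = cn_radial (Suc k) 1 * ennreal (1 / real (k+1))"
    unfolding nn_integral_power_tail[symmetric] by (rule nn_integral_cmult) measurable
  finally have 1: "?J = cn_radial (Suc k) 1 * ennreal (1 / real (k+1))" .
  \<comment> \<open>In the other order, the integral of exp (- x |z|^2) over x >= 1 cancels one
    factor |z|^2 and leaves the integrand of \<open>cn_radial k 1\<close>. The computation is in
    extended reals, so finiteness is not presupposed.\<close>
  have "?J = (\<integral>\<^sup>+x. \<integral>\<^sup>+z. ennreal ((cmod z)^(2 * Suc k) * exp (- x * (cmod z)\<^sup>2)) * indicator {1..} x \<partial>(lborel :: complex measure) \<partial>lborel)"
    unfolding cn_radial_def by (subst nn_integral_multc) auto
  also have "\<dots> = (\<integral>\<^sup>+z. \<integral>\<^sup>+x. ennreal ((cmod z)^(2 * Suc k) * exp (- x * (cmod z)\<^sup>2)) * indicator {1..} x \<partial>lborel \<partial>(lborel :: complex measure))"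
    by (rule lborel_pair.Fubini') measurable
  also have "\<dots> = cn_radial k 1"
    unfolding cn_radial_def
  proof (rule nn_integral_cong_AE)
    have "AE z in (lborel :: complex measure). z \<noteq> 0" by (rule AE_lborel_singleton)
    thus "AE z in (lborel :: complex measure).
      (\<integral>\<^sup>+x. ennreal ((cmod z)^(2 * Suc k) * exp (- x * (cmod z)\<^sup>2)) * indicator {1..} x \<partial>lborel)
       = ennreal ((cmod z)^(2*k) * exp (- 1 * (cmod z)\<^sup>2))"
    proof eventually_elim
      case (elim z)
      have "(\<integral>\<^sup>+x. ennreal ((cmod z)^(2 * Suc k) * exp (- x * (cmod z)\<^sup>2)) * indicator {1..} x \<partial>lborel)
        = (\<integral>\<^sup>+x. ennreal ((cmod z)^(2*k)) * (ennreal ((cmod z)\<^sup>2 * exp (- x * (cmod z)\<^sup>2)) * indicator {1..} x) \<partial>lborel)"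
        by (intro nn_integral_cong) (simp add: ennreal_mult'[symmetric] indicator_def power2_eq_square mult_ac)
      also have "\<dots> = ennreal ((cmod z)^(2*k)) * (\<integral>\<^sup>+x. ennreal ((cmod z)\<^sup>2 * exp (- x * (cmod z)\<^sup>2)) * indicator {1..} x \<partial>lborel)"
        by (rule nn_integral_cmult) measurable
      also have "\<dots> = ennreal ((cmod z)^(2*k)) * ennreal (exp (- (cmod z)\<^sup>2))"
        by (subst nn_integral_exp_tail) (use elim in auto)
      finally show ?case by (simp add: ennreal_mult'[symmetric])
    qed
  qed
  finally have "cn_radial k 1 = cn_radial (Suc k) 1 * ennreal (1 / real (k+1))" using 1 by simp
  hence "ennreal (real (Suc k)) * cn_radial k 1 = (ennreal (real (Suc k)) * ennreal (1 / real (k+1))) * cn_radial (Suc k) 1"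
    by (simp add: mult_ac)
  also have "ennreal (real (Suc k)) * ennreal (1 / real (k+1)) = 1"
    by (subst ennreal_mult'[symmetric]) auto
  finally show ?thesis by simp
qed

text \<open>The induction starts from the fact that the law of X has total mass 1, so the Gaussian
  integral itself is never evaluated.\<close>

lemma (in prob_space) std_cn_nn_moment:
  assumes "distributed M lborel X (\<lambda>z. ennreal (std_cn_density z))"
  shows "(\<integral>\<^sup>+w. ennreal ((cmod (X w))^(2*k)) \<partial>M) = ennreal (fact k)"
proof -
  have E: "(\<integral>\<^sup>+w. ennreal ((cmod (X w))^(2*k)) \<partial>M) = ennreal (1 / pi) * cn_radial k 1" for k
  proof -
    have "(\<integral>\<^sup>+w. ennreal ((cmod (X w))^(2*k)) \<partial>M) = (\<integral>\<^sup>+z. ennreal (std_cn_density z) * ennreal ((cmod z)^(2*k)) \<partial>lborel)"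
      by (rule distributed_nn_integral[OF assms, symmetric]) measurable
    also have "\<dots> = (\<integral>\<^sup>+z. ennreal (1 / pi) * ennreal ((cmod z)^(2*k) * exp (- 1 * (cmod z)\<^sup>2)) \<partial>lborel)"
      by (intro nn_integral_cong) (simp add: ennreal_mult'[symmetric] std_cn_density_def mult_ac)
    also have "\<dots> = ennreal (1 / pi) * cn_radial k 1"
      unfolding cn_radial_def by (rule nn_integral_cmult) measurable
    finally show ?thesis .
  qed
  show ?thesis
  proof (induction k)
    case 0 show ?case by (simp add: emeasure_space_1)
  next
    case (Suc k)
    have "ennreal (1 / pi) * cn_radial (Suc k) 1 = ennreal (real (Suc k)) * (ennreal (1 / pi) * cn_radial k 1)"
      unfolding cn_radial_Suc by (simp add: mult_ac)
    also have "\<dots> = ennreal (real (Suc k)) * ennreal (fact k)" using Suc unfolding E by simp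
    also have "\<dots> = ennreal (fact (Suc k))" unfolding fact_Suc of_nat_mult by (rule ennreal_mult'[symmetric]) simp
    finally show ?case unfolding E .
  qed
qed

text \<open>An independent copy of Y is modelled by a second integration variable over the same M.
  Nonnegative integrals allow Fubini before anything is known to be integrable.\<close>

lemma (in prob_space) decouple_nn:
  assumes [measurable]: "X \<in> measurable M S" "Y \<in> measurable M T"
    and eq: "distr M S X \<Otimes>\<^sub>M distr M T Y = distr M (S \<Otimes>\<^sub>M T) (\<lambda>w. (X w, Y w))"
    and f [measurable]: "f \<in> borel_measurable (S \<Otimes>\<^sub>M T)"
  shows "(\<integral>\<^sup>+w. f (X w, Y w) \<partial>M) = (\<integral>\<^sup>+w'. \<integral>\<^sup>+w. f (X w, Y w') \<partial>M \<partial>M)"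
proof -
  interpret X: prob_space "distr M S X" by (rule prob_space_distr) measurable
  interpret Y: prob_space "distr M T Y" by (rule prob_space_distr) measurable
  interpret XY: pair_sigma_finite "distr M S X" "distr M T Y" ..
  have "(\<integral>\<^sup>+w. f (X w, Y w) \<partial>M) = (\<integral>\<^sup>+z. f z \<partial>distr M (S \<Otimes>\<^sub>M T) (\<lambda>w. (X w, Y w)))"
    by (subst nn_integral_distr) auto
  also have "\<dots> = (\<integral>\<^sup>+y. \<integral>\<^sup>+x. f (x, y) \<partial>distr M S X \<partial>distr M T Y)"
    unfolding eq[symmetric] by (rule XY.nn_integral_snd[symmetric]) simp
  also have "\<dots> = (\<integral>\<^sup>+y. \<integral>\<^sup>+w. f (X w, y) \<partial>M \<partial>distr M T Y)"
    by (intro nn_integral_cong) (subst nn_integral_distr, auto)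
  also have "\<dots> = (\<integral>\<^sup>+w'. \<integral>\<^sup>+w. f (X w, Y w') \<partial>M \<partial>M)"
    by (rule nn_integral_distr) measurable
  finally show ?thesis .
qed

lemma (in prob_space) indep_rv_decouple_nn:
  assumes ind: "indep_rv S X T Y" and f: "f \<in> borel_measurable (S \<Otimes>\<^sub>M T)"
  shows "(\<integral>\<^sup>+w. f (X w, Y w) \<partial>M) = (\<integral>\<^sup>+w'. \<integral>\<^sup>+w. f (X w, Y w') \<partial>M \<partial>M)"
proof (rule decouple_nn)
  show X [measurable]: "X \<in> measurable M S" and Y [measurable]: "Y \<in> measurable M T"
    using ind by (simp_all add: indep_rv_def)
  show "distr M S X \<Otimes>\<^sub>M distr M T Y = distr M (S \<Otimes>\<^sub>M T) (\<lambda>w. (X w, Y w))"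
  proof (rule pair_measure_eqI)
    show "sigma_finite_measure (distr M S X)" "sigma_finite_measure (distr M T Y)"
      by (auto intro!: prob_space_imp_sigma_finite prob_space_distr)
    fix A B assume "A \<in> sets (distr M S X)" "B \<in> sets (distr M T Y)"
    hence AB [measurable]: "A \<in> sets S" "B \<in> sets T" by simp_all
    have "X -` A \<inter> space M \<in> sets (vimage_algebra (space M) X S)" "Y -` B \<inter> space M \<in> sets (vimage_algebra (space M) Y T)"
      using AB by (auto intro: in_vimage_algebra)
    hence "prob ((X -` A \<inter> space M) \<inter> (Y -` B \<inter> space M)) = prob (X -` A \<inter> space M) * prob (Y -` B \<inter> space M)"
      using ind indep_setD unfolding indep_rv_def by blast
    moreover have "(\<lambda>w. (X w, Y w)) -` (A \<times> B) \<inter> space M = (X -` A \<inter> space M) \<inter> (Y -` B \<inter> space M)" by auto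
    ultimately show "emeasure (distr M S X) A * emeasure (distr M T Y) B = emeasure (distr M (S \<Otimes>\<^sub>M T) (\<lambda>w. (X w, Y w))) (A \<times> B)"
      by (simp add: emeasure_distr emeasure_eq_measure ennreal_mult'[symmetric])
  qed simp
qed (rule f)

text \<open>In \<open>is_cond_distr\<close> the exceptional null set may depend on the event.
  Comparing two joint laws on rectangles, a generator stable under intersection, uses only one event
  at a time.\<close>

lemma (in prob_space) disintegrate_nn:
  assumes X [measurable]: "X \<in> measurable M N" and Y [measurable]: "Y \<in> measurable M L"
    and cd: "is_cond_distr M N X L Y \<kappa>"
    and f [measurable]: "f \<in> borel_measurable (L \<Otimes>\<^sub>M N)"
  shows "(\<integral>\<^sup>+w. f (Y w, X w) \<partial>M) = (\<integral>\<^sup>+w. \<integral>\<^sup>+y. f (y, X w) \<partial>\<kappa> (X w) \<partial>M)"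
proof -
  have \<kappa>: "\<kappa> \<in> measurable N (prob_algebra L)" using cd by (simp add: is_cond_distr_def)
  note [measurable] = measurable_prob_algebraD[OF \<kappa>]
  have \<kappa>p: "prob_space (\<kappa> x)" "sets (\<kappa> x) = sets L" if "x \<in> space N" for x
    using measurable_space[OF \<kappa> that] by (auto simp: space_prob_algebra)
  have XN: "X w \<in> space N" if "w \<in> space M" for w using measurable_space[OF X that] .
  \<comment> \<open>The candidate joint law: draw x from the law of X, then y from the kernel at
    x.\<close>
  define \<nu> where "\<nu> = distr M N X \<bind> (\<lambda>x. distr (\<kappa> x) (L \<Otimes>\<^sub>M N) (\<lambda>y. (y, x)))"
  have km: "(\<lambda>x. distr (\<kappa> x) (L \<Otimes>\<^sub>M N) (\<lambda>y. (y, x))) \<in> measurable N (subprob_algebra (L \<Otimes>\<^sub>M N))"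
    by (rule measurable_distr2[where M = L]) measurable
  hence km': "(\<lambda>x. distr (\<kappa> x) (L \<Otimes>\<^sub>M N) (\<lambda>y. (y, x))) \<in> measurable (distr M N X) (subprob_algebra (L \<Otimes>\<^sub>M N))"
    by simp
  have spM: "space M \<noteq> {}" by (rule not_empty)
  hence spN: "space N \<noteq> {}" using XN by auto
  have sets\<nu>: "sets \<nu> = sets (L \<Otimes>\<^sub>M N)" unfolding \<nu>_def
    by (rule sets_bind[OF sets_kernel[OF km']]) (use spN in auto)
  have nu_int: "(\<integral>\<^sup>+z. g z \<partial>\<nu>) = (\<integral>\<^sup>+w. \<integral>\<^sup>+y. g (y, X w) \<partial>\<kappa> (X w) \<partial>M)"
    if [measurable]: "g \<in> borel_measurable (L \<Otimes>\<^sub>M N)" for g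
  proof -
    have "(\<integral>\<^sup>+z. g z \<partial>\<nu>) = (\<integral>\<^sup>+x. \<integral>\<^sup>+z. g z \<partial>distr (\<kappa> x) (L \<Otimes>\<^sub>M N) (\<lambda>y. (y, x)) \<partial>distr M N X)"
      unfolding \<nu>_def by (rule nn_integral_bind[OF _ km']) simp
    also have "\<dots> = (\<integral>\<^sup>+w. \<integral>\<^sup>+z. g z \<partial>distr (\<kappa> (X w)) (L \<Otimes>\<^sub>M N) (\<lambda>y. (y, X w)) \<partial>M)"
      by (subst nn_integral_distr)
         (auto intro!: measurable_compose[OF km nn_integral_measurable_subprob_algebra])
    also have "\<dots> = (\<integral>\<^sup>+w. \<integral>\<^sup>+y. g (y, X w) \<partial>\<kappa> (X w) \<partial>M)"
    proof (rule nn_integral_cong)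
      fix w assume "w \<in> space M"
      note [measurable_cong] = \<kappa>p(2)[OF XN[OF this]] and [simp] = XN[OF this]
      show "(\<integral>\<^sup>+z. g z \<partial>distr (\<kappa> (X w)) (L \<Otimes>\<^sub>M N) (\<lambda>y. (y, X w))) = (\<integral>\<^sup>+y. g (y, X w) \<partial>\<kappa> (X w))"
        by (subst nn_integral_distr) auto
    qed
    finally show ?thesis .
  qed
  have eq: "distr M (L \<Otimes>\<^sub>M N) (\<lambda>w. (Y w, X w)) = \<nu>"
  proof (rule measure_eqI_generator_eq[where A = "\<lambda>_. space L \<times> space N"])
    show "Int_stable {a \<times> b | a b. a \<in> sets L \<and> b \<in> sets N}" by (rule Int_stable_pair_measure_generator)
    show "{a \<times> b | a b. a \<in> sets L \<and> b \<in> sets N} \<subseteq> Pow (space L \<times> space N)"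
      by (rule pair_measure_closed)
    show "sets (distr M (L \<Otimes>\<^sub>M N) (\<lambda>w. (Y w, X w))) = sigma_sets (space L \<times> space N) {a \<times> b | a b. a \<in> sets L \<and> b \<in> sets N}"
      by (simp add: sets_pair_measure)
    show "sets \<nu> = sigma_sets (space L \<times> space N) {a \<times> b | a b. a \<in> sets L \<and> b \<in> sets N}"
      unfolding sets\<nu> by (simp add: sets_pair_measure)
    show "range (\<lambda>_. space L \<times> space N) \<subseteq> {a \<times> b | a b. a \<in> sets L \<and> b \<in> sets N}" by auto
    show "(\<Union>i::nat. space L \<times> space N) = space L \<times> space N" by simp
    show "emeasure (distr M (L \<Otimes>\<^sub>M N) (\<lambda>w. (Y w, X w))) (space L \<times> space N) \<noteq> \<infinity>" for i :: nat
      by (subst emeasure_distr) (auto simp: emeasure_eq_measure)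
    fix Z assume "Z \<in> {a \<times> b | a b. a \<in> sets L \<and> b \<in> sets N}"
    then obtain A B where Z: "Z = A \<times> B" and [measurable]: "A \<in> sets L" "B \<in> sets N" by auto
    have ZL [measurable]: "Z \<in> sets (L \<Otimes>\<^sub>M N)" unfolding Z by simp
    let ?F = "vimage_algebra (space M) X N"
    have sub: "subalgebra M ?F"
      using X by (auto simp: subalgebra_def sets_vimage_algebra2 measurable_def)
    interpret F: finite_measure_subalgebra M ?F by unfold_locales (rule sub)
    have XB: "X -` B \<inter> space M \<in> sets ?F" by (rule in_vimage_algebra) simp
    have ce: "AE w in M. real_cond_exp M ?F (\<lambda>w. indicat_real A (Y w)) w = measure (\<kappa> (X w)) A"
      using cd by (simp add: is_cond_distr_def)
    have m1 [measurable]: "(\<lambda>w. measure (\<kappa> (X w)) A) \<in> borel_measurable M" by measurable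
    have "emeasure (distr M (L \<Otimes>\<^sub>M N) (\<lambda>w. (Y w, X w))) Z = emeasure M ((\<lambda>w. (Y w, X w)) -` Z \<inter> space M)"
      by (rule emeasure_distr) auto
    also have "\<dots> = ennreal (\<integral>w\<in>(X -` B \<inter> space M). indicat_real A (Y w) \<partial>M)"
    proof -
      have "(\<integral>w\<in>(X -` B \<inter> space M). indicat_real A (Y w) \<partial>M) = (\<integral>w. indicat_real ((\<lambda>w. (Y w, X w)) -` Z \<inter> space M) w \<partial>M)"
        unfolding set_lebesgue_integral_def
        by (intro Bochner_Integration.integral_cong) (auto simp: Z indicator_def)
      also have "\<dots> = prob ((\<lambda>w. (Y w, X w)) -` Z \<inter> space M)" by simp
      finally show ?thesis by (simp add: emeasure_eq_measure)
    qed
    also have "(\<integral>w\<in>(X -` B \<inter> space M). indicat_real A (Y w) \<partial>M)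
        = (\<integral>w\<in>(X -` B \<inter> space M). real_cond_exp M ?F (\<lambda>w. indicat_real A (Y w)) w \<partial>M)"
      by (rule F.real_cond_exp_intA[OF _ XB]) (auto intro!: integrable_const_bound[of _ 1])
    also have "\<dots> = (\<integral>w. indicator B (X w) * measure (\<kappa> (X w)) A \<partial>M)"
      unfolding set_lebesgue_integral_def
    proof (rule integral_cong_AE)
      show "AE w in M. indicat_real (X -` B \<inter> space M) w *\<^sub>R real_cond_exp M ?F (\<lambda>w. indicat_real A (Y w)) w
         = indicator B (X w) * measure (\<kappa> (X w)) A"
        using ce AE_space by eventually_elim (auto simp: indicator_def)
      show "(\<lambda>w. indicat_real (X -` B \<inter> space M) w *\<^sub>R real_cond_exp M ?F (\<lambda>w. indicat_real A (Y w)) w) \<in> borel_measurable M"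
        by measurable
    qed measurable
    also have "ennreal \<dots> = (\<integral>\<^sup>+w. ennreal (indicator B (X w) * measure (\<kappa> (X w)) A) \<partial>M)"
      by (rule nn_integral_eq_integral[symmetric])
         (auto intro!: integrable_const_bound[of _ 1] AE_I2 mult_le_one prob_space.prob_le_1[OF \<kappa>p(1)[OF XN]])
    also have "\<dots> = (\<integral>\<^sup>+w. \<integral>\<^sup>+y. indicator Z (y, X w) \<partial>\<kappa> (X w) \<partial>M)"
    proof (rule nn_integral_cong)
      fix w assume w: "w \<in> space M"
      interpret k: prob_space "\<kappa> (X w)" by (rule \<kappa>p(1)[OF XN[OF w]])
      have "(\<integral>\<^sup>+y. indicator Z (y, X w) \<partial>\<kappa> (X w)) = (\<integral>\<^sup>+y. indicator B (X w) * indicator A y \<partial>\<kappa> (X w))"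
        by (intro nn_integral_cong) (auto simp: Z indicator_def)
      also have "\<dots> = indicator B (X w) * emeasure (\<kappa> (X w)) A"
        by (subst nn_integral_cmult_indicator) (auto simp: \<kappa>p(2)[OF XN[OF w]])
      finally show "ennreal (indicator B (X w) * measure (\<kappa> (X w)) A) = (\<integral>\<^sup>+y. indicator Z (y, X w) \<partial>\<kappa> (X w))"
        by (simp add: k.emeasure_eq_measure indicator_def)
    qed
    also have "\<dots> = (\<integral>\<^sup>+z. indicator Z z \<partial>\<nu>)" by (rule nu_int[symmetric]) measurable
    also have "\<dots> = emeasure \<nu> Z" by (rule nn_integral_indicator) (simp add: sets\<nu>)
    finally show "emeasure (distr M (L \<Otimes>\<^sub>M N) (\<lambda>w. (Y w, X w))) Z = emeasure \<nu> Z" .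
  qed
  have "(\<integral>\<^sup>+w. f (Y w, X w) \<partial>M) = (\<integral>\<^sup>+z. f z \<partial>distr M (L \<Otimes>\<^sub>M N) (\<lambda>w. (Y w, X w)))"
    by (rule nn_integral_distr[symmetric]) measurable
  also have "\<dots> = (\<integral>\<^sup>+w. \<integral>\<^sup>+y. f (y, X w) \<partial>\<kappa> (X w) \<partial>M)"
    unfolding eq by (rule nu_int) measurable
  finally show ?thesis .
qed

text \<open>The bound is nonnegativity of the variance of |X|. A hypothesis on the nonnegative
  integral yields integrability together with the estimate.\<close>

lemma (in prob_space) expectation_abs_le_sqrt:
  fixes X :: "'a \<Rightarrow> real"
  assumes [measurable]: "X \<in> borel_measurable M" and v: "(\<integral>\<^sup>+w. ennreal ((X w)\<^sup>2) \<partial>M) \<le> ennreal v" "v \<ge> 0"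
  shows "integrable M X" "(\<integral>w. \<bar>X w\<bar> \<partial>M) \<le> sqrt v"
proof -
  have i2: "integrable M (\<lambda>w. (X w)\<^sup>2)"
    by (rule integrableI_nonneg) (use v in \<open>auto simp: order_le_less_trans[OF v(1)]\<close>)
  have le: "norm \<bar>X w\<bar> \<le> norm (1 + (X w)\<^sup>2)" for w
  proof -
    have "0 \<le> (\<bar>X w\<bar> - 1)\<^sup>2" by simp
    hence "2 * \<bar>X w\<bar> \<le> 1 + (X w)\<^sup>2" by (simp add: power2_diff)
    thus ?thesis by simp
  qed
  have ia: "integrable M (\<lambda>w. \<bar>X w\<bar>)"
  proof (rule Bochner_Integration.integrable_bound[of M "\<lambda>w. 1 + (X w)\<^sup>2"])
    show "integrable M (\<lambda>w. 1 + (X w)\<^sup>2)" using i2 by simp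
    show "AE w in M. norm \<bar>X w\<bar> \<le> norm (1 + (X w)\<^sup>2)" using le by (intro AE_I2) blast
  qed measurable
  thus "integrable M X" using integrable_abs_iff[OF assms(1)] by blast
  have e: "(\<integral>w. (X w)\<^sup>2 \<partial>M) \<le> v"
  proof -
    have "ennreal (\<integral>w. (X w)\<^sup>2 \<partial>M) \<le> ennreal v"
      using v(1) by (subst nn_integral_eq_integral[OF i2, symmetric]) auto
    thus ?thesis using v(2) by (subst (asm) ennreal_le_iff)
  qed
  have "0 \<le> variance (\<lambda>w. \<bar>X w\<bar>)" by (rule variance_positive)
  also have "\<dots> = (\<integral>w. (X w)\<^sup>2 \<partial>M) - (\<integral>w. \<bar>X w\<bar> \<partial>M)\<^sup>2"
    by (subst variance_eq) (use ia i2 in auto)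
  finally have "(\<integral>w. \<bar>X w\<bar> \<partial>M)\<^sup>2 \<le> v" using e by linarith
  thus "(\<integral>w. \<bar>X w\<bar> \<partial>M) \<le> sqrt v" by (rule real_le_rsqrt)
qed

subsection \<open>The feedback model\<close>

lemma cvec_norm_sq: "v \<in> carrier_vec n \<Longrightarrow> (cvec_norm v)\<^sup>2 = sqn n (($) v)"
  by (auto simp: cvec_norm_eq_sqn sqn_nonneg)

lemma measurable_cvec_norm [measurable]: "cvec_norm \<in> borel_measurable (cvec_space n)"
proof -
  have "(\<lambda>v. sqrt (sqn n (($) v))) \<in> borel_measurable (cvec_space n)" by measurable
  thus ?thesis by (rule measurable_cong[THEN iffD1, rotated]) (auto simp: cvec_norm_eq_sqn)
qed

lemma direction_carrier [simp]: "v \<in> carrier_vec n \<Longrightarrow> direction v \<in> carrier_vec n"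
  by (simp add: direction_def)

lemma direction_coord: "v \<in> carrier_vec n \<Longrightarrow> k < n \<Longrightarrow> direction v $ k = of_real (1 / cvec_norm v) * v $ k"
  by (simp add: direction_def)

text \<open>This covers the zero vector: its direction is 0, since division by 0 gives 0.\<close>

lemma norm_times_direction:
  assumes "v \<in> carrier_vec n" "k < n"
  shows "of_real (cvec_norm v) * direction v $ k = v $ k"
proof (cases "cvec_norm v = 0")
  case True
  hence "sqn n (($) v) = 0" using cvec_norm_sq[OF assms(1)] by simp
  thus ?thesis using assms True by (simp add: sqn_zero_iff)
qed (use assms in \<open>simp add: direction_coord\<close>)

lemma measurable_direction [measurable]: "direction \<in> measurable (cvec_space n) (cvec_space n)"
proof (rule measurable_cvec_spaceI)
  fix k assume k: "k < n"
  have "(\<lambda>v. of_real (1 / cvec_norm v) * v $ k) \<in> borel_measurable (cvec_space n)" using k by measurable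
  thus "(\<lambda>v. direction v $ k) \<in> borel_measurable (cvec_space n)"
    by (rule measurable_cong[THEN iffD1, rotated]) (use k in \<open>auto simp: direction_coord\<close>)
qed simp

lemma measurable_sin2_angle [measurable]:
  "(\<lambda>(x, y). sin2_angle x y) \<in> borel_measurable (cvec_space n \<Otimes>\<^sub>M cvec_space n)"
proof -
  have "(\<lambda>(x, y). 1 - (cmod (cip n (($) x) (($) y)) / (cvec_norm x * cvec_norm y))\<^sup>2) \<in> borel_measurable (cvec_space n \<Otimes>\<^sub>M cvec_space n)"
    by measurable
  thus ?thesis
    by (rule measurable_cong[THEN iffD1, rotated])
       (auto simp: sin2_angle_def scalar_prod_eq_cip space_pair_measure)
qed

lemma sin2_angle_bounds:
  assumes "x \<in> carrier_vec n" "y \<in> carrier_vec n"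
  shows "0 \<le> sin2_angle x y" "sin2_angle x y \<le> 1"
proof -
  have "(cmod (x \<bullet>c y))\<^sup>2 \<le> (cvec_norm x)\<^sup>2 * (cvec_norm y)\<^sup>2"
    using cip_Cauchy_Schwarz[of n "($) x" "($) y"] assms
    by (simp add: scalar_prod_eq_cip[of _ n] cvec_norm_sq[of _ n])
  hence "(cmod (x \<bullet>c y) / (cvec_norm x * cvec_norm y))\<^sup>2 \<le> 1"
    unfolding power_divide power_mult_distrib by (intro divide_le_eq_1[THEN iffD2]) (auto simp: zero_less_mult_iff)
  thus "0 \<le> sin2_angle x y" by (simp add: sin2_angle_def)
  show "sin2_angle x y \<le> 1" by (simp add: sin2_angle_def)
qed

lemma orthogonal_compl_0: "orthogonal_compl n (0\<^sub>v n) = carrier_vec n"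
  by (auto simp: orthogonal_compl_def)

locale qub_setup = qub_feedback M K r h hh e
  for M :: "'w measure" and K r h hh e +
  assumes K2: "2 \<le> K" and r0: "0 \<le> r"
begin

declare rv_h [measurable] rv_hh [measurable] rv_e [measurable]

abbreviation "C \<equiv> cvec_space K"
abbreviation "PH \<equiv> Pi\<^sub>M {..<K} (\<lambda>_. cvec_space K)"

text \<open>The point where the prescribed distribution function of the squared sine reaches 1, that
  is, the squared sine of the opening angle of the cap.\<close>

definition D :: real where "D = 2 powr (- r / real (K - 1))"
definition d :: "nat \<Rightarrow> 'w \<Rightarrow> real" where "d i w = sin2_angle (direction (h i w)) (hh i w)"
definition Hv :: "'w \<Rightarrow> nat \<Rightarrow> cvec" where "Hv w = (\<lambda>j\<in>{..<K}. hh j w)"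

lemma h_carrier: "i < K \<Longrightarrow> w \<in> space M \<Longrightarrow> h i w \<in> carrier_vec K"
  using measurable_space[OF rv_h, of i w] by simp
lemma hh_carrier: "i < K \<Longrightarrow> w \<in> space M \<Longrightarrow> hh i w \<in> carrier_vec K"
  using measurable_space[OF rv_hh, of i w] by simp
lemma e_carrier: "i < K \<Longrightarrow> w \<in> space M \<Longrightarrow> e i w \<in> carrier_vec K"
  using measurable_space[OF rv_e, of i w] by simp

lemma Hv_measurable [measurable]: "Hv \<in> measurable M PH"
  unfolding Hv_def by (rule measurable_restrict) simp

lemma D_pos: "0 < D" by (simp add: D_def)
lemma D_le_1: "D \<le> 1" using r0 powr_mono[of "- r / real (K - 1)" 0 2] by (simp add: D_def)

lemma D_power: "2 powr r * D ^ (K - 1) = 1"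
proof -
  have "D ^ (K - 1) = 2 powr (- r / real (K - 1) * real (K - 1))"
    unfolding powr_realpow[OF D_pos, symmetric] unfolding D_def by (rule powr_powr)
  also have "- r / real (K - 1) * real (K - 1) = - r" using K2 by simp
  finally show ?thesis by (simp add: powr_add[symmetric])
qed

lemma d_measurable [measurable]: "i < K \<Longrightarrow> d i \<in> borel_measurable M"
proof -
  assume i: "i < K"
  have "(\<lambda>w. (direction (h i w), hh i w)) \<in> measurable M (C \<Otimes>\<^sub>M C)" using i by measurable
  from measurable_compose[OF this measurable_sin2_angle] show ?thesis by (simp add: d_def[abs_def])
qed

lemma d_bounds: "i < K \<Longrightarrow> w \<in> space M \<Longrightarrow> 0 \<le> d i w" "i < K \<Longrightarrow> w \<in> space M \<Longrightarrow> d i w \<le> 1"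
  using sin2_angle_bounds[of "direction (h i w)" K "hh i w"] h_carrier hh_carrier by (auto simp: d_def)

lemma hh_uniform_sphere: "i < K \<Longrightarrow> uniform_sphere K (0\<^sub>v K) (distr M C (hh i))"
  using hh_uniform[of i] by (simp add: uniform_sphere_def orthogonal_compl_0)

lemma hh_unit: "i < K \<Longrightarrow> AE w in M. sqn K (($) (hh i w)) = 1"
proof -
  assume i: "i < K"
  interpret U: uniform_sphere K "0\<^sub>v K" "distr M C (hh i)" by (rule hh_uniform_sphere[OF i])
  have "AE x in distr M C (hh i). sqn K (($) x) = 1" using U.AE_unit by eventually_elim simp
  thus ?thesis by (rule AE_distrD[OF rv_hh[OF i]])
qed

lemma prob_d_le: "i < K \<Longrightarrow> 0 \<le> x \<Longrightarrow> x \<le> D \<Longrightarrow> prob {w \<in> space M. d i w \<le> x} = 2 powr r * x ^ (K - 1)"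
  using dc2_cdf[of i x] by (simp add: d_def D_def)

lemma d_le_D: "i < K \<Longrightarrow> AE w in M. d i w \<le> D"
proof -
  assume i: "i < K"
  have "prob {w \<in> space M. d i w \<le> D} = 1" using prob_d_le[OF i, of D] D_pos D_power by simp
  thus ?thesis using AE_prob_1[of "{w \<in> space M. d i w \<le> D}"] by auto
qed

lemma d_pos: "i < K \<Longrightarrow> AE w in M. 0 < d i w"
proof -
  assume i: "i < K"
  have "prob {w \<in> space M. d i w \<le> 0} = 0" using prob_d_le[OF i, of 0] D_pos K2 by (simp add: zero_power)
  hence "AE w in M. w \<notin> {w \<in> space M. d i w \<le> 0}"
    using i by (subst AE_iff_measurable[of "{w \<in> space M. d i w \<le> 0}"]) (auto simp: emeasure_eq_measure)
  thus ?thesis using AE_space by eventually_elim auto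
qed

text \<open>Tail formula: Fubini on the region 0 < x < d turns the mean into the integral of Pr (d >
  x). The region is cut off at D because the distribution function is prescribed only up to there;
  almost surely d <= D, so nothing is lost.\<close>

lemma nn_integral_d: "i < K \<Longrightarrow> (\<integral>\<^sup>+w. ennreal (d i w) \<partial>M) = ennreal (D * real (K - 1) / real K)"
proof -
  assume i: "i < K"
  note [measurable] = d_measurable[OF i]
  have "(\<integral>\<^sup>+w. ennreal (d i w) \<partial>M) = (\<integral>\<^sup>+w. \<integral>\<^sup>+x. indicator {w. 0 < snd w \<and> snd w < d i (fst w) \<and> snd w < D} (w, x) \<partial>lborel \<partial>M)"
  proof (rule nn_integral_cong_AE)
    show "AE w in M. ennreal (d i w) = (\<integral>\<^sup>+x. indicator {w. 0 < snd w \<and> snd w < d i (fst w) \<and> snd w < D} (w, x) \<partial>lborel)"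
      using d_le_D[OF i] AE_space
    proof eventually_elim
      case (elim w)
      have "(\<integral>\<^sup>+x. indicator {w. 0 < snd w \<and> snd w < d i (fst w) \<and> snd w < D} (w, x) \<partial>lborel)
          = (\<integral>\<^sup>+x. indicator {0<..<d i w} x \<partial>lborel)"
        using elim by (intro nn_integral_cong) (auto simp: indicator_def)
      also have "\<dots> = ennreal (d i w)" using d_bounds(1)[OF i elim(2)] by simp
      finally show ?case by simp
    qed
  qed
  also have "\<dots> = (\<integral>\<^sup>+x. \<integral>\<^sup>+w. indicator {w. 0 < snd w \<and> snd w < d i (fst w) \<and> snd w < D} (w, x) \<partial>M \<partial>lborel)"
  proof -
    interpret MM: pair_sigma_finite M "lborel :: real measure" ..
    show ?thesis by (rule MM.Fubini'[symmetric]) measurable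
  qed
  also have "\<dots> = (\<integral>\<^sup>+x. ennreal (1 - 2 powr r * x ^ (K - 1)) * indicator {0<..<D} x \<partial>lborel)"
  proof (rule nn_integral_cong)
    fix x :: real
    show "(\<integral>\<^sup>+w. indicator {w. 0 < snd w \<and> snd w < d i (fst w) \<and> snd w < D} (w, x) \<partial>M) = ennreal (1 - 2 powr r * x ^ (K - 1)) * indicator {0<..<D} x"
    proof (cases "0 < x \<and> x < D")
      case True
      have "(\<integral>\<^sup>+w. indicator {w. 0 < snd w \<and> snd w < d i (fst w) \<and> snd w < D} (w, x) \<partial>M)
        = (\<integral>\<^sup>+w. indicator {w \<in> space M. \<not> d i w \<le> x} w \<partial>M)"
        using True by (intro nn_integral_cong) (auto simp: indicator_def)
      also have "\<dots> = ennreal (prob {w \<in> space M. \<not> d i w \<le> x})" by (simp add: emeasure_eq_measure)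
      also have "prob {w \<in> space M. \<not> d i w \<le> x} = 1 - 2 powr r * x ^ (K - 1)"
        using prob_neg[of "\<lambda>w. d i w \<le> x"] prob_d_le[OF i, of x] True by simp
      finally show ?thesis using True by simp
    qed auto
  qed
  also have "\<dots> = (\<integral>\<^sup>+x. ennreal (1 - 2 powr r * x ^ (K - 1)) * indicator {0..D} x \<partial>lborel)"
  proof (rule nn_integral_cong_AE)
    have "AE x in lborel. x \<noteq> (0::real)" "AE x in lborel. x \<noteq> D" by (rule AE_lborel_singleton)+
    thus "AE x in lborel. ennreal (1 - 2 powr r * x ^ (K - 1)) * indicator {0<..<D} x = ennreal (1 - 2 powr r * x ^ (K - 1)) * indicator {0..D} x"
      by eventually_elim (auto simp: indicator_def)
  qed
  also have "\<dots> = ennreal ((D - 2 powr r * D ^ K / real K) - (0 - 2 powr r * 0 ^ K / real K))"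
  proof (rule nn_integral_FTC_Icc[where F = "\<lambda>x. x - 2 powr r * x ^ K / real K"])
    fix x assume x: "x \<in> {0..D}"
    have "((\<lambda>x. x - 2 powr r * x ^ K / real K) has_real_derivative 1 - 2 powr r * (real K * x ^ (K - 1)) / real K) (at x)"
      by (auto intro!: derivative_eq_intros)
    thus "((\<lambda>x. x - 2 powr r * x ^ K / real K) has_real_derivative 1 - 2 powr r * x ^ (K - 1)) (at x)"
      using K2 by simp
    have "2 powr r * x ^ (K - 1) \<le> 2 powr r * D ^ (K - 1)" using x by (intro mult_left_mono power_mono) auto
    thus "0 \<le> 1 - 2 powr r * x ^ (K - 1)" unfolding D_power by linarith
  qed (use D_pos in auto)
  also have "(D - 2 powr r * D ^ K / real K) - (0 - 2 powr r * 0 ^ K / real K) = D * real (K - 1) / real K"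
  proof -
    have "2 powr r * D ^ K = D"
      using D_power K2 power_Suc[of D "K - 1"] by (simp add: mult_ac)
    thus ?thesis using K2 by (simp add: field_simps of_nat_diff)
  qed
  finally show ?thesis .
qed

lemma decomposition_coord:
  assumes i: "i < K"
  shows "AE w in M. \<forall>k<K. direction (h i w) $ k = of_real (sqrt (1 - d i w)) * hh i w $ k + of_real (sqrt (d i w)) * e i w $ k"
  using decomposition[OF i] AE_space
proof eventually_elim
  case (elim w)
  show ?case
  proof (intro allI impI)
    fix k assume k: "k < K"
    have "direction (h i w) $ k = (complex_of_real (sqrt (1 - d i w)) \<cdot>\<^sub>v hh i w + complex_of_real (sqrt (d i w)) \<cdot>\<^sub>v e i w) $ k"
      using elim(1) unfolding d_def by simp
    thus "direction (h i w) $ k = of_real (sqrt (1 - d i w)) * hh i w $ k + of_real (sqrt (d i w)) * e i w $ k"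
      using k hh_carrier[OF i elim(2)] e_carrier[OF i elim(2)] by simp
  qed
qed

lemma nn_integral_norm_sq: "i < K \<Longrightarrow> (\<integral>\<^sup>+w. ennreal ((cvec_norm (h i w))\<^sup>2) \<partial>M) = ennreal (real K)"
proof -
  assume i: "i < K"
  have "(\<integral>\<^sup>+w. ennreal ((cvec_norm (h i w))\<^sup>2) \<partial>M) = (\<integral>\<^sup>+w. (\<Sum>k<K. ennreal ((cmod (h i w $ k))^(2*1))) \<partial>M)"
    using h_carrier[OF i] by (intro nn_integral_cong) (simp add: cvec_norm_sq[of _ K] sqn_def sum_ennreal)
  also have "\<dots> = (\<Sum>k<K. \<integral>\<^sup>+w. ennreal ((cmod (h i w $ k))^(2*1)) \<partial>M)"
    by (rule nn_integral_sum) (use i in measurable)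
  also have "\<dots> = (\<Sum>k<K. 1)"
    by (rule sum.cong[OF refl], subst std_cn_nn_moment[OF cn_marginal]) (use i in auto)
  finally show ?thesis by (simp add: ennreal_of_nat_eq_real_of_nat)
qed

text \<open>The centred squares Z_k are independent and have variance 2! - 1 = 1, so only the
  diagonal of the double sum contributes.\<close>

lemma nn_integral_norm_var: "i < K \<Longrightarrow> (\<integral>\<^sup>+w. ennreal (((cvec_norm (h i w))\<^sup>2 - real K)\<^sup>2) \<partial>M) = ennreal (real K)"
proof -
  assume i: "i < K"
  define Z where "Z k w = (cmod (h i w $ k))\<^sup>2 - 1" for k w
  have [measurable]: "Z k \<in> borel_measurable M" if "k < K" for k
    unfolding Z_def using i that by measurable
  have i2: "integrable M (\<lambda>w. (cmod (h i w $ k))\<^sup>2)" "(\<integral>w. (cmod (h i w $ k))\<^sup>2 \<partial>M) = 1" if "k < K" for k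
    using integral_eq_nn_integral[of "\<lambda>w. (cmod (h i w $ k))\<^sup>2" M] std_cn_nn_moment[OF cn_marginal[OF i that], of 1] i that
    by (auto intro!: integrableI_nonneg)
  have i4: "integrable M (\<lambda>w. (cmod (h i w $ k))^4)" "(\<integral>w. (cmod (h i w $ k))^4 \<partial>M) = 2" if "k < K" for k
    using integral_eq_nn_integral[of "\<lambda>w. (cmod (h i w $ k))^4" M] std_cn_nn_moment[OF cn_marginal[OF i that], of 2] i that
    by (auto intro!: integrableI_nonneg)
  have Z1: "integrable M (Z k)" "(\<integral>w. Z k w \<partial>M) = 0" if "k < K" for k
    unfolding Z_def using i2[OF that] by (auto simp: prob_space)
  have Ze: "Z k w * Z k w = (cmod (h i w $ k))^4 - 2 * (cmod (h i w $ k))\<^sup>2 + 1" for k w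
    by (simp add: Z_def power2_eq_square power4_eq_xxxx algebra_simps)
  have Z2: "integrable M (\<lambda>w. Z k w * Z k w)" "(\<integral>w. Z k w * Z k w \<partial>M) = 1" if "k < K" for k
    unfolding Ze using i2[OF that] i4[OF that] by (auto simp: prob_space)
  have ind: "indep_vars (\<lambda>_. borel) Z {..<K}"
    unfolding Z_def by (rule indep_vars_compose2[OF cn_indep[OF i]]) measurable
  have Zjk: "integrable M (\<lambda>w. Z j w * Z k w)" "(\<integral>w. Z j w * Z k w \<partial>M) = (if j = k then 1 else 0)" if jk: "j < K" "k < K" for j k
  proof -
    have "integrable M (\<lambda>w. Z j w * Z k w) \<and> (\<integral>w. Z j w * Z k w \<partial>M) = (if j = k then 1 else 0)"
    proof (cases "j = k")
      case True thus ?thesis using Z2 jk by simp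
    next
      case False
      have s: "indep_vars (\<lambda>_. borel) Z {j, k}" by (rule indep_vars_subset[OF ind]) (use jk in auto)
      have fin: "finite {j, k}" by simp
      have int: "\<And>l. l \<in> {j, k} \<Longrightarrow> integrable M (Z l)" using Z1 jk by auto
      show ?thesis
        using indep_vars_lebesgue_integral[OF fin s int] indep_vars_integrable[OF fin s int] False Z1(2) jk by simp
    qed
    thus "integrable M (\<lambda>w. Z j w * Z k w)" "(\<integral>w. Z j w * Z k w \<partial>M) = (if j = k then 1 else 0)" by auto
  qed
  have eq: "((cvec_norm (h i w))\<^sup>2 - real K)\<^sup>2 = (\<Sum>j<K. \<Sum>k<K. Z j w * Z k w)" if "w \<in> space M" for w
  proof -
    have "(cvec_norm (h i w))\<^sup>2 - real K = (\<Sum>k<K. Z k w)"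
      using h_carrier[OF i that] by (simp add: cvec_norm_sq[of _ K] sqn_def Z_def sum_subtractf)
    thus ?thesis by (simp add: power2_eq_square sum_product)
  qed
  have int: "integrable M (\<lambda>w. \<Sum>j<K. \<Sum>k<K. Z j w * Z k w)"
    by (intro Bochner_Integration.integrable_sum Zjk(1)) auto
  have nonneg: "AE w in M. 0 \<le> (\<Sum>j<K. \<Sum>k<K. Z j w * Z k w)"
    by (rule AE_I2) (simp add: eq[symmetric])
  have "(\<integral>\<^sup>+w. ennreal (((cvec_norm (h i w))\<^sup>2 - real K)\<^sup>2) \<partial>M) = (\<integral>\<^sup>+w. ennreal (\<Sum>j<K. \<Sum>k<K. Z j w * Z k w) \<partial>M)"
    by (intro nn_integral_cong) (simp add: eq)
  also have "\<dots> = ennreal (\<integral>w. (\<Sum>j<K. \<Sum>k<K. Z j w * Z k w) \<partial>M)"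
    by (rule nn_integral_eq_integral[OF int nonneg])
  also have "(\<integral>w. (\<Sum>j<K. \<Sum>k<K. Z j w * Z k w) \<partial>M) = (\<Sum>j<K. \<Sum>k<K. (\<integral>w. Z j w * Z k w \<partial>M))"
  proof -
    have "(\<integral>w. (\<Sum>j<K. \<Sum>k<K. Z j w * Z k w) \<partial>M) = (\<Sum>j<K. (\<integral>w. (\<Sum>k<K. Z j w * Z k w) \<partial>M))"
      by (intro Bochner_Integration.integral_sum Bochner_Integration.integrable_sum Zjk(1)) auto
    also have "\<dots> = (\<Sum>j<K. \<Sum>k<K. (\<integral>w. Z j w * Z k w \<partial>M))"
      by (intro sum.cong refl Bochner_Integration.integral_sum Zjk(1)) auto
    finally show ?thesis .
  qed
  also have "\<dots> = (\<Sum>j<K. \<Sum>k<K. if j = k then 1 else 0)" using Zjk(2) by (intro sum.cong refl) auto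
  also have "\<dots> = real K" by simp
  finally show ?thesis .
qed

end

subsection \<open>Second moments of the channel\<close>

text \<open>On the support only the component of b orthogonal to u acts, and
  \<open>moment_shift\<close> applies to that component.\<close>

lemma (in uniform_sphere) nn_integral_shift:
  assumes \<theta>: "sqn n (($) u) = 1"
  shows "(\<integral>\<^sup>+x. ennreal ((cmod (z + c * cip n (($) x) b))\<^sup>2) \<partial>\<mu>)
    = ennreal ((cmod z)\<^sup>2 + (cmod c)\<^sup>2 * ((sqn n b - (cmod (cip n b (($) u)))\<^sup>2) / (real n - 1)))"
proof -
  define \<gamma> where "\<gamma> = cip n b (($) u)"
  define a where "a = (\<lambda>k. b k - \<gamma> * u $ k)"
  have uu: "cip n (($) u) (($) u) = 1" by (simp add: cip_self \<theta>)
  have ub: "cip n (($) u) b = cnj \<gamma>" by (simp add: \<gamma>_def cnj_cip)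
  have au: "cip n a (($) u) = 0" by (simp add: a_def cip_linear uu \<gamma>_def[symmetric])
  have "cip n a a = cip n a b - cnj \<gamma> * cip n a (($) u)"
    by (subst (2) a_def) (simp add: cip_linear)
  also have "\<dots> = of_real (sqn n b) - \<gamma> * cnj \<gamma>"
    by (simp add: au) (simp add: a_def cip_linear ub cip_self)
  finally have sa: "sqn n a = sqn n b - (cmod \<gamma>)\<^sup>2"
    by (simp add: sqn_eq_Re_cip flip: complex_norm_square)
  let ?f = "\<lambda>x. (cmod (z + c * cip n (($) x) a))\<^sup>2"
  have "(\<integral>\<^sup>+x. ennreal ((cmod (z + c * cip n (($) x) b))\<^sup>2) \<partial>\<mu>) = (\<integral>\<^sup>+x. ennreal (?f x) \<partial>\<mu>)"
    by (rule nn_integral_cong_AE, use AE_unit in eventually_elim) (simp add: a_def cip_linear)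
  also have "\<dots> = ennreal (\<integral>x. ?f x \<partial>\<mu>)"
  proof (rule nn_integral_eq_integral)
    show "integrable \<mu> ?f"
    proof (rule integrable_bounded[of _ "2 * ((cmod z)\<^sup>2 + (cmod c)\<^sup>2 * sqn n a)"])
      show "AE x in \<mu>. \<bar>?f x\<bar> \<le> 2 * ((cmod z)\<^sup>2 + (cmod c)\<^sup>2 * sqn n a)"
        using AE_cip_bound[of a]
      proof eventually_elim
        case (elim x)
        have "?f x \<le> 2 * ((cmod z)\<^sup>2 + (cmod (c * cip n (($) x) a))\<^sup>2)"
          using cmod_parallelogram[of z "c * cip n (($) x) a"] zero_le_power2[of "cmod (z - c * cip n (($) x) a)"] by linarith
        also have "\<dots> \<le> 2 * ((cmod z)\<^sup>2 + (cmod c)\<^sup>2 * sqn n a)"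
          using elim by (simp add: norm_mult power_mult_distrib mult_left_mono)
        finally show ?case by simp
      qed
    qed measurable
  qed simp
  also have "(\<integral>x. ?f x \<partial>\<mu>) = (cmod z)\<^sup>2 + (cmod c)\<^sup>2 * (sqn n a / (real n - 1))"
    using moment_shift[of 1 a z c] \<theta> au by simp
  finally show ?thesis by (simp add: sa \<gamma>_def)
qed

context qub_setup
begin

text \<open>The tuple of quantized directions in which slot i holds a free variable u while the
  other users keep their values at w. It separates user i from the rest.\<close>

definition Hu :: "nat \<Rightarrow> 'w \<Rightarrow> cvec \<Rightarrow> nat \<Rightarrow> cvec" where
  "Hu i w u = (\<lambda>j\<in>{..<K}. if j = i then u else hh j w)"

lemma Hu_measurable: "w \<in> space M \<Longrightarrow> Hu i w \<in> measurable C PH"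
  unfolding Hu_def by (rule measurable_restrict) (auto simp: hh_carrier)

lemma Hu_same: "i < K \<Longrightarrow> Hu i w (hh i w) = Hv w"
  by (auto simp: Hu_def Hv_def)

text \<open>The tuple \<open>Hv w\<close> involves user i, so it is not independent of (h i, hh i).
  It is, however, a function of hh i and of the block of the other users, and those blocks are
  independent.\<close>

lemma user_decouple:
  assumes i: "i < K" and f [measurable]: "f \<in> borel_measurable ((C \<Otimes>\<^sub>M C) \<Otimes>\<^sub>M PH)"
  shows "(\<integral>\<^sup>+w. f ((h i w, hh i w), Hv w) \<partial>M) = (\<integral>\<^sup>+w'. \<integral>\<^sup>+w. f ((h i w, hh i w), Hu i w' (hh i w)) \<partial>M \<partial>M)"
proof -
  let ?B = "{..<K} - {i}" and ?CC = "\<lambda>_::nat. C \<Otimes>\<^sub>M C"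
  define X where "X = (\<lambda>w. \<lambda>j\<in>{i}. (h j w, hh j w))"
  define Y where "Y = (\<lambda>w. \<lambda>j\<in>?B. (h j w, hh j w))"
  have "indep_var (PiM {i} ?CC) X (PiM ?B ?CC) Y"
    unfolding X_def Y_def by (rule indep_var_restrict[OF users_indep]) (use i in auto)
  hence X: "X \<in> measurable M (PiM {i} ?CC)" and Y: "Y \<in> measurable M (PiM ?B ?CC)"
    and eq: "distr M (PiM {i} ?CC) X \<Otimes>\<^sub>M distr M (PiM ?B ?CC) Y = distr M (PiM {i} ?CC \<Otimes>\<^sub>M PiM ?B ?CC) (\<lambda>w. (X w, Y w))"
    unfolding indep_var_distribution_eq by auto
  define g where "g z = f (fst z i, \<lambda>j\<in>{..<K}. if j = i then snd (fst z i) else snd (snd z j))" for z :: "(nat \<Rightarrow> cvec \<times> cvec) \<times> (nat \<Rightarrow> cvec \<times> cvec)"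
  have m1: "(\<lambda>z. fst z i) \<in> measurable (PiM {i} ?CC \<Otimes>\<^sub>M PiM ?B ?CC) (C \<Otimes>\<^sub>M C)"
    by (rule measurable_compose[OF measurable_fst measurable_component_singleton]) simp
  have m2: "(\<lambda>z. snd z j) \<in> measurable (PiM {i} ?CC \<Otimes>\<^sub>M PiM ?B ?CC) (C \<Otimes>\<^sub>M C)" if "j \<in> ?B" for j
    by (rule measurable_compose[OF measurable_snd measurable_component_singleton[OF that]])
  have m3: "(\<lambda>z. \<lambda>j\<in>{..<K}. if j = i then snd (fst z i) else snd (snd z j)) \<in> measurable (PiM {i} ?CC \<Otimes>\<^sub>M PiM ?B ?CC) PH"
  proof (rule measurable_restrict)
    fix j assume "j \<in> {..<K}"
    thus "(\<lambda>z. if j = i then snd (fst z i) else snd (snd z j)) \<in> measurable (PiM {i} ?CC \<Otimes>\<^sub>M PiM ?B ?CC) C"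
      using measurable_compose[OF m1 measurable_snd] measurable_compose[OF m2 measurable_snd, of j] by (cases "j = i") auto
  qed
  have g: "g \<in> borel_measurable (PiM {i} ?CC \<Otimes>\<^sub>M PiM ?B ?CC)"
    unfolding g_def by (rule measurable_compose[OF measurable_Pair[OF m1 m3] f])
  have e: "g (X w, Y w') = f ((h i w, hh i w), Hu i w' (hh i w))" for w w'
    unfolding g_def Hu_def X_def Y_def by (rule arg_cong[of _ _ f]) auto
  show ?thesis using decouple_nn[OF X Y eq g] unfolding e Hu_same[OF i] .
qed

text \<open>The kernel is controlled only at unit vectors, which is why its uses below first discard
  the null set of \<open>hh_unit\<close>.\<close>

definition kap :: "nat \<Rightarrow> cvec \<Rightarrow> cvec measure" where
  "kap i = (SOME \<kappa>. is_cond_distr M C (hh i) C (e i) \<kappa> \<and>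
      (\<forall>u\<in>carrier_vec K. cvec_norm u = 1 \<longrightarrow> uniform_on_unit_sphere K (orthogonal_compl K u) (\<kappa> u)))"

lemma kap: assumes "i < K"
  shows "is_cond_distr M C (hh i) C (e i) (kap i)"
    and "\<And>u. u \<in> carrier_vec K \<Longrightarrow> sqn K (($) u) = 1 \<Longrightarrow> uniform_sphere K u (kap i u)"
  using someI_ex[OF e_isotropic[OF assms]] unfolding kap_def[symmetric]
  by (auto simp: uniform_sphere_def cvec_norm_eq_sqn)

lemma kap_measurable [measurable]: "i < K \<Longrightarrow> kap i \<in> measurable C (subprob_algebra C)"
  using kap(1)[of i] measurable_prob_algebraD by (auto simp: is_cond_distr_def)

lemma e_hh_kernel:
  assumes "i < K" "f \<in> borel_measurable (C \<Otimes>\<^sub>M C)"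
  shows "(\<integral>\<^sup>+w. f (e i w, hh i w) \<partial>M) = (\<integral>\<^sup>+w. \<integral>\<^sup>+x. f (x, hh i w) \<partial>kap i (hh i w) \<partial>M)"
  by (rule disintegrate_nn[OF rv_hh rv_e kap(1)]) (use assms in auto)

lemma integral_d: assumes i: "i < K"
  shows "integrable M (d i)" "(\<integral>w. d i w \<partial>M) = D * real (K - 1) / real K"
proof -
  show 1: "integrable M (d i)"
    by (rule integrable_const_bound[of _ 1]) (use d_bounds[OF i] i in auto)
  have "ennreal (\<integral>w. d i w \<partial>M) = ennreal (D * real (K - 1) / real K)"
    unfolding nn_integral_d[OF i, symmetric]
    by (rule nn_integral_eq_integral[OF 1, symmetric]) (use d_bounds[OF i] in auto)
  moreover have "0 \<le> (\<integral>w. d i w \<partial>M)" by (rule integral_nonneg_AE) (use d_bounds[OF i] in auto)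
  ultimately show "(\<integral>w. d i w \<partial>M) = D * real (K - 1) / real K"
    using D_pos by (subst (asm) ennreal_inj) auto
qed

text \<open>The norm contributes its mean K by \<open>norm_indep\<close>, d is separated from (e, u)
  by \<open>dc2_indep\<close>, and e is averaged by its kernel, under which its cross term with u
  vanishes. The test function \<phi> makes the identity one about conditional expectations.\<close>

lemma user_second_moment:
  assumes i: "i < K" and a [measurable]: "\<And>k. k < K \<Longrightarrow> (\<lambda>u. a u k) \<in> borel_measurable C"
    and \<phi> [measurable]: "\<phi> \<in> borel_measurable C"
  shows "(\<integral>\<^sup>+w. ennreal ((cmod (cip K (($) (h i w)) (a (hh i w))))\<^sup>2) * \<phi> (hh i w) \<partial>M)
    = (\<integral>\<^sup>+w. ennreal (real K * (1 - D) * (cmod (cip K (($) (hh i w)) (a (hh i w))))\<^sup>2 + D * sqn K (a (hh i w))) * \<phi> (hh i w) \<partial>M)"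
proof -
  note [measurable] = rv_h[OF i] rv_hh[OF i] rv_e[OF i] d_measurable[OF i]
  define \<alpha> where "\<alpha> w = (cmod (cip K (($) (hh i w)) (a (hh i w))))\<^sup>2" for w
  define \<gamma> where "\<gamma> w = (sqn K (a (hh i w)) - \<alpha> w) / (real K - 1)" for w
  have \<alpha>0: "0 \<le> \<alpha> w" for w by (simp add: \<alpha>_def)
  have \<gamma>0: "0 \<le> \<gamma> w" if "sqn K (($) (hh i w)) = 1" for w
    using cip_Cauchy_Schwarz[of K "($) (hh i w)" "a (hh i w)"] that K2 by (simp add: \<gamma>_def \<alpha>_def)
  have [measurable]: "\<alpha> \<in> borel_measurable M" "\<gamma> \<in> borel_measurable M"
    unfolding \<alpha>_def \<gamma>_def by measurable
  let ?G = "\<lambda>x u. ennreal ((cmod (cip K (($) x) (a u)))\<^sup>2) * \<phi> u"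
  define F where "F = (\<lambda>(t, (x, u)). ennreal ((cmod (of_real (sqrt (1 - t)) * cip K (($) u) (a u) + of_real (sqrt t) * cip K (($) x) (a u)))\<^sup>2) * \<phi> u)"
  have F [measurable]: "F \<in> borel_measurable (borel \<Otimes>\<^sub>M (C \<Otimes>\<^sub>M C))" unfolding F_def by measurable
  have "(\<integral>\<^sup>+w. ?G (h i w) (hh i w) \<partial>M) = (\<integral>\<^sup>+w. (\<lambda>(t, (x, u)). ennreal (t\<^sup>2) * ?G x u) (cvec_norm (h i w), (direction (h i w), hh i w)) \<partial>M)"
  proof (rule nn_integral_cong)
    fix w assume w: "w \<in> space M"
    have "cip K (($) (h i w)) z = of_real (cvec_norm (h i w)) * cip K (($) (direction (h i w))) z" for z
      unfolding cip_scale_left[symmetric] by (rule cip_cong) (simp_all add: norm_times_direction[OF h_carrier[OF i w]])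
    thus "?G (h i w) (hh i w) = (\<lambda>(t, (x, u)). ennreal (t\<^sup>2) * ?G x u) (cvec_norm (h i w), (direction (h i w), hh i w))"
      by (simp add: norm_mult power_mult_distrib ennreal_mult' mult_ac)
  qed
  also have "\<dots> = (\<integral>\<^sup>+w'. \<integral>\<^sup>+w. (\<lambda>(t, (x, u)). ennreal (t\<^sup>2) * ?G x u) (cvec_norm (h i w), (direction (h i w'), hh i w')) \<partial>M \<partial>M)"
    by (rule indep_rv_decouple_nn[OF norm_indep[OF i]]) measurable
  also have "\<dots> = (\<integral>\<^sup>+w'. ennreal (real K) * ?G (direction (h i w')) (hh i w') \<partial>M)"
    by (intro nn_integral_cong) (simp add: nn_integral_multc nn_integral_norm_sq[OF i])
  also have "\<dots> = ennreal (real K) * (\<integral>\<^sup>+w. ?G (direction (h i w)) (hh i w) \<partial>M)"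
    by (rule nn_integral_cmult) measurable
  also have "(\<integral>\<^sup>+w. ?G (direction (h i w)) (hh i w) \<partial>M) = (\<integral>\<^sup>+w. F (d i w, (e i w, hh i w)) \<partial>M)"
  proof (rule nn_integral_cong_AE)
    show "AE w in M. ?G (direction (h i w)) (hh i w) = F (d i w, (e i w, hh i w))"
      using decomposition_coord[OF i]
    proof eventually_elim
      case (elim w)
      have "cip K (($) (direction (h i w))) z = of_real (sqrt (1 - d i w)) * cip K (($) (hh i w)) z + of_real (sqrt (d i w)) * cip K (($) (e i w)) z" for z
        unfolding cip_scale_left[symmetric] cip_add_left[symmetric] by (rule cip_cong) (use elim in auto)
      thus ?case by (simp add: F_def)
    qed
  qed
  also have "\<dots> = (\<integral>\<^sup>+w'. \<integral>\<^sup>+w. F (d i w, (e i w', hh i w')) \<partial>M \<partial>M)"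
    using dc2_indep[OF i] unfolding d_def[symmetric] by (rule indep_rv_decouple_nn) measurable
  \<comment> \<open>After the exchange d is a constant in the inner integral, so the kernel of e
    applies there.\<close>
  also have "\<dots> = (\<integral>\<^sup>+w. \<integral>\<^sup>+w'. F (d i w, (e i w', hh i w')) \<partial>M \<partial>M)"
  proof -
    interpret MM: pair_sigma_finite M M ..
    show ?thesis by (rule MM.Fubini') measurable
  qed
  also have "\<dots> = (\<integral>\<^sup>+w. \<integral>\<^sup>+w'. ennreal ((1 - d i w) * \<alpha> w' + d i w * \<gamma> w') * \<phi> (hh i w') \<partial>M \<partial>M)"
  proof (rule nn_integral_cong)
    fix w assume w: "w \<in> space M"
    note dw = d_bounds[OF i w]
    have "(\<integral>\<^sup>+w'. F (d i w, (e i w', hh i w')) \<partial>M) = (\<integral>\<^sup>+w'. \<integral>\<^sup>+x. F (d i w, (x, hh i w')) \<partial>kap i (hh i w') \<partial>M)"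
      using e_hh_kernel[OF i, of "\<lambda>z. F (d i w, z)"] by simp
    also have "\<dots> = (\<integral>\<^sup>+w'. ennreal ((1 - d i w) * \<alpha> w' + d i w * \<gamma> w') * \<phi> (hh i w') \<partial>M)"
    proof (rule nn_integral_cong_AE)
      show "AE w' in M. (\<integral>\<^sup>+x. F (d i w, (x, hh i w')) \<partial>kap i (hh i w')) = ennreal ((1 - d i w) * \<alpha> w' + d i w * \<gamma> w') * \<phi> (hh i w')"
        using hh_unit[OF i] AE_space
      proof eventually_elim
        case (elim w')
        interpret US: uniform_sphere K "hh i w'" "kap i (hh i w')"
          by (rule kap(2)[OF i hh_carrier[OF i elim(2)] elim(1)])
        have "(\<integral>\<^sup>+x. F (d i w, (x, hh i w')) \<partial>kap i (hh i w'))
          = (\<integral>\<^sup>+x. ennreal ((cmod (of_real (sqrt (1 - d i w)) * cip K (($) (hh i w')) (a (hh i w')) + of_real (sqrt (d i w)) * cip K (($) x) (a (hh i w'))))\<^sup>2) \<partial>kap i (hh i w')) * \<phi> (hh i w')"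
          unfolding F_def by (simp add: nn_integral_multc)
        also have "\<dots> = ennreal ((1 - d i w) * \<alpha> w' + d i w * \<gamma> w') * \<phi> (hh i w')"
        proof -
          have "cmod (cip K (a (hh i w')) (($) (hh i w'))) = cmod (cip K (($) (hh i w')) (a (hh i w')))"
            by (metis cnj_cip complex_mod_cnj)
          thus ?thesis
            unfolding US.nn_integral_shift[OF elim(1)] using dw
            by (simp add: norm_mult power_mult_distrib \<gamma>_def \<alpha>_def)
        qed
        finally show ?case .
      qed
    qed
    finally show "(\<integral>\<^sup>+w'. F (d i w, (e i w', hh i w')) \<partial>M) = (\<integral>\<^sup>+w'. ennreal ((1 - d i w) * \<alpha> w' + d i w * \<gamma> w') * \<phi> (hh i w') \<partial>M)" .
  qed
  also have "\<dots> = (\<integral>\<^sup>+w'. \<integral>\<^sup>+w. ennreal ((1 - d i w) * \<alpha> w' + d i w * \<gamma> w') * \<phi> (hh i w') \<partial>M \<partial>M)"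
  proof -
    interpret MM: pair_sigma_finite M M ..
    show ?thesis by (rule MM.Fubini') measurable
  qed
  also have "ennreal (real K) * \<dots> = (\<integral>\<^sup>+w'. ennreal (real K) * (\<integral>\<^sup>+w. ennreal ((1 - d i w) * \<alpha> w' + d i w * \<gamma> w') * \<phi> (hh i w') \<partial>M) \<partial>M)"
    by (rule nn_integral_cmult[symmetric]) measurable
  also have "\<dots> = (\<integral>\<^sup>+w'. ennreal (real K * (1 - D) * \<alpha> w' + D * sqn K (a (hh i w'))) * \<phi> (hh i w') \<partial>M)"
  proof (rule nn_integral_cong_AE)
    show "AE w' in M. ennreal (real K) * (\<integral>\<^sup>+w. ennreal ((1 - d i w) * \<alpha> w' + d i w * \<gamma> w') * \<phi> (hh i w') \<partial>M)
       = ennreal (real K * (1 - D) * \<alpha> w' + D * sqn K (a (hh i w'))) * \<phi> (hh i w')"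
      using hh_unit[OF i]
    proof eventually_elim
      case (elim w')
      have int: "integrable M (\<lambda>w. (1 - d i w) * \<alpha> w' + d i w * \<gamma> w')" using integral_d(1)[OF i] by auto
      have "(\<integral>\<^sup>+w. ennreal ((1 - d i w) * \<alpha> w' + d i w * \<gamma> w') \<partial>M) = ennreal (\<integral>w. (1 - d i w) * \<alpha> w' + d i w * \<gamma> w' \<partial>M)"
        by (rule nn_integral_eq_integral[OF int]) (use d_bounds[OF i] \<alpha>0 \<gamma>0[OF elim] in auto)
      also have "(\<integral>w. (1 - d i w) * \<alpha> w' + d i w * \<gamma> w' \<partial>M) = (1 - D * real (K - 1) / real K) * \<alpha> w' + D * real (K - 1) / real K * \<gamma> w'"
        using integral_d[OF i] by (simp add: prob_space)
      finally have e1: "(\<integral>\<^sup>+w. ennreal ((1 - d i w) * \<alpha> w' + d i w * \<gamma> w') \<partial>M) = ennreal \<dots>" .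
      \<comment> \<open>Inserting E d = D (K - 1) / K, the factor K - 1 cancels the denominator of
        \<gamma>, and the coefficient of \<alpha> becomes K - D (K - 1) - D = K (1 - D).\<close>
      have e2: "real K * ((1 - D * real (K - 1) / real K) * \<alpha> w' + D * real (K - 1) / real K * \<gamma> w') = real K * (1 - D) * \<alpha> w' + D * sqn K (a (hh i w'))"
        using K2 by (simp add: \<gamma>_def of_nat_diff field_simps)
      have "ennreal (real K) * (\<integral>\<^sup>+w. ennreal ((1 - d i w) * \<alpha> w' + d i w * \<gamma> w') * \<phi> (hh i w') \<partial>M)
          = (ennreal (real K) * (\<integral>\<^sup>+w. ennreal ((1 - d i w) * \<alpha> w' + d i w * \<gamma> w') \<partial>M)) * \<phi> (hh i w')"
        by (subst nn_integral_multc) (auto simp: mult_ac)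
      also have "\<dots> = ennreal (real K * (1 - D) * \<alpha> w' + D * sqn K (a (hh i w'))) * \<phi> (hh i w')"
        unfolding e1 e2[symmetric] by (subst ennreal_mult') auto
      finally show ?case .
    qed
  qed
  finally show ?thesis unfolding \<alpha>_def .
qed

text \<open>With the other users frozen, a vector depending on the whole tuple depends on hh i
  alone, so the one-user identity applies inside the outer integral.\<close>

lemma hv_second_moment:
  assumes i: "i < K" and a [measurable]: "\<And>k. k < K \<Longrightarrow> (\<lambda>H. a H k) \<in> borel_measurable PH"
    and \<phi> [measurable]: "\<phi> \<in> borel_measurable PH"
  shows "(\<integral>\<^sup>+w. ennreal ((cmod (cip K (($) (h i w)) (a (Hv w))))\<^sup>2) * \<phi> (Hv w) \<partial>M)
    = (\<integral>\<^sup>+w. ennreal (real K * (1 - D) * (cmod (cip K (($) (hh i w)) (a (Hv w))))\<^sup>2 + D * sqn K (a (Hv w))) * \<phi> (Hv w) \<partial>M)"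
proof -
  let ?f = "\<lambda>z. ennreal ((cmod (cip K (($) (fst (fst z))) (a (snd z))))\<^sup>2) * \<phi> (snd z)"
  let ?g = "\<lambda>z. ennreal (real K * (1 - D) * (cmod (cip K (($) (snd (fst z))) (a (snd z))))\<^sup>2 + D * sqn K (a (snd z))) * \<phi> (snd z)"
  have f: "?f \<in> borel_measurable ((C \<Otimes>\<^sub>M C) \<Otimes>\<^sub>M PH)" by measurable
  have g: "?g \<in> borel_measurable ((C \<Otimes>\<^sub>M C) \<Otimes>\<^sub>M PH)" by measurable
  have "(\<integral>\<^sup>+w'. \<integral>\<^sup>+w. ?f ((h i w, hh i w), Hu i w' (hh i w)) \<partial>M \<partial>M) = (\<integral>\<^sup>+w'. \<integral>\<^sup>+w. ?g ((h i w, hh i w), Hu i w' (hh i w)) \<partial>M \<partial>M)"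
  proof (rule nn_integral_cong)
    fix w' assume w': "w' \<in> space M"
    have 1: "(\<lambda>u. a (Hu i w' u) k) \<in> borel_measurable C" if "k < K" for k
      by (rule measurable_compose[OF Hu_measurable[OF w'] a[OF that]])
    have 2: "(\<lambda>u. \<phi> (Hu i w' u)) \<in> borel_measurable C"
      by (rule measurable_compose[OF Hu_measurable[OF w'] \<phi>])
    show "(\<integral>\<^sup>+w. ?f ((h i w, hh i w), Hu i w' (hh i w)) \<partial>M) = (\<integral>\<^sup>+w. ?g ((h i w, hh i w), Hu i w' (hh i w)) \<partial>M)"
      using user_second_moment[OF i 1 2] by simp
  qed
  thus ?thesis using user_decouple[OF i f] user_decouple[OF i g] by simp
qed

text \<open>
  The hypothesis users_indep does not mention the error direction e, but d is almost surely
  positive, so e is almost surely a function of (h, hh).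
\<close>
lemma e_kernel:
  assumes i: "i < K" and f [measurable]: "f \<in> borel_measurable (C \<Otimes>\<^sub>M PH)"
  shows "(\<integral>\<^sup>+w. f (e i w, Hv w) \<partial>M) = (\<integral>\<^sup>+w. \<integral>\<^sup>+x. f (x, Hv w) \<partial>kap i (hh i w) \<partial>M)"
proof -
  note [measurable] = rv_h[OF i] rv_hh[OF i] rv_e[OF i] d_measurable[OF i] kap_measurable[OF i]
  define E where "E = (\<lambda>(x, u). vec K (\<lambda>k. (direction x $ k - of_real (sqrt (1 - sin2_angle (direction x) u)) * u $ k) / of_real (sqrt (sin2_angle (direction x) u))))"
  have s [measurable]: "(\<lambda>z. sin2_angle (direction (fst z)) (snd z)) \<in> borel_measurable (C \<Otimes>\<^sub>M C)"
  proof -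
    have "(\<lambda>z. (direction (fst z), snd z)) \<in> measurable (C \<Otimes>\<^sub>M C) (C \<Otimes>\<^sub>M C)" by measurable
    from measurable_compose[OF this measurable_sin2_angle] show ?thesis by simp
  qed
  have E [measurable]: "E \<in> measurable (C \<Otimes>\<^sub>M C) C"
  proof (rule measurable_cvec_spaceI)
    show "E x \<in> carrier_vec K" for x by (simp add: E_def split: prod.split)
    fix k assume k: "k < K"
    have "(\<lambda>z. (direction (fst z) $ k - of_real (sqrt (1 - sin2_angle (direction (fst z)) (snd z))) * snd z $ k) / of_real (sqrt (sin2_angle (direction (fst z)) (snd z)))) \<in> borel_measurable (C \<Otimes>\<^sub>M C)"
      using k by measurable
    thus "(\<lambda>z. E z $ k) \<in> borel_measurable (C \<Otimes>\<^sub>M C)" using k by (simp add: E_def case_prod_beta)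
  qed
  have Ee: "AE w in M. E (h i w, hh i w) = e i w"
    using decomposition_coord[OF i] d_pos[OF i] AE_space
  proof eventually_elim
    case (elim w)
    show ?case
    proof (rule eq_vecI)
      show "dim_vec (E (h i w, hh i w)) = dim_vec (e i w)" using e_carrier[OF i elim(3)] by (simp add: E_def)
      fix k assume "k < dim_vec (e i w)"
      hence k: "k < K" using e_carrier[OF i elim(3)] by simp
      thus "E (h i w, hh i w) $ k = e i w $ k"
        using elim(1,2) by (simp add: E_def d_def[symmetric])
    qed
  qed
  let ?f = "\<lambda>z. f (E (fst z), snd z)"
  let ?g = "\<lambda>z. \<integral>\<^sup>+x. f (x, snd z) \<partial>kap i (snd (fst z))"
  have g: "?g \<in> borel_measurable ((C \<Otimes>\<^sub>M C) \<Otimes>\<^sub>M PH)"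
    by (rule nn_integral_measurable_subprob_algebra2[where N = C]) measurable
  have "(\<integral>\<^sup>+w. f (e i w, Hv w) \<partial>M) = (\<integral>\<^sup>+w. ?f ((h i w, hh i w), Hv w) \<partial>M)"
    by (rule nn_integral_cong_AE, use Ee in eventually_elim) simp
  also have "\<dots> = (\<integral>\<^sup>+w'. \<integral>\<^sup>+w. ?f ((h i w, hh i w), Hu i w' (hh i w)) \<partial>M \<partial>M)"
    by (rule user_decouple[OF i]) measurable
  also have "\<dots> = (\<integral>\<^sup>+w'. \<integral>\<^sup>+w. ?g ((h i w, hh i w), Hu i w' (hh i w)) \<partial>M \<partial>M)"
  proof (rule nn_integral_cong)
    fix w' assume w': "w' \<in> space M"
    note [measurable] = Hu_measurable[OF w']
    have "(\<integral>\<^sup>+w. ?f ((h i w, hh i w), Hu i w' (hh i w)) \<partial>M) = (\<integral>\<^sup>+w. f (e i w, Hu i w' (hh i w)) \<partial>M)"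
      by (rule nn_integral_cong_AE, use Ee in eventually_elim) simp
    also have "\<dots> = (\<integral>\<^sup>+w. \<integral>\<^sup>+x. f (x, Hu i w' (hh i w)) \<partial>kap i (hh i w) \<partial>M)"
      using e_hh_kernel[OF i, of "\<lambda>(x, u). f (x, Hu i w' u)"] by simp
    finally show "(\<integral>\<^sup>+w. ?f ((h i w, hh i w), Hu i w' (hh i w)) \<partial>M) = (\<integral>\<^sup>+w. ?g ((h i w, hh i w), Hu i w' (hh i w)) \<partial>M)" by simp
  qed
  also have "\<dots> = (\<integral>\<^sup>+w. ?g ((h i w, hh i w), Hv w) \<partial>M)"
    by (rule user_decouple[OF i g, symmetric])
  finally show ?thesis by simp
qed

end

subsection \<open>Gram-Schmidt orthonormalization\<close>

text \<open>
  On linearly dependent input some of these vectors are 0 (division by 0); the identities below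
  hold regardless.
\<close>
fun onb :: "nat \<Rightarrow> (nat \<Rightarrow> nat \<Rightarrow> complex) \<Rightarrow> nat \<Rightarrow> nat \<Rightarrow> complex" where
  "onb n H j = (let g = (\<lambda>k. H j k - (\<Sum>l<j. cip n (H j) (onb n H l) * onb n H l k))
     in (\<lambda>k. of_real (1 / sqrt (sqn n g)) * g k))"

declare onb.simps [simp del]

text \<open>The residual before normalization, which is what the library's
  \<open>gram_schmidt\<close> computes.\<close>

definition gsv :: "nat \<Rightarrow> (nat \<Rightarrow> nat \<Rightarrow> complex) \<Rightarrow> nat \<Rightarrow> nat \<Rightarrow> complex" where
  "gsv n H j = (\<lambda>k. H j k - (\<Sum>l<j. cip n (H j) (onb n H l) * onb n H l k))"

lemma onb_eq: "onb n H j = (\<lambda>k. of_real (1 / sqrt (sqn n (gsv n H j))) * gsv n H j k)"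
  by (subst onb.simps) (simp add: gsv_def Let_def)

text \<open>Causality of Gram-Schmidt. It makes the beam vectors before index i independent of hh i,
  and it permits placing an arbitrary vector in a later slot, as in
  \<open>exists_orthogonal_onb\<close> and \<open>Bessel_onb\<close>.\<close>

lemma onb_cong:
  assumes "\<And>l. l \<le> j \<Longrightarrow> H l = H' l"
  shows "onb n H j = onb n H' j"
  using assms
proof (induction j rule: less_induct)
  case (less j)
  have "onb n H l = onb n H' l" if "l < j" for l using less that by auto
  hence "(\<Sum>l<j. cip n (H' j) (onb n H l) * onb n H l k) = (\<Sum>l<j. cip n (H' j) (onb n H' l) * onb n H' l k)" for k
    by (intro sum.cong) auto
  thus ?case using less.prems[of j] by (simp add: onb.simps[of n _ j])
qed

lemma gsv_cong:
  assumes "\<And>l. l \<le> j \<Longrightarrow> H l = H' l"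
  shows "gsv n H j = gsv n H' j"
proof -
  have "onb n H l = onb n H' l" if "l < j" for l using assms that by (intro onb_cong) auto
  hence "(\<Sum>l<j. cip n (H' j) (onb n H l) * onb n H l k) = (\<Sum>l<j. cip n (H' j) (onb n H' l) * onb n H' l k)" for k
    by (intro sum.cong) auto
  thus ?thesis using assms[of j] by (simp add: gsv_def)
qed

lemma measurable_gsv_onb:
  assumes "\<And>l k. l \<le> j \<Longrightarrow> k < n \<Longrightarrow> (\<lambda>x. H x l k) \<in> borel_measurable N"
  shows "\<forall>k<n. (\<lambda>x. gsv n (H x) j k) \<in> borel_measurable N \<and> (\<lambda>x. onb n (H x) j k) \<in> borel_measurable N"
  using assms
proof (induction j rule: less_induct)
  case (less j)
  have [measurable]: "(\<lambda>x. onb n (H x) l k) \<in> borel_measurable N" if "l < j" "k < n" for l k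
    using less.IH[OF that(1)] less.prems that by auto
  have [measurable]: "(\<lambda>x. H x j k) \<in> borel_measurable N" if "k < n" for k using less.prems that by auto
  have g [measurable]: "(\<lambda>x. gsv n (H x) j k) \<in> borel_measurable N" if "k < n" for k
  proof -
    have "(\<lambda>x. \<Sum>l<j. cip n (H x j) (onb n (H x) l) * onb n (H x) l k) \<in> borel_measurable N"
      by (rule borel_measurable_sum) (use that in measurable)
    thus ?thesis unfolding gsv_def using that by measurable
  qed
  have "(\<lambda>x. onb n (H x) j k) \<in> borel_measurable N" if "k < n" for k
    unfolding onb_eq using that by measurable
  thus ?case using g by blast
qed

lemma sqn_onb: "sqn n (onb n H j) = (if sqn n (gsv n H j) = 0 then 0 else 1)"
proof -
  have "sqn n (onb n H j) = (1 / sqrt (sqn n (gsv n H j)))\<^sup>2 * sqn n (gsv n H j)"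
    unfolding onb_eq sqn_scale by (simp add: norm_divide power_divide sqn_nonneg)
  thus ?thesis using sqn_nonneg[of n "gsv n H j"] by (auto simp: power_divide)
qed

lemma cip_sqn_0: "sqn n g = 0 \<Longrightarrow> cip n f g = 0" "sqn n g = 0 \<Longrightarrow> cip n g f = 0"
  by (simp_all add: cip_def sqn_zero_iff)

lemma cip_gsv_onb_aux:
  assumes "\<And>m m'. m < j \<Longrightarrow> m' < j \<Longrightarrow> m \<noteq> m' \<Longrightarrow> cip n (onb n H m) (onb n H m') = 0" "l < j"
  shows "cip n (gsv n H j) (onb n H l) = 0"
proof -
  have "cip n (gsv n H j) (onb n H l) = cip n (H j) (onb n H l) - (\<Sum>m<j. cip n (H j) (onb n H m) * cip n (onb n H m) (onb n H l))"
    by (simp add: gsv_def cip_linear)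
  also have "(\<Sum>m<j. cip n (H j) (onb n H m) * cip n (onb n H m) (onb n H l))
     = (\<Sum>m<j. if m = l then cip n (H j) (onb n H l) * of_real (sqn n (onb n H l)) else 0)"
    using assms by (intro sum.cong) (auto simp: cip_self)
  also have "\<dots> = cip n (H j) (onb n H l) * of_real (sqn n (onb n H l))" using assms(2) by simp
  \<comment> \<open>If the l-th vector degenerated to 0, the form with it is 0 as well, so the
    missing factor 1 is harmless.\<close>
  also have "\<dots> = cip n (H j) (onb n H l)"
    by (cases "sqn n (onb n H l) = 0") (auto simp: cip_sqn_0 sqn_onb)
  finally show ?thesis by simp
qed

lemma onb_orth: "l \<noteq> m \<Longrightarrow> cip n (onb n H l) (onb n H m) = 0"
proof -
  have "\<forall>l\<le>N. \<forall>m\<le>N. l \<noteq> m \<longrightarrow> cip n (onb n H l) (onb n H m) = 0" for N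
  proof (induction N)
    case (Suc N)
    have a: "cip n (onb n H (Suc N)) (onb n H m) = 0" if "m \<le> N" for m
    proof -
      have "cip n (gsv n H (Suc N)) (onb n H m) = 0"
        by (rule cip_gsv_onb_aux) (use Suc that in auto)
      thus ?thesis unfolding onb_eq[of n H "Suc N"] cip_scale_left by simp
    qed
    have b: "cip n (onb n H m) (onb n H (Suc N)) = 0" if "m \<le> N" for m
      using a[OF that] cnj_cip[of n "onb n H (Suc N)" "onb n H m"] by simp
    show ?case using Suc a b by (auto simp: le_Suc_eq)
  qed simp
  thus "l \<noteq> m \<Longrightarrow> cip n (onb n H l) (onb n H m) = 0" by (meson max.cobounded1 max.cobounded2)
qed

lemma cip_gsv_onb: "l < j \<Longrightarrow> cip n (gsv n H j) (onb n H l) = 0"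
  by (rule cip_gsv_onb_aux) (auto simp: onb_orth)

lemma gsv_eq_onb: "k < n \<Longrightarrow> gsv n H j k = of_real (sqrt (sqn n (gsv n H j))) * onb n H j k"
  by (cases "sqn n (gsv n H j) = 0") (auto simp: onb_eq sqn_zero_iff)

lemma sqn_gsv: "sqn n (gsv n H j) = sqn n (H j) - (\<Sum>l<j. (cmod (cip n (H j) (onb n H l)))\<^sup>2)"
proof -
  have "cip n (gsv n H j) (gsv n H j) = cip n (gsv n H j) (H j) - (\<Sum>l<j. cnj (cip n (H j) (onb n H l)) * cip n (gsv n H j) (onb n H l))"
    by (subst (2) gsv_def) (simp add: cip_linear)
  also have "\<dots> = cip n (gsv n H j) (H j)" by (simp add: cip_gsv_onb)
  also have "\<dots> = cip n (H j) (H j) - (\<Sum>l<j. cip n (H j) (onb n H l) * cnj (cip n (H j) (onb n H l)))"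
    unfolding gsv_def by (simp add: cip_linear cnj_cip)
  also have "\<dots> = of_real (sqn n (H j) - (\<Sum>l<j. (cmod (cip n (H j) (onb n H l)))\<^sup>2))"
    by (simp add: cip_self complex_norm_square del: of_real_power)
  finally show ?thesis unfolding cip_self of_real_eq_iff .
qed

text \<open>The QR factorization: H j is a combination of the vectors up to index j, and the
  diagonal entry of the triangular factor is real and nonnegative. The first part is the
  zero-forcing property.\<close>

lemma cip_H_onb:
  shows "j < m \<Longrightarrow> cip n (H j) (onb n H m) = 0"
    and "cip n (H j) (onb n H j) = of_real (sqrt (sqn n (gsv n H j)))"
proof -
  have H: "cip n (H j) y = of_real (sqrt (sqn n (gsv n H j))) * cip n (onb n H j) y + (\<Sum>l<j. cip n (H j) (onb n H l) * cip n (onb n H l) y)" for y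
  proof -
    have "cip n (H j) y = cip n (\<lambda>k. of_real (sqrt (sqn n (gsv n H j))) * onb n H j k + (\<Sum>l<j. cip n (H j) (onb n H l) * onb n H l k)) y"
    proof (rule cip_cong)
      fix k assume "k < n"
      have "H j k = gsv n H j k + (\<Sum>l<j. cip n (H j) (onb n H l) * onb n H l k)" by (simp add: gsv_def)
      thus "H j k = of_real (sqrt (sqn n (gsv n H j))) * onb n H j k + (\<Sum>l<j. cip n (H j) (onb n H l) * onb n H l k)"
        unfolding gsv_eq_onb[OF \<open>k < n\<close>, of H j] .
    qed simp
    thus ?thesis by (simp add: cip_linear)
  qed
  show "j < m \<Longrightarrow> cip n (H j) (onb n H m) = 0" by (subst H) (simp add: onb_orth)
  show "cip n (H j) (onb n H j) = of_real (sqrt (sqn n (gsv n H j)))"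
    by (subst H) (auto simp: onb_orth cip_self sqn_onb)
qed

text \<open>Parseval for a vector in the span: coefficients beyond j vanish, and the diagonal one
  supplies the squared norm of the residual.\<close>

lemma sum_cip_onb:
  assumes "j < m"
  shows "(\<Sum>l<m. (cmod (cip n (H j) (onb n H l)))\<^sup>2) = sqn n (H j)"
proof -
  have "(\<Sum>l<m. (cmod (cip n (H j) (onb n H l)))\<^sup>2) = (\<Sum>l<Suc j. (cmod (cip n (H j) (onb n H l)))\<^sup>2)"
    by (rule sum.mono_neutral_right) (use assms in \<open>auto simp: cip_H_onb\<close>)
  thus ?thesis by (simp add: cip_H_onb(2) sqn_gsv[of n H j, symmetric] sqn_nonneg) (simp add: sqn_gsv)
qed

text \<open>Dimension count by traces: the residuals of the n standard basis vectors have total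
  squared norm at least n - j > 0, so one of them is nonzero and serves as y.\<close>

lemma exists_orthogonal_onb:
  assumes "j < n"
  shows "\<exists>y. sqn n y > 0 \<and> (\<forall>l<j. cip n (onb n H l) y = 0)"
proof -
  define \<epsilon> where "\<epsilon> i = (\<lambda>k::nat. if k = i then 1 else (0::complex))" for i
  define G where "G i = gsv n (H(j := \<epsilon> i)) j" for i
  have o: "onb n (H(j := \<epsilon> i)) l = onb n H l" if "l < j" for l i using that by (intro onb_cong) auto
  have ex: "cip n (\<epsilon> i) y = cnj (y i)" if "i < n" for i y
    using that by (simp add: cip_def \<epsilon>_def if_distrib[of "\<lambda>x. x * _"] cong: if_cong)
  have sG: "sqn n (G i) = 1 - (\<Sum>l<j. (cmod (onb n H l i))\<^sup>2)" if "i < n" for i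
  proof -
    have "sqn n (\<epsilon> i) = 1" using ex[OF that, of "\<epsilon> i"] by (simp add: sqn_eq_Re_cip) (simp add: \<epsilon>_def)
    thus ?thesis unfolding G_def sqn_gsv using that by (simp add: o ex)
  qed
  have "(\<Sum>i<n. sqn n (G i)) = real n - (\<Sum>l<j. sqn n (onb n H l))"
  proof -
    have "(\<Sum>i<n. sqn n (G i)) = (\<Sum>i<n. 1 - (\<Sum>l<j. (cmod (onb n H l i))\<^sup>2))"
      by (rule sum.cong) (auto simp: sG)
    also have "\<dots> = real n - (\<Sum>i<n. \<Sum>l<j. (cmod (onb n H l i))\<^sup>2)" by (simp add: sum_subtractf)
    also have "(\<Sum>i<n. \<Sum>l<j. (cmod (onb n H l i))\<^sup>2) = (\<Sum>l<j. sqn n (onb n H l))"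
      unfolding sqn_def by (rule sum.swap)
    finally show ?thesis .
  qed
  moreover have "(\<Sum>l<j. sqn n (onb n H l)) \<le> (\<Sum>l<j. 1)" by (rule sum_mono) (simp add: sqn_onb)
  ultimately have "(\<Sum>i<n. sqn n (G i)) > 0" using assms by simp
  then obtain i where i: "sqn n (G i) > 0"
    by (metis not_le sum_nonpos)
  have "cip n (onb n H l) (G i) = 0" if "l < j" for l
    using cip_gsv_onb[of l j n "H(j := \<epsilon> i)"] that cnj_cip[of n "G i" "onb n H l"] by (simp add: G_def o)
  thus ?thesis using i by blast
qed

section \<open>Agreement with the library's Gram-Schmidt process\<close>

lemma adjuster_carrier_vec: "set us \<subseteq> carrier_vec n \<Longrightarrow> adjuster n w us \<in> carrier_vec n"
  by (induction us) auto

lemma adjuster_coord: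
  assumes "set us \<subseteq> carrier_vec n" "k < n"
  shows "adjuster n w us $ k = (\<Sum>u\<leftarrow>us. - (w \<bullet>c u) / (u \<bullet>c u) * u $ k)"
  using assms
proof (induction us)
  case (Cons u us)
  thus ?case using adjuster_carrier_vec[of us n w] by auto
qed simp

lemma gram_schmidt_sub2_length: "length (gram_schmidt_sub2 n us ws) = length ws"
  by (induction ws arbitrary: us) (auto simp: Let_def)

text \<open>Each output is described through the list of outputs itself, which turns the recursion
  with accumulator into a strong induction on the index.\<close>

lemma gram_schmidt_sub2_nth:
  "j < length ws \<Longrightarrow> gram_schmidt_sub2 n us ws ! j
     = adjuster n (ws ! j) (rev (take j (gram_schmidt_sub2 n us ws)) @ us) + ws ! j"
proof (induction ws arbitrary: us j)
  case (Cons w ws)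
  show ?case
  proof (cases j)
    case (Suc m)
    thus ?thesis using Cons.IH[of m "(adjuster n w us + w) # us"] Cons.prems by (simp add: Let_def)
  qed (simp add: Let_def)
qed simp

text \<open>Dividing by the squared norm of an earlier residual amounts to normalizing it twice, as
  \<open>onb\<close> does. If that residual is 0, both corrections are 0 by division by 0, so the
  agreement extends to dependent input.\<close>

lemma gram_schmidt_nth:
  assumes "set ws \<subseteq> carrier_vec n" "j < length ws"
  shows "gram_schmidt n ws ! j \<in> carrier_vec n \<and> (\<forall>k<n. gram_schmidt n ws ! j $ k = gsv n (\<lambda>i. ($) (ws ! i)) j k)"
  using assms(2)
proof (induction j rule: less_induct)
  case (less j)
  let ?gs = "gram_schmidt n ws" and ?H = "\<lambda>i. ($) (ws ! i)"
  have gs: "?gs = gram_schmidt_sub2 n [] ws" by (rule gram_schmidt_code)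
  have len: "length ?gs = length ws" by (simp add: gs gram_schmidt_sub2_length)
  have rec: "?gs ! j = adjuster n (ws ! j) (rev (take j ?gs)) + ws ! j"
    using gram_schmidt_sub2_nth[OF less.prems, of n "[]"] by (simp add: gs)
  have w: "ws ! j \<in> carrier_vec n" using assms less.prems by auto
  have IH: "?gs ! l \<in> carrier_vec n" "\<And>k. k < n \<Longrightarrow> ?gs ! l $ k = gsv n ?H l k" if "l < j" for l
    using less that by auto
  have set: "set (rev (take j ?gs)) \<subseteq> carrier_vec n"
    using IH len less.prems by (auto simp: in_set_conv_nth)
  have tm: "- (ws ! j \<bullet>c ?gs ! l) / (?gs ! l \<bullet>c ?gs ! l) * ?gs ! l $ k = - (cip n (?H j) (onb n ?H l) * onb n ?H l k)"
    if l: "l < j" and k: "k < n" for l k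
  proof -
    let ?g = "gsv n ?H l"
    have 1: "ws ! j \<bullet>c ?gs ! l = cip n (?H j) ?g"
      using IH[OF l] w by (subst scalar_prod_eq_cip[of _ n]) (auto intro: cip_cong)
    have "?gs ! l \<bullet>c ?gs ! l = cip n ?g ?g"
      using IH[OF l] by (subst scalar_prod_eq_cip[of _ n]) (auto intro: cip_cong)
    hence 2: "?gs ! l \<bullet>c ?gs ! l = of_real (sqn n ?g)" by (simp add: cip_self)
    have "cip n (?H j) (onb n ?H l) * onb n ?H l k = of_real (1 / sqrt (sqn n ?g) * (1 / sqrt (sqn n ?g))) * (cip n (?H j) ?g * ?g k)"
      unfolding onb_eq cip_scale_right of_real_mult by simp
    also have "1 / sqrt (sqn n ?g) * (1 / sqrt (sqn n ?g)) = 1 / sqn n ?g"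
      using sqn_nonneg[of n ?g] by (simp add: real_sqrt_mult[symmetric])
    finally show ?thesis unfolding 1 2 IH(2)[OF l k] by simp
  qed
  show ?case
  proof (intro conjI allI impI)
    show "?gs ! j \<in> carrier_vec n"
      unfolding rec using adjuster_carrier_vec[OF set] w by simp
    fix k assume k: "k < n"
    have "(\<Sum>u\<leftarrow>rev (take j ?gs). - (ws ! j \<bullet>c u) / (u \<bullet>c u) * u $ k) = (\<Sum>u\<leftarrow>take j ?gs. - (ws ! j \<bullet>c u) / (u \<bullet>c u) * u $ k)"
      by (simp add: rev_map[symmetric] sum_list_rev)
    also have "\<dots> = (\<Sum>l<j. - (ws ! j \<bullet>c ?gs ! l) / (?gs ! l \<bullet>c ?gs ! l) * ?gs ! l $ k)"
      using less.prems len by (subst sum_list_sum_nth) (simp add: atLeast0LessThan)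
    also have "\<dots> = - (\<Sum>l<j. cip n (?H j) (onb n ?H l) * onb n ?H l k)"
      unfolding sum_negf[symmetric] by (rule sum.cong) (use tm k in auto)
    finally show "?gs ! j $ k = gsv n ?H j k"
      using adjuster_coord[OF set k, of "ws ! j"] w k by (simp add: rec gsv_def)
  qed
qed

lemma (in zf_dpc) omega_coord:
  assumes "\<And>i. i < K \<Longrightarrow> hh i w \<in> carrier_vec K" and j: "j < K"
  shows "omega j w \<in> carrier_vec K" "\<And>k. k < K \<Longrightarrow> omega j w $ k = onb K (\<lambda>i. ($) (hh i w)) j k"
proof -
  let ?ws = "map (\<lambda>i. hh i w) [0..<K]"
  have g: "gram_schmidt K ?ws ! j \<in> carrier_vec K"
     "\<And>k. k < K \<Longrightarrow> gram_schmidt K ?ws ! j $ k = gsv K (\<lambda>i. ($) (?ws ! i)) j k"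
  proof -
    have "set ?ws \<subseteq> carrier_vec K" using assms(1) by auto
    thus "gram_schmidt K ?ws ! j \<in> carrier_vec K"
     "\<And>k. k < K \<Longrightarrow> gram_schmidt K ?ws ! j $ k = gsv K (\<lambda>i. ($) (?ws ! i)) j k"
      using gram_schmidt_nth[of ?ws K j] j by auto
  qed
  have e: "gsv K (\<lambda>i. ($) (?ws ! i)) j = gsv K (\<lambda>i. ($) (hh i w)) j"
    using j by (intro gsv_cong) auto
  show "omega j w \<in> carrier_vec K" unfolding omega_def by (rule direction_carrier[OF g(1)])
  fix k assume k: "k < K"
  have "cvec_norm (gram_schmidt K ?ws ! j) = sqrt (sqn K (gsv K (\<lambda>i. ($) (hh i w)) j))"
  proof -
    have "sqn K (($) (gram_schmidt K ?ws ! j)) = sqn K (gsv K (\<lambda>i. ($) (hh i w)) j)"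
      by (rule sqn_cong) (use g e in auto)
    thus ?thesis using g(1) by (auto simp: cvec_norm_eq_sqn)
  qed
  thus "omega j w $ k = onb K (\<lambda>i. ($) (hh i w)) j k"
    unfolding omega_def direction_coord[OF g(1) k] onb_eq by (simp add: g(2)[OF k] e)
qed

lemma (in uniform_sphere) nn_frame_variance:
  assumes l: "l \<le> n" and orth: "\<And>j k. j < l \<Longrightarrow> k < l \<Longrightarrow> cip n (o' j) (o' k) = (if j = k then 1 else 0)"
    and th: "(\<Sum>j<l. (cmod (cip n (o' j) (($) u)))\<^sup>2) = \<theta>" "sqn n (($) u) = \<theta>" "\<theta> = 0 \<or> \<theta> = 1"
  shows "(\<integral>\<^sup>+x. ennreal (((\<Sum>j<l. (cmod (cip n (($) x) (o' j)))\<^sup>2) - (real l - \<theta>) / (real n - \<theta>))\<^sup>2) \<partial>\<mu>) \<le> ennreal (1 / (real n - \<theta>))"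
proof -
  let ?T = "\<lambda>x. (\<Sum>j<l. (cmod (cip n (($) x) (o' j)))\<^sup>2)" and ?c = "(real l - \<theta>) / (real n - \<theta>)"
  have i1: "integrable \<mu> ?T" by (simp add: integrable_cip2)
  have i2: "integrable \<mu> (\<lambda>x. (?T x)\<^sup>2)"
    by (simp add: power2_eq_square[of "sum _ _"] sum_product integrable_cip22)
  have "integrable \<mu> (\<lambda>x. (?T x)\<^sup>2 - 2 * ?c * ?T x + ?c\<^sup>2)" using i1 i2 by auto
  also have "(\<lambda>x. (?T x)\<^sup>2 - 2 * ?c * ?T x + ?c\<^sup>2) = (\<lambda>x. (?T x - ?c)\<^sup>2)"
    by (simp add: power2_diff algebra_simps)
  finally have i: "integrable \<mu> (\<lambda>x. (?T x - ?c)\<^sup>2)" .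
  have "(\<integral>\<^sup>+x. ennreal ((?T x - ?c)\<^sup>2) \<partial>\<mu>) = ennreal (\<integral>x. (?T x - ?c)\<^sup>2 \<partial>\<mu>)"
    by (rule nn_integral_eq_integral[OF i]) simp
  also have "\<dots> \<le> ennreal (1 / (real n - \<theta>))"
    by (rule ennreal_leI, rule frame_variance[OF l orth th])
  finally show ?thesis .
qed

subsection \<open>Concentration and conditional expectations\<close>

context qub_setup
begin

abbreviation om :: "'w \<Rightarrow> nat \<Rightarrow> nat \<Rightarrow> complex" where
  "om w j \<equiv> onb K (\<lambda>l. ($) (hh l w)) j"

text \<open>The same vectors as functions of the tuple, the form in which decoupling and
  measurability with respect to the quantized directions are expressed.\<close>

abbreviation omH :: "(nat \<Rightarrow> cvec) \<Rightarrow> nat \<Rightarrow> nat \<Rightarrow> complex" where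
  "omH H j \<equiv> onb K (\<lambda>l. ($) (H l)) j"

lemma omH_Hv: "j < K \<Longrightarrow> omH (Hv w) j = om w j"
  by (intro onb_cong) (simp add: Hv_def)

lemma omH_Hu: "j < i \<Longrightarrow> i < K \<Longrightarrow> omH (Hu i w u) j = om w j"
  by (intro onb_cong) (simp add: Hu_def)

lemma PH_coord [measurable]: "l < K \<Longrightarrow> k < K \<Longrightarrow> (\<lambda>H. H l $ k) \<in> borel_measurable PH"
  by (rule measurable_compose[where f = "\<lambda>H. H l" and N = C]) auto

lemma omH_measurable [measurable]: "j < K \<Longrightarrow> k < K \<Longrightarrow> (\<lambda>H. omH H j k) \<in> borel_measurable PH"
  using measurable_gsv_onb[of j K "\<lambda>H l. ($) (H l)" PH] by auto

lemma gsvH_measurable [measurable]: "j < K \<Longrightarrow> k < K \<Longrightarrow> (\<lambda>H. gsv K (\<lambda>l. ($) (H l)) j k) \<in> borel_measurable PH"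
  using measurable_gsv_onb[of j K "\<lambda>H l. ($) (H l)" PH] by auto

lemma om_measurable [measurable]: "j < K \<Longrightarrow> k < K \<Longrightarrow> (\<lambda>w. om w j k) \<in> borel_measurable M"
  using measurable_gsv_onb[of j K "\<lambda>w l. ($) (hh l w)" M] by auto

lemma AE_finite_lessThan: "(\<And>j. j < (n::nat) \<Longrightarrow> AE w in M. Q j w) \<Longrightarrow> AE w in M. \<forall>j<n. Q j w"
proof -
  assume "\<And>j. j < n \<Longrightarrow> AE w in M. Q j w"
  hence "AE w in M. \<forall>j\<in>{..<n}. Q j w" by (intro AE_finite_allI) auto
  thus ?thesis by eventually_elim auto
qed

text \<open>Freeze the other users and choose y orthogonal to the earlier beam vectors. The residual
  then has the same form with y as hh j, and by \<open>AE_cip_neq_0\<close> that form is almost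
  surely nonzero.\<close>

lemma gsv_nonzero: "AE w in M. \<forall>j<K. sqn K (gsv K (\<lambda>l. ($) (hh l w)) j) \<noteq> 0"
proof (rule AE_finite_lessThan)
  fix j assume j: "j < K"
  note [measurable] = rv_hh[OF j] gsvH_measurable[OF j]
  let ?f = "\<lambda>z. indicator {0} (sqn K (gsv K (\<lambda>l. ($) (snd z l)) j)) :: ennreal"
  have f: "?f \<in> borel_measurable ((C \<Otimes>\<^sub>M C) \<Otimes>\<^sub>M PH)"
    by (rule measurable_compose[OF measurable_snd]) measurable
  have "(\<integral>\<^sup>+w. ?f ((h j w, hh j w), Hv w) \<partial>M) = (\<integral>\<^sup>+w'. \<integral>\<^sup>+w. ?f ((h j w, hh j w), Hu j w' (hh j w)) \<partial>M \<partial>M)"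
    by (rule user_decouple[OF j f])
  also have "\<dots> = (\<integral>\<^sup>+w'. 0 \<partial>M)"
  proof (rule nn_integral_cong)
    fix w' assume w': "w' \<in> space M"
    interpret U: uniform_sphere K "0\<^sub>v K" "distr M C (hh j)" by (rule hh_uniform_sphere[OF j])
    obtain y where y: "sqn K y > 0" "\<And>l. l < j \<Longrightarrow> cip K (om w' l) y = 0"
      using exists_orthogonal_onb[OF j] by blast
    have "AE x in distr M C (hh j). cip K (($) x) y \<noteq> 0"
      by (rule U.AE_cip_neq_0) (use y in \<open>simp_all add: sqn_def\<close>)
    hence ae: "AE w in M. cip K (($) (hh j w)) y \<noteq> 0" by (rule AE_distrD[OF rv_hh[OF j]])
    have "(\<integral>\<^sup>+w. ?f ((h j w, hh j w), Hu j w' (hh j w)) \<partial>M) = (\<integral>\<^sup>+w. 0 \<partial>M)"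
    proof (rule nn_integral_cong_AE, use ae in eventually_elim)
      case (elim w)
      let ?H = "\<lambda>l. ($) (Hu j w' (hh j w) l)"
      have Hj: "?H j = ($) (hh j w)" using j by (simp add: Hu_def)
      have "cip K (gsv K ?H j) y = cip K (?H j) y - (\<Sum>l<j. cip K (?H j) (onb K ?H l) * cip K (onb K ?H l) y)"
        by (simp add: gsv_def cip_linear)
      also have "\<dots> = cip K (($) (hh j w)) y" using omH_Hu[OF _ j] y(2) by (simp add: Hj)
      finally have "sqn K (gsv K ?H j) \<noteq> 0" using elim cip_sqn_0(2)[of K "gsv K ?H j" y] by auto
      thus ?case by simp
    qed
    thus "(\<integral>\<^sup>+w. ?f ((h j w, hh j w), Hu j w' (hh j w)) \<partial>M) = 0" by simp
  qed
  finally have "(\<integral>\<^sup>+w. ?f ((h j w, hh j w), Hv w) \<partial>M) = 0" by simp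
  moreover have "(\<lambda>w. ?f ((h j w, hh j w), Hv w)) \<in> borel_measurable M"
    by (rule measurable_compose[OF _ f]) (use j in measurable)
  ultimately have "AE w in M. ?f ((h j w, hh j w), Hv w) = 0" by (simp add: nn_integral_0_iff_AE)
  thus "AE w in M. sqn K (gsv K (\<lambda>l. ($) (hh l w)) j) \<noteq> 0"
  proof eventually_elim
    case (elim w)
    have "gsv K (\<lambda>l. ($) (Hv w l)) j = gsv K (\<lambda>l. ($) (hh l w)) j"
      using j by (intro gsv_cong) (simp add: Hv_def)
    thus ?case using elim by (auto simp: indicator_def split: if_splits)
  qed
qed

lemma om_orthonormal:
  "AE w in M. \<forall>j<K. \<forall>l<K. cip K (om w j) (om w l) = (if j = l then 1 else 0)"
  using gsv_nonzero
proof eventually_elim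
  case (elim w)
  thus ?case by (auto simp: onb_orth cip_self sqn_onb)
qed

text \<open>Resampling hh i leaves the beam vectors before index i unchanged, so they are a fixed
  orthonormal frame for a uniform vector of the whole space: the case \<theta> = 0 of the frame
  variance.\<close>

lemma hh_frame_variance:
  assumes i: "i < K"
  shows "(\<integral>\<^sup>+w. ennreal (((\<Sum>l<i. (cmod (cip K (($) (hh i w)) (om w l)))\<^sup>2) - real i / real K)\<^sup>2) \<partial>M) \<le> ennreal (1 / real K)"
proof -
  note [measurable] = rv_hh[OF i]
  define F where "F = (\<lambda>x o'. ennreal (((\<Sum>l<i. (cmod (cip K (($) x) (o' l)))\<^sup>2) - real i / real K)\<^sup>2))"
  let ?f = "\<lambda>z. F (snd (fst z)) (omH (snd z))"
  have m1: "(\<lambda>z. omH (snd z) l k) \<in> borel_measurable ((C \<Otimes>\<^sub>M C) \<Otimes>\<^sub>M PH)" if "l < i" "k < K" for l k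
    by (rule measurable_compose[OF measurable_snd omH_measurable]) (use that i in auto)
  have m2: "(\<lambda>z. snd (fst z) $ k) \<in> borel_measurable ((C \<Otimes>\<^sub>M C) \<Otimes>\<^sub>M PH)" if "k < K" for k
    using that by measurable
  have m3: "(\<lambda>z. cip K (($) (snd (fst z))) (omH (snd z) l)) \<in> borel_measurable ((C \<Otimes>\<^sub>M C) \<Otimes>\<^sub>M PH)" if "l < i" for l
    by (rule measurable_cip) (use m1 m2 that in auto)
  have m4: "(\<lambda>z. \<Sum>l<i. (cmod (cip K (($) (snd (fst z))) (omH (snd z) l)))\<^sup>2) \<in> borel_measurable ((C \<Otimes>\<^sub>M C) \<Otimes>\<^sub>M PH)"
    by (rule borel_measurable_sum) (use m3 in measurable)
  have f: "?f \<in> borel_measurable ((C \<Otimes>\<^sub>M C) \<Otimes>\<^sub>M PH)"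
    unfolding F_def using m4 by measurable
  have e1: "F x (omH (Hv w)) = F x (om w)" for w x
    unfolding F_def using omH_Hv i by simp
  have e2: "F x (omH (Hu i w' u)) = F x (om w')" for w' x u
    unfolding F_def using omH_Hu i by simp
  have "(\<integral>\<^sup>+w. F (hh i w) (om w) \<partial>M) = (\<integral>\<^sup>+w'. \<integral>\<^sup>+w. F (hh i w) (om w') \<partial>M \<partial>M)"
    using user_decouple[OF i f] by (simp add: e1 e2)
  also have "\<dots> \<le> (\<integral>\<^sup>+w'. ennreal (1 / real K) \<partial>M)"
  proof (rule nn_integral_mono_AE, use om_orthonormal in eventually_elim)
    case (elim w')
    interpret U: uniform_sphere K "0\<^sub>v K" "distr M C (hh i)" by (rule hh_uniform_sphere[OF i])
    have "(\<integral>\<^sup>+w. F (hh i w) (om w') \<partial>M) = (\<integral>\<^sup>+x. F x (om w') \<partial>distr M C (hh i))"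
      by (rule nn_integral_distr[symmetric]) (unfold F_def, measurable)
    also have "\<dots> \<le> ennreal (1 / real K)"
    proof -
      have z: "cip K y (($) (0\<^sub>v K)) = 0" for y by (simp add: cip_def)
      show ?thesis unfolding F_def using U.nn_frame_variance[of i "om w'" 0] elim i by (simp add: z sqn_def)
    qed
    finally show ?case .
  qed
  finally show ?thesis by (simp add: F_def emeasure_space_1)
qed

text \<open>Given all directions, e is uniform on the complement of hh i. Since i < s, hh i lies in
  the span of the first s beam vectors: the case \<theta> = 1.\<close>

lemma e_frame_variance:
  assumes i: "i < s" and s: "s \<le> K"
  shows "(\<integral>\<^sup>+w. ennreal (((\<Sum>l<s. (cmod (cip K (($) (e i w)) (om w l)))\<^sup>2) - (real s - 1) / (real K - 1))\<^sup>2) \<partial>M) \<le> ennreal (1 / (real K - 1))"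
proof -
  have iK: "i < K" using i s by simp
  define F where "F = (\<lambda>x o'. ennreal (((\<Sum>l<s. (cmod (cip K (($) x) (o' l)))\<^sup>2) - (real s - 1) / (real K - 1))\<^sup>2))"
  let ?f = "\<lambda>z. F (fst z) (omH (snd z))"
  have m1: "(\<lambda>z. omH (snd z) l k) \<in> borel_measurable (C \<Otimes>\<^sub>M PH)" if "l < s" "k < K" for l k
    by (rule measurable_compose[OF measurable_snd omH_measurable]) (use that s in auto)
  have m2: "(\<lambda>z. fst z $ k) \<in> borel_measurable (C \<Otimes>\<^sub>M PH)" if "k < K" for k
    using that by measurable
  have m3: "(\<lambda>z. cip K (($) (fst z)) (omH (snd z) l)) \<in> borel_measurable (C \<Otimes>\<^sub>M PH)" if "l < s" for l
    by (rule measurable_cip) (use m1 m2 that in auto)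
  have m4: "(\<lambda>z. \<Sum>l<s. (cmod (cip K (($) (fst z)) (omH (snd z) l)))\<^sup>2) \<in> borel_measurable (C \<Otimes>\<^sub>M PH)"
    by (rule borel_measurable_sum) (use m3 in measurable)
  have f: "?f \<in> borel_measurable (C \<Otimes>\<^sub>M PH)"
    unfolding F_def using m4 by measurable
  have e1: "F x (omH (Hv w)) = F x (om w)" for w x
    unfolding F_def using omH_Hv s by simp
  have "(\<integral>\<^sup>+w. F (e i w) (om w) \<partial>M) = (\<integral>\<^sup>+w. \<integral>\<^sup>+x. F x (om w) \<partial>kap i (hh i w) \<partial>M)"
    using e_kernel[OF iK f] by (simp add: e1)
  also have "\<dots> \<le> (\<integral>\<^sup>+w. ennreal (1 / (real K - 1)) \<partial>M)"
  proof (rule nn_integral_mono_AE, use om_orthonormal hh_unit[OF iK] AE_space in eventually_elim)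
    case (elim w)
    interpret U: uniform_sphere K "hh i w" "kap i (hh i w)"
      by (rule kap(2)[OF iK hh_carrier[OF iK elim(3)] elim(2)])
    have "(\<Sum>l<s. (cmod (cip K (om w l) (($) (hh i w))))\<^sup>2) = (\<Sum>l<s. (cmod (cip K (($) (hh i w)) (om w l)))\<^sup>2)"
      by (intro sum.cong refl) (metis cnj_cip complex_mod_cnj)
    also have "\<dots> = 1" using sum_cip_onb[OF i, of K "\<lambda>l. ($) (hh l w)"] elim(2) by simp
    finally show ?case unfolding F_def using U.nn_frame_variance[of s "om w" 1] elim s by simp
  qed
  finally show ?thesis by (simp add: F_def emeasure_space_1)
qed

lemma e_cip_bound:
  assumes i: "i < K" and X: "\<And>k. k < K \<Longrightarrow> (\<lambda>H. X H k) \<in> borel_measurable PH"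
    and B: "AE w in M. sqn K (X (Hv w)) \<le> B"
  shows "(\<integral>\<^sup>+w. ennreal ((cmod (cip K (($) (e i w)) (X (Hv w))))\<^sup>2) \<partial>M) \<le> ennreal (B / (real K - 1))"
proof -
  have f: "(\<lambda>z. ennreal ((cmod (cip K (($) (fst z)) (X (snd z))))\<^sup>2)) \<in> borel_measurable (C \<Otimes>\<^sub>M PH)"
  proof -
    have "(\<lambda>z. X (snd z) k) \<in> borel_measurable (C \<Otimes>\<^sub>M PH)" if "k < K" for k
      by (rule measurable_compose[OF measurable_snd X[OF that]])
    thus ?thesis by measurable
  qed
  have "(\<integral>\<^sup>+w. ennreal ((cmod (cip K (($) (e i w)) (X (Hv w))))\<^sup>2) \<partial>M)
     = (\<integral>\<^sup>+w. \<integral>\<^sup>+x. ennreal ((cmod (cip K (($) x) (X (Hv w))))\<^sup>2) \<partial>kap i (hh i w) \<partial>M)"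
    using e_kernel[OF i f] by simp
  also have "\<dots> \<le> (\<integral>\<^sup>+w. ennreal (B / (real K - 1)) \<partial>M)"
  proof (rule nn_integral_mono_AE, use B hh_unit[OF i] AE_space in eventually_elim)
    case (elim w)
    interpret U: uniform_sphere K "hh i w" "kap i (hh i w)"
      by (rule kap(2)[OF i hh_carrier[OF i elim(3)] elim(2)])
    have "(sqn K (X (Hv w)) - (cmod (cip K (X (Hv w)) (($) (hh i w))))\<^sup>2) / (real K - 1) \<le> B / (real K - 1)"
      using elim(1) K2 zero_le_power2[of "cmod (cip K (X (Hv w)) (($) (hh i w)))"] by (intro divide_right_mono) linarith+
    thus ?case using U.nn_integral_shift[OF elim(2), of 0 1 "X (Hv w)"] by (simp add: ennreal_leI)
  qed
  finally show ?thesis by (simp add: emeasure_space_1)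
qed

section \<open>Conditional second moments given all quantized directions\<close>

lemma sigma_hh_eq: "zf_dpc.sigma_hh M K hh = vimage_algebra (space M) Hv PH"
  by (simp add: zf_dpc.sigma_hh_def Hv_def[abs_def])

lemma subalg_sigma_hh: "subalgebra M (vimage_algebra (space M) Hv PH)"
  using Hv_measurable by (auto simp: subalgebra_def sets_vimage_algebra2 measurable_def)

sublocale F: finite_measure_subalgebra M "vimage_algebra (space M) Hv PH"
  by unfold_locales (rule subalg_sigma_hh)

lemma measurable_sigma_hh: "f \<in> borel_measurable PH \<Longrightarrow> (\<lambda>w. f (Hv w)) \<in> borel_measurable (vimage_algebra (space M) Hv PH)"
  by (rule measurable_compose[OF measurable_vimage_algebra1]) (use Hv_measurable in \<open>auto simp: measurable_def\<close>)

definition gain :: real where "gain = real K * (1 - D)"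

lemma gain_nonneg: "0 \<le> gain" using D_le_1 by (simp add: gain_def)

text \<open>Taking indicators of events for \<phi> in \<open>hv_second_moment\<close> gives the
  defining property of a conditional expectation; taking \<phi> = 1 gives integrability, because the
  right-hand side is bounded.\<close>

lemma cond_exp_cip_sq:
  assumes i: "i < K" and a: "\<And>k. k < K \<Longrightarrow> (\<lambda>H. a H k) \<in> borel_measurable PH"
    and B: "AE w in M. sqn K (a (Hv w)) \<le> B"
  shows "integrable M (\<lambda>w. (cmod (cip K (($) (h i w)) (a (Hv w))))\<^sup>2)"
    and "AE w in M. real_cond_exp M (vimage_algebra (space M) Hv PH) (\<lambda>w. (cmod (cip K (($) (h i w)) (a (Hv w))))\<^sup>2) w
      = gain * (cmod (cip K (($) (hh i w)) (a (Hv w))))\<^sup>2 + D * sqn K (a (Hv w))"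
proof -
  note [measurable] = rv_h[OF i] rv_hh[OF i] a
  have [measurable]: "(\<lambda>w. a (Hv w) k) \<in> borel_measurable M" if "k < K" for k
    by (rule measurable_compose[OF Hv_measurable a[OF that]])
  let ?f = "\<lambda>w. (cmod (cip K (($) (h i w)) (a (Hv w))))\<^sup>2"
  let ?g = "\<lambda>w. gain * (cmod (cip K (($) (hh i w)) (a (Hv w))))\<^sup>2 + D * sqn K (a (Hv w))"
  have g0: "0 \<le> ?g w" for w using gain_nonneg D_pos by (simp add: sqn_nonneg)
  have gi: "integrable M ?g"
  proof (rule integrable_const_bound[of _ "gain * B + D * B"])
    show "AE w in M. norm (?g w) \<le> gain * B + D * B"
      using B hh_unit[OF i]
    proof eventually_elim
      case (elim w)
      have "(cmod (cip K (($) (hh i w)) (a (Hv w))))\<^sup>2 \<le> B"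
        using cip_Cauchy_Schwarz[of K "($) (hh i w)" "a (Hv w)"] elim by simp
      thus ?case using g0[of w] elim gain_nonneg D_pos by (simp add: add_mono mult_left_mono)
    qed
  qed measurable
  have key: "(\<integral>\<^sup>+w. ennreal (?f w) * indicator B (Hv w) \<partial>M) = (\<integral>\<^sup>+w. ennreal (?g w) * indicator B (Hv w) \<partial>M)"
    if "B \<in> sets PH" for B
    unfolding gain_def by (rule hv_second_moment[OF i a]) (use that in auto)
  have "(\<integral>\<^sup>+w. ennreal (?f w) \<partial>M) = (\<integral>\<^sup>+w. ennreal (?g w) \<partial>M)"
    using hv_second_moment[where a = a, OF i a, of "\<lambda>_. 1"] by (simp add: gain_def)
  also have "\<dots> < \<infinity>" using gi g0 by (simp add: nn_integral_eq_integral)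
  finally show fi: "integrable M ?f" by (intro integrableI_nonneg) auto
  show "AE w in M. real_cond_exp M (vimage_algebra (space M) Hv PH) ?f w = ?g w"
  proof (rule F.real_cond_exp_charact[OF _ fi gi])
    fix A assume "A \<in> sets (vimage_algebra (space M) Hv PH)"
    then obtain B where B: "B \<in> sets PH" "A = Hv -` B \<inter> space M"
      using Hv_measurable by (subst (asm) sets_vimage_algebra2) (auto simp: measurable_def)
    have 1: "(\<integral>w\<in>A. q w \<partial>M) = enn2real (\<integral>\<^sup>+w. ennreal (q w) * indicator B (Hv w) \<partial>M)"
      if [measurable]: "q \<in> borel_measurable M" and q0: "\<And>w. 0 \<le> q w" for q
    proof -
      have "(\<integral>w\<in>A. q w \<partial>M) = (\<integral>w. indicator B (Hv w) * q w \<partial>M)"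
        unfolding set_lebesgue_integral_def by (rule Bochner_Integration.integral_cong) (auto simp: B indicator_def)
      also have "\<dots> = enn2real (\<integral>\<^sup>+w. ennreal (indicator B (Hv w) * q w) \<partial>M)"
        by (rule integral_eq_nn_integral) (use q0 B(1) in auto)
      also have "(\<integral>\<^sup>+w. ennreal (indicator B (Hv w) * q w) \<partial>M) = (\<integral>\<^sup>+w. ennreal (q w) * indicator B (Hv w) \<partial>M)"
        by (rule nn_integral_cong) (auto simp: indicator_def)
      finally show ?thesis .
    qed
    show "(\<integral>w\<in>A. ?f w \<partial>M) = (\<integral>w\<in>A. ?g w \<partial>M)"
      by (subst (1 2) 1) (use g0 key[OF B(1)] in auto)
  next
    have "(\<lambda>w. gain * (cmod (cip K (($) (Hv w i)) (a (Hv w))))\<^sup>2 + D * sqn K (a (Hv w))) \<in> borel_measurable (vimage_algebra (space M) Hv PH)"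
      by (rule measurable_sigma_hh[of "\<lambda>H. gain * (cmod (cip K (($) (H i)) (a H)))\<^sup>2 + D * sqn K (a H)"])
         (use i in measurable)
    thus "?g \<in> borel_measurable (vimage_algebra (space M) Hv PH)" using i by (simp add: Hv_def)
  qed
qed

text \<open>The real part follows by polarization from the squares for a + b and a - b. Replacing a
  by \<open>\<i> * a\<close> turns the imaginary part into a real part.\<close>

lemma cond_exp_cip_mult:
  assumes i: "i < K" and a: "\<And>k. k < K \<Longrightarrow> (\<lambda>H. a H k) \<in> borel_measurable PH"
    and b: "\<And>k. k < K \<Longrightarrow> (\<lambda>H. b H k) \<in> borel_measurable PH"
    and Ba: "AE w in M. sqn K (a (Hv w)) \<le> A" and Bb: "AE w in M. sqn K (b (Hv w)) \<le> B"
  defines "f \<equiv> \<lambda>w. cip K (($) (h i w)) (a (Hv w)) * cnj (cip K (($) (h i w)) (b (Hv w)))"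
  defines "g \<equiv> \<lambda>w. of_real gain * (cip K (($) (hh i w)) (a (Hv w)) * cnj (cip K (($) (hh i w)) (b (Hv w)))) + of_real D * cip K (b (Hv w)) (a (Hv w))"
  shows "integrable M (\<lambda>w. Re (f w))" "integrable M (\<lambda>w. Im (f w))"
    "AE w in M. real_cond_exp M (vimage_algebra (space M) Hv PH) (\<lambda>w. Re (f w)) w = Re (g w)"
    "AE w in M. real_cond_exp M (vimage_algebra (space M) Hv PH) (\<lambda>w. Im (f w)) w = Im (g w)"
proof -
  let ?F = "vimage_algebra (space M) Hv PH"
  have *: "integrable M (\<lambda>w. Re (cip K (($) (h i w)) (c (Hv w)) * cnj (cip K (($) (h i w)) (b (Hv w))))) \<and>
     (AE w in M. real_cond_exp M ?F (\<lambda>w. Re (cip K (($) (h i w)) (c (Hv w)) * cnj (cip K (($) (h i w)) (b (Hv w))))) w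
       = Re (of_real gain * (cip K (($) (hh i w)) (c (Hv w)) * cnj (cip K (($) (hh i w)) (b (Hv w)))) + of_real D * cip K (b (Hv w)) (c (Hv w))))"
    if c: "\<And>k. k < K \<Longrightarrow> (\<lambda>H. c H k) \<in> borel_measurable PH" and Bc: "AE w in M. sqn K (c (Hv w)) \<le> A" for c
  proof -
    define p where "p H = (\<lambda>k. c H k + b H k)" for H
    define m where "m H = (\<lambda>k. c H k - b H k)" for H
    have pm: "\<And>k. k < K \<Longrightarrow> (\<lambda>H. p H k) \<in> borel_measurable PH" "\<And>k. k < K \<Longrightarrow> (\<lambda>H. m H k) \<in> borel_measurable PH"
      unfolding p_def m_def using b c by auto
    have par: "sqn K (p H) + sqn K (m H) = 2 * (sqn K (c H) + sqn K (b H))" for H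
      by (simp add: p_def m_def sqn_add sqn_diff)
    have Bp: "AE w in M. sqn K (p (Hv w)) \<le> 2 * (A + B)" and Bm: "AE w in M. sqn K (m (Hv w)) \<le> 2 * (A + B)"
      using Bc Bb by (eventually_elim, use par sqn_nonneg in \<open>smt (verit)\<close>)+
    have cp: "integrable M (\<lambda>w. (cmod (cip K (($) (h i w)) (p (Hv w))))\<^sup>2)"
      "AE w in M. real_cond_exp M ?F (\<lambda>w. (cmod (cip K (($) (h i w)) (p (Hv w))))\<^sup>2) w
        = gain * (cmod (cip K (($) (hh i w)) (p (Hv w))))\<^sup>2 + D * sqn K (p (Hv w))"
      by (rule cond_exp_cip_sq[where a = p, OF i pm(1) Bp]; assumption)+
    have cm: "integrable M (\<lambda>w. (cmod (cip K (($) (h i w)) (m (Hv w))))\<^sup>2)"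
      "AE w in M. real_cond_exp M ?F (\<lambda>w. (cmod (cip K (($) (h i w)) (m (Hv w))))\<^sup>2) w
        = gain * (cmod (cip K (($) (hh i w)) (m (Hv w))))\<^sup>2 + D * sqn K (m (Hv w))"
      by (rule cond_exp_cip_sq[where a = m, OF i pm(2) Bm]; assumption)+
    have e: "Re (cip K x (c H) * cnj (cip K x (b H))) = ((cmod (cip K x (p H)))\<^sup>2 - (cmod (cip K x (m H)))\<^sup>2) / 4" for x H
      using Re_mult_cnj_polar[of "cip K x (c H)" "cip K x (b H)"] by (simp add: p_def m_def cip_linear)
    have e': "Re (cip K (b H) (c H)) = (sqn K (p H) - sqn K (m H)) / 4" for H
    proof -
      have "Re (cip K (b H) (c H)) = Re (cip K (c H) (b H))" using cnj_cip[of K "b H" "c H"] by (metis complex_cnj(1) complex_surj cnj.sel(1))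
      thus ?thesis by (simp add: p_def m_def sqn_add sqn_diff)
    qed
    have "AE w in M. real_cond_exp M ?F (\<lambda>w. ((cmod (cip K (($) (h i w)) (p (Hv w))))\<^sup>2 - (cmod (cip K (($) (h i w)) (m (Hv w))))\<^sup>2) / 4) w
       = real_cond_exp M ?F (\<lambda>w. (cmod (cip K (($) (h i w)) (p (Hv w))))\<^sup>2 - (cmod (cip K (($) (h i w)) (m (Hv w))))\<^sup>2) w / 4"
      by (rule F.real_cond_exp_cdiv) (use cp(1) cm(1) in auto)
    moreover have "AE w in M. real_cond_exp M ?F (\<lambda>w. (cmod (cip K (($) (h i w)) (p (Hv w))))\<^sup>2 - (cmod (cip K (($) (h i w)) (m (Hv w))))\<^sup>2) w
      = real_cond_exp M ?F (\<lambda>w. (cmod (cip K (($) (h i w)) (p (Hv w))))\<^sup>2) w - real_cond_exp M ?F (\<lambda>w. (cmod (cip K (($) (h i w)) (m (Hv w))))\<^sup>2) w"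
      by (rule F.real_cond_exp_diff) (use cp(1) cm(1) in auto)
    ultimately have "AE w in M. real_cond_exp M ?F (\<lambda>w. ((cmod (cip K (($) (h i w)) (p (Hv w))))\<^sup>2 - (cmod (cip K (($) (h i w)) (m (Hv w))))\<^sup>2) / 4) w
       = Re (of_real gain * (cip K (($) (hh i w)) (c (Hv w)) * cnj (cip K (($) (hh i w)) (b (Hv w)))) + of_real D * cip K (b (Hv w)) (c (Hv w)))"
      using cp(2) cm(2)
    proof eventually_elim
      case (elim w)
      have r: "Re (of_real gain * z + of_real D * z') = gain * Re z + D * Re z'" for z z' by simp
      show ?case unfolding elim(1,2,3,4) r e e' by (simp add: algebra_simps diff_divide_distrib add_divide_distrib)
    qed
    thus ?thesis unfolding e using cp(1) cm(1) by auto
  qed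
  from *[OF a Ba] show "integrable M (\<lambda>w. Re (f w))"
    "AE w in M. real_cond_exp M ?F (\<lambda>w. Re (f w)) w = Re (g w)" by (auto simp: f_def g_def)
  define c where "c H = (\<lambda>k. \<i> * a H k)" for H
  have c: "\<And>k. k < K \<Longrightarrow> (\<lambda>H. c H k) \<in> borel_measurable PH" unfolding c_def using a by auto
  have Bc: "AE w in M. sqn K (c (Hv w)) \<le> A" using Ba by (simp add: c_def sqn_scale)
  have ec: "Re (cip K x (c H) * y) = Im (cip K x (a H) * y)" for x H y
    by (simp add: c_def cip_scale_right)
  have ec': "Re (of_real gain * (cip K x (c H) * y) + of_real D * cip K z (c H)) = Im (of_real gain * (cip K x (a H) * y) + of_real D * cip K z (a H))" for x H y z
    by (simp add: c_def cip_scale_right algebra_simps)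
  from *[OF c Bc] show "integrable M (\<lambda>w. Im (f w))"
    "AE w in M. real_cond_exp M ?F (\<lambda>w. Im (f w)) w = Im (g w)" unfolding ec ec' by (auto simp: f_def g_def)
qed

end

subsection \<open>Matrix inverses\<close>

lemma mat_adjoint_dim [simp]: "dim_row (mat_adjoint A) = dim_col A" "dim_col (mat_adjoint A) = dim_row A"
  by (simp_all add: mat_adjoint_def)

lemma mat_adjoint_carrier [simp]: "A \<in> carrier_mat m n \<Longrightarrow> mat_adjoint A \<in> carrier_mat n m"
  by (auto intro: carrier_matI)

lemma mat_adjoint_index: "j < dim_col A \<Longrightarrow> l < dim_row A \<Longrightarrow> mat_adjoint A $$ (j, l) = cnj (A $$ (l, j))"
  by (simp add: mat_adjoint_def mat_of_rows_def)

lemma mat_of_cols_index': "set us \<subseteq> carrier_vec n \<Longrightarrow> l < n \<Longrightarrow> j < length us \<Longrightarrow> mat_of_cols n us $$ (l, j) = us ! j $ l"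
  by (simp add: mat_of_cols_def)

lemma index_mult_sum: "A \<in> carrier_mat m n \<Longrightarrow> B \<in> carrier_mat n q \<Longrightarrow> i < m \<Longrightarrow> j < q \<Longrightarrow>
    (A * B) $$ (i, j) = (\<Sum>l<n. A $$ (i, l) * B $$ (l, j))"
  by (simp add: scalar_prod_def atLeast0LessThan)

lemma mat_of_cols_sandwich:
  assumes x: "x \<in> carrier_vec n" and us: "set us \<subseteq> carrier_vec n" and vs: "set vs \<subseteq> carrier_vec n"
    and j: "j < length us" and k: "k < length vs"
  shows "(mat_adjoint (mat_of_cols n us) * mat_of_cols n [x] * mat_adjoint (mat_of_cols n [x]) * mat_of_cols n vs) $$ (j, k)
    = cip n (($) x) (($) (us ! j)) * cnj (cip n (($) x) (($) (vs ! k)))"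
proof -
  let ?U = "mat_of_cols n us" and ?V = "mat_of_cols n vs" and ?X = "mat_of_cols n [x]"
  have U: "?U \<in> carrier_mat n (length us)" and V: "?V \<in> carrier_mat n (length vs)" and X: "?X \<in> carrier_mat n 1" by auto
  have UX: "mat_adjoint ?U * ?X \<in> carrier_mat (length us) 1" and XV: "mat_adjoint ?X * ?V \<in> carrier_mat 1 (length vs)"
    using U V X by auto
  have "mat_adjoint ?U * ?X * mat_adjoint ?X * ?V = (mat_adjoint ?U * ?X) * (mat_adjoint ?X * ?V)"
    by (rule assoc_mult_mat[OF UX mat_adjoint_carrier[OF X] V])
  hence "(mat_adjoint ?U * ?X * mat_adjoint ?X * ?V) $$ (j, k) = (mat_adjoint ?U * ?X) $$ (j, 0) * (mat_adjoint ?X * ?V) $$ (0, k)"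
    using index_mult_sum[OF UX XV j k] by simp
  moreover have "(mat_adjoint ?U * ?X) $$ (j, 0) = cip n (($) x) (($) (us ! j))"
  proof -
    have "(mat_adjoint ?U * ?X) $$ (j, 0) = (\<Sum>l<n. mat_adjoint ?U $$ (j, l) * ?X $$ (l, 0))"
      by (rule index_mult_sum[OF mat_adjoint_carrier[OF U] X]) (use j in auto)
    also have "\<dots> = cip n (($) x) (($) (us ! j))"
      unfolding cip_def by (rule sum.cong) (use j x us in \<open>auto simp: mat_adjoint_index mat_of_cols_index'\<close>)
    finally show ?thesis .
  qed
  moreover have "(mat_adjoint ?X * ?V) $$ (0, k) = cnj (cip n (($) x) (($) (vs ! k)))"
  proof -
    have "(mat_adjoint ?X * ?V) $$ (0, k) = (\<Sum>l<n. mat_adjoint ?X $$ (0, l) * ?V $$ (l, k))"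
      by (rule index_mult_sum[OF mat_adjoint_carrier[OF X] V]) (use k in auto)
    also have "\<dots> = cnj (cip n (($) x) (($) (vs ! k)))"
      unfolding cip_def cnj_sum by (rule sum.cong) (use k x vs in \<open>auto simp: mat_adjoint_index mat_of_cols_index'\<close>)
    finally show ?thesis .
  qed
  ultimately show ?thesis by simp
qed

lemma mat_inv_carrier: "A \<in> carrier_mat n n \<Longrightarrow> mat_inv A \<in> carrier_mat n n"
  using mat_inverse(2)[of A n] by (cases "mat_inverse A") (auto simp: mat_inv_def)

lemma mat_inv_unique:
  assumes A: "A \<in> carrier_mat n n" and B: "B \<in> carrier_mat n n" and AB: "A * B = 1\<^sub>m n"
  shows "mat_inv A = B"
proof -
  have BA: "B * A = 1\<^sub>m n" by (rule mat_mult_left_right_inverse[OF A B AB])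
  have "A \<in> Units (ring_mat TYPE(complex) n ())"
    using A B AB BA by (auto simp: Units_def ring_mat_simps)
  then obtain C' where C': "mat_inverse A = Some C'" using mat_inverse(1)[OF A, where b = "()"] by (cases "mat_inverse A") auto
  from mat_inverse(2)[OF A this] have CA: "C' * A = 1\<^sub>m n" and Cc: "C' \<in> carrier_mat n n" by auto
  have "C' = C' * (A * B)" using Cc AB by simp
  also have "\<dots> = (C' * A) * B" by (rule assoc_mult_mat[symmetric, OF Cc A B])
  finally show ?thesis using C' CA B by (simp add: mat_inv_def)
qed

text \<open>Cramer's rule replaces elimination by determinants, which are visibly measurable in the
  entries; the value 0 at singular matrices is one measurable case.\<close>

lemma mat_inv_eq_adj_mat:
  assumes A: "A \<in> carrier_mat n n" and ij: "i < n" "j < n"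
  shows "mat_inv A $$ (i, j) = (if det A = 0 then 0 else cofactor A j i / det A)"
proof (cases "det A = 0")
  case True
  have "mat_inverse A = None"
  proof (rule ccontr)
    assume "mat_inverse A \<noteq> None"
    then obtain B where "mat_inverse A = Some B" by auto
    from mat_inverse(2)[OF A this] have "A * B = 1\<^sub>m n" "B \<in> carrier_mat n n" by auto
    hence "det A * det B = 1" using det_mult[OF A, of B] by simp
    thus False using True by simp
  qed
  thus ?thesis using True A ij by (simp add: mat_inv_def)
next
  case False
  have "mat_inv A = (1 / det A) \<cdot>\<^sub>m adj_mat A"
  proof (rule mat_inv_unique[OF A])
    show "(1 / det A) \<cdot>\<^sub>m adj_mat A \<in> carrier_mat n n" using adj_mat(1)[OF A] by simp
    have "A * ((1 / det A) \<cdot>\<^sub>m adj_mat A) = (1 / det A) \<cdot>\<^sub>m (A * adj_mat A)"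
      by (rule mult_smult_distrib[OF A adj_mat(1)[OF A]])
    also have "\<dots> = 1\<^sub>m n" unfolding adj_mat(2)[OF A] using False by (intro eq_matI) auto
    finally show "A * ((1 / det A) \<cdot>\<^sub>m adj_mat A) = 1\<^sub>m n" .
  qed
  thus ?thesis using False A ij adj_mat(1)[OF A] by (simp add: adj_mat_def)
qed

lemma measurable_det:
  assumes "\<And>w. A w \<in> carrier_mat n n" and "\<And>i j. i < n \<Longrightarrow> j < n \<Longrightarrow> (\<lambda>w. A w $$ (i, j)) \<in> borel_measurable N"
  shows "(\<lambda>w. det (A w) :: complex) \<in> borel_measurable N"
proof -
  have "(\<lambda>w. \<Sum>p\<in>{p. p permutes {0..<n}}. signof p * (\<Prod>i = 0..<n. A w $$ (i, p i))) \<in> borel_measurable N"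
  proof (intro borel_measurable_sum borel_measurable_times borel_measurable_const borel_measurable_prod)
    fix p i assume "p \<in> {p. p permutes {0..<n}}" "i \<in> {0..<n}"
    thus "(\<lambda>w. A w $$ (i, p i)) \<in> borel_measurable N"
      using assms(2)[of i "p i"] permutes_in_image[of p "{0..<n}" i] by auto
  qed
  thus ?thesis by (simp add: det_def'[OF assms(1)])
qed

text \<open>
  The conditional expectation of a non-measurable function is a junk value, so the rate makes
  sense only because the inflation factor is a measurable function of the outcome.
\<close>
lemma measurable_mat_inv:
  assumes A: "\<And>w. A w \<in> carrier_mat n n" and m: "\<And>i j. i < n \<Longrightarrow> j < n \<Longrightarrow> (\<lambda>w. A w $$ (i, j)) \<in> borel_measurable N"
    and ij: "i < n" "j < n"
  shows "(\<lambda>w. mat_inv (A w) $$ (i, j)) \<in> borel_measurable N"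
proof -
  have [measurable]: "(\<lambda>w. det (A w)) \<in> borel_measurable N" by (rule measurable_det[OF A m])
  have [measurable]: "(\<lambda>w. cofactor (A w) j i) \<in> borel_measurable N"
  proof -
    have d: "mat_delete (A w) j i \<in> carrier_mat (n - 1) (n - 1)" for w
      using A[of w] by (intro mat_delete_carrier) 
    have "(\<lambda>w. det (mat_delete (A w) j i)) \<in> borel_measurable N"
    proof (rule measurable_det[OF d])
      fix a b assume ab: "a < n - 1" "b < n - 1"
      have "mat_delete (A w) j i $$ (a, b) = A w $$ (if a < j then a else Suc a, if b < i then b else Suc b)" for w
        using A[of w] ab by (simp add: mat_delete_def)
      moreover have "(if a < j then a else Suc a) < n" "(if b < i then b else Suc b) < n" using ab by auto
      note m[OF this]
      ultimately show "(\<lambda>w. mat_delete (A w) j i $$ (a, b)) \<in> borel_measurable N" by presburger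
    qed
    thus ?thesis unfolding cofactor_def by measurable
  qed
  show ?thesis unfolding mat_inv_eq_adj_mat[OF A ij] by measurable
qed

text \<open>Sherman-Morrison for (\<tau> + \<mu> V) I - \<mu> v v^* where V is the squared norm of
  v. The scalar is written this way because \<tau> is then the eigenvalue on v and \<tau> + \<mu> V
  the one on its complement, so positivity of \<tau> ensures invertibility.\<close>

lemma mat_inv_rank_one:
  fixes v :: "nat \<Rightarrow> complex" and \<mu> \<tau> V :: real
  assumes V_def: "V = (\<Sum>k<n. (cmod (v k))\<^sup>2)" and \<tau>: "\<tau> > 0" and \<mu>: "\<mu> \<ge> 0"
  shows "mat_inv (mat n n (\<lambda>(j, k). of_real (\<tau> + \<mu> * V) * (if j = k then 1 else 0) - of_real \<mu> * (v j * cnj (v k))))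
    = mat n n (\<lambda>(j, k). of_real (1 / (\<tau> + \<mu> * V)) * ((if j = k then 1 else 0) + of_real (\<mu> / \<tau>) * (v j * cnj (v k))))"
proof (rule mat_inv_unique)
  define L where "L = \<tau> + \<mu> * V"
  have V0: "V \<ge> 0" by (simp add: V_def sum_nonneg)
  have L: "L > 0" using \<tau> \<mu> V0 by (simp add: L_def add_pos_nonneg)
  have VV: "(\<Sum>l<n. cnj (v l) * v l) = of_real V"
    by (simp add: V_def complex_norm_square mult.commute del: of_real_power)
  let ?A = "mat n n (\<lambda>(j, k). of_real (\<tau> + \<mu> * V) * (if j = k then 1 else 0) - of_real \<mu> * (v j * cnj (v k)))"
  let ?B = "mat n n (\<lambda>(j, k). of_real (1 / (\<tau> + \<mu> * V)) * ((if j = k then 1 else 0) + of_real (\<mu> / \<tau>) * (v j * cnj (v k))))"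
  show A: "?A \<in> carrier_mat n n" and B: "?B \<in> carrier_mat n n" by auto
  show "?A * ?B = 1\<^sub>m n"
  proof (rule eq_matI)
    fix j k assume "j < dim_row (1\<^sub>m n :: complex mat)" "k < dim_col (1\<^sub>m n :: complex mat)"
    hence jk: "j < n" "k < n" by auto
    have "(?A * ?B) $$ (j, k) = (\<Sum>l<n. (of_real L * (if j = l then 1 else 0) - of_real \<mu> * (v j * cnj (v l))) * (of_real (1 / L) * ((if l = k then 1 else 0) + of_real (\<mu> / \<tau>) * (v l * cnj (v k)))))"
      unfolding index_mult_sum[OF A B jk] using jk by (intro sum.cong) (auto simp: L_def)
    also have "\<dots> = of_real (1 / L) * (\<Sum>l<n. (if j = l then of_real L * ((if l = k then 1 else 0) + of_real (\<mu> / \<tau>) * (v l * cnj (v k))) else 0)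
        - (if l = k then of_real \<mu> * (v j * cnj (v l)) else 0) - of_real (\<mu> * \<mu> / \<tau>) * (v j * cnj (v k)) * (cnj (v l) * v l))"
      unfolding sum_distrib_left using L by (intro sum.cong refl) (auto simp: algebra_simps add_divide_distrib)
    also have "\<dots> = of_real (1 / L) * (of_real L * ((if j = k then 1 else 0) + of_real (\<mu> / \<tau>) * (v j * cnj (v k))) - of_real \<mu> * (v j * cnj (v k)) - of_real (\<mu> * \<mu> / \<tau>) * (v j * cnj (v k)) * of_real V)"
      unfolding sum_subtractf sum_distrib_left[symmetric] VV using jk by simp
    also have "\<dots> = (if j = k then 1 else 0) + of_real (1 / L * (L * \<mu> / \<tau> - \<mu> - \<mu> * \<mu> / \<tau> * V)) * (v j * cnj (v k))"
      using L by (simp add: algebra_simps add_divide_distrib diff_divide_distrib)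
    also have "L * \<mu> / \<tau> - \<mu> - \<mu> * \<mu> / \<tau> * V = 0"
      using \<tau> by (simp add: L_def field_simps)
    finally show "(?A * ?B) $$ (j, k) = 1\<^sub>m n $$ (j, k)" using jk by simp
  qed auto
qed

subsection \<open>The inflation factor\<close>

locale dpc_setup = qub_setup M K r h hh e
  for M :: "'w measure" and K r h hh e +
  fixes s :: nat and P :: real
  assumes s1: "1 \<le> s" and sK: "s \<le> K" and P0: "P > 0"
begin

sublocale Z: zf_dpc M K s P h hh .

abbreviation sgm :: "'w measure" where "sgm \<equiv> vimage_algebra (space M) Hv PH"

lemma sigma_hh_sgm: "Z.sigma_hh = sgm"
  by (rule sigma_hh_eq)

definition p :: real where "p = P / real s"
text \<open>The factor s - 1 instead of s arises because M_i subtracts the isotropic part p D I of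
  the second moment from the mean 1 + p * gain + p D s of nr.\<close>

definition b1 :: real where "b1 = 1 + p * D * (real s - 1)"
definition c2 :: "nat \<Rightarrow> 'w \<Rightarrow> real" where "c2 i w = sqn K (gsv K (\<lambda>l. ($) (hh l w)) i)"
definition bet :: "nat \<Rightarrow> 'w \<Rightarrow> real" where "bet i w = p * gain * sqrt (c2 i w) / (b1 + p * gain * c2 i w)"
definition v :: "nat \<Rightarrow> 'w \<Rightarrow> nat \<Rightarrow> complex" where "v i w k = cip K (($) (hh i w)) (om w k)"

lemma p0: "p > 0" using P0 s1 by (simp add: p_def)
lemma b1_ge: "b1 \<ge> 1" using p0 D_pos s1 by (simp add: b1_def)
lemma c2_nonneg: "0 \<le> c2 i w" by (simp add: c2_def sqn_nonneg)
lemma tau_pos: "b1 + p * gain * c2 i w > 0"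
  using b1_ge p0 gain_nonneg c2_nonneg[of i w] by (simp add: add_pos_nonneg)

lemma v_self: "v i w i = of_real (sqrt (c2 i w))"
  unfolding v_def c2_def by (rule cip_H_onb(2))

lemma c2_eq: "sqn K (($) (hh i w)) = 1 \<Longrightarrow> c2 i w = 1 - (\<Sum>l<i. (cmod (v i w l))\<^sup>2)"
  by (simp add: c2_def sqn_gsv v_def)

lemma c2_measurable [measurable]: "i < K \<Longrightarrow> c2 i \<in> borel_measurable M"
  unfolding c2_def using measurable_gsv_onb[of i K "\<lambda>w l. ($) (hh l w)" M] by (auto intro!: measurable_sqn)

lemma omega_carrier: "w \<in> space M \<Longrightarrow> j < K \<Longrightarrow> Z.omega j w \<in> carrier_vec K"
  by (rule Z.omega_coord(1)) (auto simp: hh_carrier)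

lemma omega_om: "w \<in> space M \<Longrightarrow> j < K \<Longrightarrow> k < K \<Longrightarrow> Z.omega j w $ k = om w j k"
  by (rule Z.omega_coord(2)) (auto simp: hh_carrier)

lemma cip_omega: "w \<in> space M \<Longrightarrow> j < K \<Longrightarrow> cip K x (($) (Z.omega j w)) = cip K x (om w j)"
  by (rule cip_cong) (auto simp: omega_om)

lemma cip_omega': "w \<in> space M \<Longrightarrow> j < K \<Longrightarrow> cip K (($) (Z.omega j w)) x = cip K (om w j) x"
  by (rule cip_cong) (auto simp: omega_om)

lemma nr_eq: "w \<in> space M \<Longrightarrow> i < K \<Longrightarrow> Z.nr i w = 1 + p * (\<Sum>j<s. (cmod (cip K (($) (h i w)) (om w j)))\<^sup>2)"
proof -
  assume w: "w \<in> space M" and i: "i < K"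
  have "cmod (Z.omega j w \<bullet>c h i w) = cmod (cip K (($) (h i w)) (om w j))" if "j < s" for j
  proof -
    have j: "j < K" using that sK by simp
    have "Z.omega j w \<bullet>c h i w = cip K (om w j) (($) (h i w))"
      using omega_carrier[OF w j] h_carrier[OF i w] cip_omega'[OF w j]
      by (subst scalar_prod_eq_cip[of _ K]) auto
    thus ?thesis by (metis cnj_cip complex_mod_cnj)
  qed
  thus ?thesis by (simp add: Z.nr_def p_def)
qed

lemma before_entry:
  assumes w: "w \<in> space M" and i: "i < K" and jk: "j < i" "k < i"
  shows "(mat_adjoint (Z.omega_before i w) * Z.h_col i w * mat_adjoint (Z.h_col i w) * Z.omega_before i w) $$ (j, k)
    = cip K (($) (h i w)) (om w j) * cnj (cip K (($) (h i w)) (om w k))"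
proof -
  have "set (map (\<lambda>j. Z.omega j w) [0..<i]) \<subseteq> carrier_vec K" using omega_carrier[OF w] i by auto
  from mat_of_cols_sandwich[OF h_carrier[OF i w] this this, of j k] jk i show ?thesis
    unfolding Z.omega_before_def Z.h_col_def by (simp add: cip_omega[OF w])
qed

lemma row_entry:
  assumes w: "w \<in> space M" and i: "i < K" and k: "k < i"
  shows "(mat_adjoint (Z.omega_col i w) * Z.h_col i w * mat_adjoint (Z.h_col i w) * Z.omega_before i w) $$ (0, k)
    = cip K (($) (h i w)) (om w i) * cnj (cip K (($) (h i w)) (om w k))"
proof -
  have 1: "set (map (\<lambda>j. Z.omega j w) [0..<i]) \<subseteq> carrier_vec K" using omega_carrier[OF w] i by auto
  have 2: "set [Z.omega i w] \<subseteq> carrier_vec K" using omega_carrier[OF w i] by auto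
  from mat_of_cols_sandwich[OF h_carrier[OF i w] 2 1, of 0 k] k i show ?thesis
    unfolding Z.omega_before_def Z.h_col_def Z.omega_col_def by (simp add: cip_omega[OF w])
qed

lemma om_cond_exp:
  assumes i: "i < K" and j: "j < K" and k: "k < K"
  defines "f \<equiv> \<lambda>w. cip K (($) (h i w)) (om w j) * cnj (cip K (($) (h i w)) (om w k))"
  defines "g \<equiv> \<lambda>w. of_real gain * (v i w j * cnj (v i w k)) + of_real D * cip K (om w k) (om w j)"
  shows "integrable M (\<lambda>w. Re (f w))" "integrable M (\<lambda>w. Im (f w))"
    "AE w in M. real_cond_exp M sgm (\<lambda>w. Re (f w)) w = Re (g w)"
    "AE w in M. real_cond_exp M sgm (\<lambda>w. Im (f w)) w = Im (g w)"
proof -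
  have m: "\<And>k. k < K \<Longrightarrow> (\<lambda>H. omH H j k) \<in> borel_measurable PH" using j by measurable
  have m': "\<And>l. l < K \<Longrightarrow> (\<lambda>H. omH H k l) \<in> borel_measurable PH" using k by measurable
  have B: "AE w in M. sqn K (omH (Hv w) j) \<le> 1" "AE w in M. sqn K (omH (Hv w) k) \<le> 1" by (simp_all add: sqn_onb)
  note * = cond_exp_cip_mult[where a = "\<lambda>H. omH H j" and b = "\<lambda>H. omH H k", OF i m m' B]
  show "integrable M (\<lambda>w. Re (f w))" "integrable M (\<lambda>w. Im (f w))"
    "AE w in M. real_cond_exp M sgm (\<lambda>w. Re (f w)) w = Re (g w)"
    "AE w in M. real_cond_exp M sgm (\<lambda>w. Im (f w)) w = Im (g w)"
    using * by (simp_all add: f_def g_def v_def omH_Hv[OF j] omH_Hv[OF k])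
qed

lemma om_sq_cond_exp:
  assumes i: "i < K" and j: "j < K"
  shows "integrable M (\<lambda>w. (cmod (cip K (($) (h i w)) (om w j)))\<^sup>2)"
    "AE w in M. real_cond_exp M sgm (\<lambda>w. (cmod (cip K (($) (h i w)) (om w j)))\<^sup>2) w = gain * (cmod (v i w j))\<^sup>2 + D"
proof -
  have e: "(cmod z)\<^sup>2 = Re (z * cnj z)" for z by (simp flip: complex_norm_square)
  show "integrable M (\<lambda>w. (cmod (cip K (($) (h i w)) (om w j)))\<^sup>2)"
    unfolding e by (rule om_cond_exp(1)[OF i j j])
  show "AE w in M. real_cond_exp M sgm (\<lambda>w. (cmod (cip K (($) (h i w)) (om w j)))\<^sup>2) w = gain * (cmod (v i w j))\<^sup>2 + D"
    unfolding e using om_cond_exp(3)[OF i j j] om_orthonormal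
    by eventually_elim (use j in simp)
qed

definition NRK :: real where "NRK = 1 + p * gain + p * D * real s"

definition nrf :: "nat \<Rightarrow> 'w \<Rightarrow> real" where
  "nrf i w = 1 + p * (\<Sum>j<s. (cmod (cip K (($) (h i w)) (om w j)))\<^sup>2)"

lemma nrf_measurable [measurable]: "i < K \<Longrightarrow> nrf i \<in> borel_measurable M"
proof -
  assume i: "i < K"
  have "(\<lambda>w. cip K (($) (h i w)) (om w j)) \<in> borel_measurable M" if "j < s" for j
    by (rule measurable_cip) (use i that sK in auto)
  hence "(\<lambda>w. \<Sum>j<s. (cmod (cip K (($) (h i w)) (om w j)))\<^sup>2) \<in> borel_measurable M"
    by (intro borel_measurable_sum borel_measurable_power borel_measurable_norm) auto
  thus ?thesis unfolding nrf_def by measurable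
qed

text \<open>The mean is the same for all directions: hh i lies in the span of the first s beam
  vectors, so its squared coefficients over them sum to 1.\<close>

lemma nr_cond_exp:
  assumes i: "i < s"
  shows "integrable M (nrf i)" "AE w in M. real_cond_exp M sgm (nrf i) w = NRK"
proof -
  have iK: "i < K" using i sK by simp
  let ?q = "\<lambda>j w. (cmod (cip K (($) (h i w)) (om w j)))\<^sup>2"
  have qi: "integrable M (?q j)" if "j < s" for j using om_sq_cond_exp(1)[OF iK, of j] that sK by simp
  have si: "integrable M (\<lambda>w. \<Sum>j<s. ?q j w)" by (intro Bochner_Integration.integrable_sum) (use qi in auto)
  hence psi: "integrable M (\<lambda>w. p * (\<Sum>j<s. ?q j w))" by simp
  have c1: "integrable M (\<lambda>w. 1 :: real)" by simp
  show "integrable M (nrf i)" unfolding nrf_def[abs_def] using psi by simp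
  have "AE w in M. \<forall>j<s. real_cond_exp M sgm (?q j) w = gain * (cmod (v i w j))\<^sup>2 + D"
    by (rule AE_finite_lessThan) (use om_sq_cond_exp(2)[OF iK] sK in auto)
  moreover have "AE w in M. real_cond_exp M sgm (\<lambda>w. 1 + p * (\<Sum>j<s. ?q j w)) w = real_cond_exp M sgm (\<lambda>w. 1) w + real_cond_exp M sgm (\<lambda>w. p * (\<Sum>j<s. ?q j w)) w"
    by (rule F.real_cond_exp_add[OF c1 psi])
  moreover have "AE w in M. real_cond_exp M sgm (\<lambda>w. 1) w = 1"
    by (rule F.real_cond_exp_F_meas[OF c1]) simp
  moreover have "AE w in M. real_cond_exp M sgm (\<lambda>w. p * (\<Sum>j<s. ?q j w)) w = p * real_cond_exp M sgm (\<lambda>w. \<Sum>j<s. ?q j w) w"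
    by (rule F.real_cond_exp_cmult[OF si])
  moreover have "AE w in M. real_cond_exp M sgm (\<lambda>w. \<Sum>j<s. ?q j w) w = (\<Sum>j<s. real_cond_exp M sgm (?q j) w)"
  proof -
    \<comment> \<open>The rule for sums asks for integrability at every index, hence the padding by
      0.\<close>
    have "integrable M (\<lambda>w. if j < s then ?q j w else 0)" for j using qi by (cases "j < s") auto
    from F.real_cond_exp_sum[where f = "\<lambda>j w. if j < s then ?q j w else 0" and I = "{..<s}", OF this]
    show ?thesis by simp
  qed
  ultimately show "AE w in M. real_cond_exp M sgm (nrf i) w = NRK"
    unfolding nrf_def[abs_def] using hh_unit[OF iK]
  proof eventually_elim
    case (elim w)
    have "(\<Sum>j<s. (cmod (v i w j))\<^sup>2) = 1"
      using sum_cip_onb[OF i, of K "\<lambda>l. ($) (hh l w)"] elim(6) by (simp add: v_def)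
    hence "(\<Sum>j<s. real_cond_exp M sgm (?q j) w) = gain + D * real s"
      using elim(1) by (simp add: sum.distrib sum_distrib_left[symmetric])
    thus ?case unfolding elim(2,3,4,5) by (simp add: NRK_def algebra_simps)
  qed
qed

lemma rce_cong: "(\<And>w. w \<in> space M \<Longrightarrow> f w = g w) \<Longrightarrow> g \<in> borel_measurable M \<Longrightarrow>
   AE w in M. real_cond_exp M sgm f w = real_cond_exp M sgm g w"
  by (rule F.real_cond_exp_cong) (auto cong: measurable_cong)

text \<open>The isotropic part D I of the second moment drops out, since the i-th beam vector is
  orthogonal to the earlier ones.\<close>

lemma row_cond_exp:
  assumes i: "i < s"
  shows "AE w in M. \<forall>k<i. mat_cond_exp M Z.sigma_hh 1 i (\<lambda>w.
          mat_adjoint (Z.omega_col i w) * Z.h_col i w * mat_adjoint (Z.h_col i w) * Z.omega_before i w) w $$ (0, k)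
     = of_real (gain * sqrt (c2 i w)) * cnj (v i w k)"
proof (rule AE_finite_lessThan)
  fix k assume k: "k < i"
  have iK: "i < K" and kK: "k < K" using i k sK by auto
  let ?X = "\<lambda>w. (mat_adjoint (Z.omega_col i w) * Z.h_col i w * mat_adjoint (Z.h_col i w) * Z.omega_before i w) $$ (0, k)"
  let ?f = "\<lambda>w. cip K (($) (h i w)) (om w i) * cnj (cip K (($) (h i w)) (om w k))"
  note oc = om_cond_exp[OF iK iK kK]
  have "AE w in M. real_cond_exp M sgm (\<lambda>w. Re (?X w)) w = real_cond_exp M sgm (\<lambda>w. Re (?f w)) w"
    by (rule rce_cong) (use row_entry[OF _ iK k] oc(1) in auto)
  moreover have "AE w in M. real_cond_exp M sgm (\<lambda>w. Im (?X w)) w = real_cond_exp M sgm (\<lambda>w. Im (?f w)) w"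
    by (rule rce_cong) (use row_entry[OF _ iK k] oc(2) in auto)
  ultimately show "AE w in M. mat_cond_exp M Z.sigma_hh 1 i (\<lambda>w.
          mat_adjoint (Z.omega_col i w) * Z.h_col i w * mat_adjoint (Z.h_col i w) * Z.omega_before i w) w $$ (0, k)
     = of_real (gain * sqrt (c2 i w)) * cnj (v i w k)"
    using oc(3,4)
  proof eventually_elim
    case (elim w)
    have o: "cip K (om w k) (om w i) = 0" using k by (simp add: onb_orth)
    have "mat_cond_exp M Z.sigma_hh 1 i (\<lambda>w.
          mat_adjoint (Z.omega_col i w) * Z.h_col i w * mat_adjoint (Z.h_col i w) * Z.omega_before i w) w $$ (0, k)
       = complex_cond_exp M sgm ?X w" using k unfolding mat_cond_exp_def sigma_hh_sgm by (subst index_mat) auto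
    also have "\<dots> = of_real (gain * sqrt (c2 i w)) * cnj (v i w k)"
      unfolding complex_cond_exp_def elim(1,2) elim(3,4) o by (simp add: v_self complex_eq_iff)
    finally show ?case .
  qed
qed

lemma M_mat_eq:
  assumes i: "i < s"
  shows "AE w in M. Z.M_mat i w = mat i i (\<lambda>(j, k).
     of_real (b1 + p * gain * c2 i w + p * gain * (\<Sum>l<i. (cmod (v i w l))\<^sup>2)) * (if j = k then 1 else 0) - of_real (p * gain) * (v i w j * cnj (v i w k)))"
proof -
  have iK: "i < K" using i sK by auto
  define X where "X w = complex_of_real (Z.nr i w) \<cdot>\<^sub>m 1\<^sub>m i - complex_of_real (P / real s) \<cdot>\<^sub>m
       (mat_adjoint (Z.omega_before i w) * Z.h_col i w * mat_adjoint (Z.h_col i w) * Z.omega_before i w)" for w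
  have "AE w in M. \<forall>j<i. \<forall>k<i. complex_cond_exp M sgm (\<lambda>w. X w $$ (j, k)) w
     = of_real (NRK - p * D) * (if j = k then 1 else 0) - of_real (p * gain) * (v i w j * cnj (v i w k))"
  proof (intro AE_finite_lessThan)
    fix j k assume j: "j < i" and k: "k < i"
    have jK: "j < K" and kK: "k < K" using j k iK by auto
    let ?f = "\<lambda>w. cip K (($) (h i w)) (om w j) * cnj (cip K (($) (h i w)) (om w k))"
    let ?\<delta> = "if j = k then 1 else (0::real)"
    note oc = om_cond_exp[OF iK jK kK]
    have Xe: "X w $$ (j, k) = of_real (?\<delta> * nrf i w) - of_real p * ?f w" if "w \<in> space M" for w
    proof -
      have "dim_col (Z.omega_before i w) = i" by (simp add: Z.omega_before_def)
      thus ?thesis unfolding X_def using j k before_entry[OF that iK j k] nr_eq[OF that iK]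
        by (simp add: p_def nrf_def)
    qed
    have n: "integrable M (\<lambda>w. ?\<delta> * nrf i w)" using nr_cond_exp(1)[OF i] by simp
    have f1: "integrable M (\<lambda>w. p * Re (?f w))" and f2: "integrable M (\<lambda>w. p * Im (?f w))"
      using oc(1,2) by (auto simp del: times_complex.simps)
    have "AE w in M. real_cond_exp M sgm (\<lambda>w. Re (X w $$ (j, k))) w = real_cond_exp M sgm (\<lambda>w. ?\<delta> * nrf i w - p * Re (?f w)) w"
    proof (rule rce_cong)
      show "(\<lambda>w. ?\<delta> * nrf i w - p * Re (?f w)) \<in> borel_measurable M"
        using n f1 by (intro borel_measurable_diff borel_measurable_integrable)
    qed (unfold Xe, simp)
    moreover have "AE w in M. real_cond_exp M sgm (\<lambda>w. ?\<delta> * nrf i w - p * Re (?f w)) w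
       = real_cond_exp M sgm (\<lambda>w. ?\<delta> * nrf i w) w - real_cond_exp M sgm (\<lambda>w. p * Re (?f w)) w"
      by (rule F.real_cond_exp_diff[OF n f1])
    moreover have "AE w in M. real_cond_exp M sgm (\<lambda>w. ?\<delta> * nrf i w) w = ?\<delta> * real_cond_exp M sgm (nrf i) w"
      by (rule F.real_cond_exp_cmult[OF nr_cond_exp(1)[OF i]])
    moreover have "AE w in M. real_cond_exp M sgm (\<lambda>w. p * Re (?f w)) w = p * real_cond_exp M sgm (\<lambda>w. Re (?f w)) w"
      by (rule F.real_cond_exp_cmult[OF oc(1)])
    moreover have "AE w in M. real_cond_exp M sgm (\<lambda>w. Im (X w $$ (j, k))) w = real_cond_exp M sgm (\<lambda>w. (- p) * Im (?f w)) w"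
    proof (rule rce_cong)
      show "(\<lambda>w. (- p) * Im (?f w)) \<in> borel_measurable M"
        using f2 by (intro borel_measurable_times borel_measurable_const borel_measurable_integrable oc(2))
    qed (unfold Xe, simp)
    moreover have "AE w in M. real_cond_exp M sgm (\<lambda>w. (- p) * Im (?f w)) w = (- p) * real_cond_exp M sgm (\<lambda>w. Im (?f w)) w"
      by (rule F.real_cond_exp_cmult[OF oc(2)])
    ultimately show "AE w in M. complex_cond_exp M sgm (\<lambda>w. X w $$ (j, k)) w
     = of_real (NRK - p * D) * (if j = k then 1 else 0) - of_real (p * gain) * (v i w j * cnj (v i w k))"
      using oc(3,4) nr_cond_exp(2)[OF i] om_orthonormal
    proof eventually_elim
      case (elim w)
      have o: "cip K (om w k) (om w j) = (if j = k then 1 else 0)" using elim(10) jK kK by auto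
      show ?case unfolding complex_cond_exp_def elim(1,2,3,4,5,6,7,8,9) o
        by (simp add: complex_eq_iff algebra_simps)
    qed
  qed
  thus ?thesis using hh_unit[OF iK]
  proof eventually_elim
    case (elim w)
    \<comment> \<open>Since c2 and the squared norm of the coefficients before i add up to 1, the
      scalar part of M_i can be split as \<tau> + \<mu> V, the shape of
      \<open>mat_inv_rank_one\<close>.\<close>
    have "b1 + p * gain * c2 i w + p * gain * (\<Sum>l<i. (cmod (v i w l))\<^sup>2) = NRK - p * D"
      unfolding c2_eq[OF elim(2)] by (simp add: b1_def NRK_def algebra_simps)
    thus ?case using elim(1) unfolding Z.M_mat_def mat_cond_exp_def sigma_hh_sgm X_def[symmetric]
      by (intro eq_matI) auto
  qed
qed

lemma M_mat_carrier: "Z.M_mat i w \<in> carrier_mat i i"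
  by (simp add: Z.M_mat_def mat_cond_exp_def)

lemma W_entry:
  "k < i \<Longrightarrow> Z.W i w $$ (0, k) = of_real p * (\<Sum>j<i. mat_cond_exp M Z.sigma_hh 1 i (\<lambda>w.
          mat_adjoint (Z.omega_col i w) * Z.h_col i w * mat_adjoint (Z.h_col i w) * Z.omega_before i w) w $$ (0, j) * mat_inv (Z.M_mat i w) $$ (j, k))"
proof -
  assume k: "k < i"
  let ?R = "mat_cond_exp M Z.sigma_hh 1 i (\<lambda>w. mat_adjoint (Z.omega_col i w) * Z.h_col i w * mat_adjoint (Z.h_col i w) * Z.omega_before i w) w"
  have R: "?R \<in> carrier_mat 1 i" by (simp add: mat_cond_exp_def)
  note I = mat_inv_carrier[OF M_mat_carrier[of i w]]
  have "Z.W i w $$ (0, k) = of_real p * (?R * mat_inv (Z.M_mat i w)) $$ (0, k)"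
    unfolding Z.W_def p_def using R I k by (subst index_smult_mat) auto
  thus ?thesis using index_mult_sum[OF R I _ k, of 0] by simp
qed

lemma W_carrier: "Z.W i w \<in> carrier_mat 1 i"
  unfolding Z.W_def
  by (intro smult_carrier_mat mult_carrier_mat[OF _ mat_inv_carrier[OF M_mat_carrier[of i w]]]) (simp add: mat_cond_exp_def)

text \<open>The row of conditional means is a multiple of v^*, a left eigenvector of M_i with
  eigenvalue b1 + p * gain * c2, so the inverse merely divides by that number.\<close>

lemma W_eq:
  assumes i: "i < s"
  shows "AE w in M. \<forall>k<i. Z.W i w $$ (0, k) = of_real (bet i w) * cnj (v i w k)"
  using row_cond_exp[OF i] M_mat_eq[OF i]
proof eventually_elim
  case (elim w)
  show ?case
  proof (intro allI impI)
    fix k assume k: "k < i"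
    define V where "V = (\<Sum>l<i. (cmod (v i w l))\<^sup>2)"
    define \<tau> where "\<tau> = b1 + p * gain * c2 i w"
    define \<mu> where "\<mu> = p * gain"
    have \<tau>: "\<tau> > 0" by (simp add: \<tau>_def tau_pos)
    have \<mu>: "\<mu> \<ge> 0" using p0 gain_nonneg by (simp add: \<mu>_def)
    have V0: "V \<ge> 0" by (simp add: V_def sum_nonneg)
    have L: "\<tau> + \<mu> * V > 0" using \<tau> \<mu> V0 by (simp add: add_pos_nonneg)
    have VV: "(\<Sum>l<i. cnj (v i w l) * v i w l) = of_real V"
      by (simp add: V_def complex_norm_square mult.commute del: of_real_power)
    have inv: "mat_inv (Z.M_mat i w) = mat i i (\<lambda>(j, k). of_real (1 / (\<tau> + \<mu> * V)) * ((if j = k then 1 else 0) + of_real (\<mu> / \<tau>) * (v i w j * cnj (v i w k))))"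
      unfolding elim(2) using mat_inv_rank_one[OF V_def \<tau> \<mu>] by (simp add: \<tau>_def \<mu>_def V_def)
    have "Z.W i w $$ (0, k) = of_real p * (\<Sum>j<i. of_real (gain * sqrt (c2 i w)) * cnj (v i w j) * (of_real (1 / (\<tau> + \<mu> * V)) * ((if j = k then 1 else 0) + of_real (\<mu> / \<tau>) * (v i w j * cnj (v i w k)))))"
      unfolding W_entry[OF k] inv using elim(1) k by (intro arg_cong2[of _ _ _ _ "(*)"] sum.cong refl) auto
    also have "(\<Sum>j<i. of_real (gain * sqrt (c2 i w)) * cnj (v i w j) * (of_real (1 / (\<tau> + \<mu> * V)) * ((if j = k then 1 else 0) + of_real (\<mu> / \<tau>) * (v i w j * cnj (v i w k)))))
      = of_real (gain * sqrt (c2 i w)) * of_real (1 / (\<tau> + \<mu> * V)) * (\<Sum>j<i. (if j = k then cnj (v i w j) else 0) + of_real (\<mu> / \<tau>) * cnj (v i w k) * (cnj (v i w j) * v i w j))"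
      unfolding sum_distrib_left by (rule sum.cong) (auto simp: algebra_simps)
    also have "(\<Sum>j<i. (if j = k then cnj (v i w j) else 0) + of_real (\<mu> / \<tau>) * cnj (v i w k) * (cnj (v i w j) * v i w j)) = of_real (1 + \<mu> / \<tau> * V) * cnj (v i w k)"
      unfolding sum.distrib sum_distrib_left[symmetric] VV using k by (simp add: algebra_simps)
    also have "of_real p * (of_real (gain * sqrt (c2 i w)) * of_real (1 / (\<tau> + \<mu> * V)) * (of_real (1 + \<mu> / \<tau> * V) * cnj (v i w k)))
      = of_real (p * (gain * sqrt (c2 i w)) * (1 / (\<tau> + \<mu> * V) * (1 + \<mu> / \<tau> * V))) * cnj (v i w k)"
      unfolding of_real_mult by (simp only: mult_ac)
    also have "1 / (\<tau> + \<mu> * V) * (1 + \<mu> / \<tau> * V) = 1 / \<tau>"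
    proof -
      have "1 + \<mu> / \<tau> * V = (\<tau> + \<mu> * V) / \<tau>" using \<tau> by (simp add: field_simps)
      thus ?thesis using L by simp
    qed
    finally show "Z.W i w $$ (0, k) = of_real (bet i w) * cnj (v i w k)"
      by (simp add: bet_def \<tau>_def)
  qed
qed

lemma W_measurable [measurable]: "i < K \<Longrightarrow> k < i \<Longrightarrow> (\<lambda>w. Z.W i w $$ (0, k)) \<in> borel_measurable M"
proof -
  assume i: "i < K" and k: "k < i"
  have rce: "real_cond_exp M Z.sigma_hh f \<in> borel_measurable M" for f
    unfolding sigma_hh_sgm by (rule borel_measurable_cond_exp2)
  have cce [measurable]: "complex_cond_exp M Z.sigma_hh f \<in> borel_measurable M" for f
  proof -
    show ?thesis unfolding borel_measurable_complex_iff complex_cond_exp_def using rce by simp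
  qed
  have mce: "(\<lambda>w. mat_cond_exp M Z.sigma_hh m n X w $$ (a, b)) \<in> borel_measurable M" if "a < m" "b < n" for m n X a b
    using cce[of "\<lambda>w. X w $$ (a, b)"] that by (simp add: mat_cond_exp_def)
  have [measurable]: "(\<lambda>w. mat_inv (Z.M_mat i w) $$ (a, b)) \<in> borel_measurable M" if "a < i" "b < i" for a b
    by (rule measurable_mat_inv[OF M_mat_carrier _ that]) (use mce in \<open>auto simp: Z.M_mat_def\<close>)
  show ?thesis unfolding W_entry[OF k]
    by (intro borel_measurable_times borel_measurable_const borel_measurable_sum mce) (use k in auto)
qed

end

subsection \<open>Deviation of the rate from its limit\<close>

lemma abs_ln_diff_le: "1 \<le> a \<Longrightarrow> 1 \<le> b \<Longrightarrow> \<bar>ln a - ln b\<bar> \<le> \<bar>a - b :: real\<bar>"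
proof -
  have *: "ln x - ln y \<le> \<bar>x - y\<bar>" if "1 \<le> x" "1 \<le> y" for x y :: real
  proof -
    have "ln x - ln y \<le> (x - y) / y" by (rule ln_diff_le) (use that in auto)
    also have "\<dots> \<le> \<bar>x - y\<bar> / y" using that by (intro divide_right_mono) auto
    also have "\<dots> \<le> \<bar>x - y\<bar> / 1" using that by (intro divide_left_mono) auto
    finally show ?thesis by simp
  qed
  assume "1 \<le> a" "1 \<le> b"
  thus ?thesis using *[of a b] *[of b a] by (simp add: abs_minus_commute abs_if split: if_splits)
qed

lemma H_expansion:
  assumes "j < m" "k < n"
  shows "H j k = (\<Sum>l<m. cip n (H j) (onb n H l) * onb n H l k)"
proof -
  have "(\<Sum>l<m. cip n (H j) (onb n H l) * onb n H l k) = (\<Sum>l<Suc j. cip n (H j) (onb n H l) * onb n H l k)"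
    by (rule sum.mono_neutral_right) (use assms in \<open>auto simp: cip_H_onb\<close>)
  also have "\<dots> = (\<Sum>l<j. cip n (H j) (onb n H l) * onb n H l k) + gsv n H j k"
    by (simp add: cip_H_onb(2) gsv_eq_onb[OF assms(2), symmetric])
  finally show ?thesis by (simp add: gsv_def)
qed

text \<open>Place x in slot m: the difference of the two sides is the squared norm of its
  residual.\<close>

lemma Bessel_onb: "(\<Sum>l<m. (cmod (cip n x (onb n H l)))\<^sup>2) \<le> sqn n x"
proof -
  have "onb n (H(m := x)) l = onb n H l" if "l < m" for l using that by (intro onb_cong) auto
  hence "sqn n (gsv n (H(m := x)) m) = sqn n x - (\<Sum>l<m. (cmod (cip n x (onb n H l)))\<^sup>2)"
    by (simp add: sqn_gsv)
  thus ?thesis using sqn_nonneg[of n "gsv n (H(m := x)) m"] by simp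
qed

lemma abs_cmod_sq_diff:
  "\<bar>(cmod (z + w))\<^sup>2 - (cmod z)\<^sup>2\<bar> \<le> 2 * cmod z * cmod w + (cmod w)\<^sup>2"
proof -
  have "\<bar>Re (z * cnj w)\<bar> \<le> cmod z * cmod w"
    using abs_Re_le_cmod[of "z * cnj w"] by (simp add: norm_mult)
  moreover have "2 * cmod z * cmod w = 2 * (cmod z * cmod w)" by simp
  ultimately show ?thesis unfolding cmod_add_sq using zero_le_power2[of "cmod w"] by linarith
qed

text \<open>
  Here b + mu stands for nr, c for omega_i^* u, and beta is the scalar in W_i.
\<close>
lemma dpc_denominator_identity:
  fixes \<mu> b c :: real
  assumes "b + \<mu> * c\<^sup>2 \<noteq> 0"
  defines "\<beta> \<equiv> \<mu> * c / (b + \<mu> * c\<^sup>2)"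
  shows "(b + \<mu>) * (1 + \<beta>\<^sup>2 * (1 - c\<^sup>2)) - \<mu> * (c + \<beta> * (1 - c\<^sup>2))\<^sup>2 = (b + \<mu>) * b / (b + \<mu> * c\<^sup>2)"
proof -
  define \<tau> where "\<tau> = b + \<mu> * c\<^sup>2"
  have \<tau>: "\<tau> \<noteq> 0" using assms by (simp add: \<tau>_def)
  have b: "\<beta> = \<mu> * c / \<tau>" by (simp add: \<beta>_def \<tau>_def)
  have y: "c + \<beta> * (1 - c\<^sup>2) = c * (b + \<mu>) / \<tau>"
    using \<tau> unfolding b by (simp add: field_simps) (simp add: \<tau>_def algebra_simps)
  have "((b + \<mu>) * (1 + \<beta>\<^sup>2 * (1 - c\<^sup>2)) - \<mu> * (c + \<beta> * (1 - c\<^sup>2))\<^sup>2) * \<tau>\<^sup>2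
     = (b + \<mu>) * (\<tau>\<^sup>2 + \<mu>\<^sup>2 * c\<^sup>2 * (1 - c\<^sup>2)) - \<mu> * (c * (b + \<mu>))\<^sup>2"
    unfolding y unfolding b using \<tau> by (simp add: power_divide field_simps power_mult_distrib)
  also have "\<dots> = (b + \<mu>) * b * \<tau>"
    unfolding \<tau>_def by (simp add: power2_eq_square algebra_simps)
  finally have "((b + \<mu>) * (1 + \<beta>\<^sup>2 * (1 - c\<^sup>2)) - \<mu> * (c + \<beta> * (1 - c\<^sup>2))\<^sup>2) * \<tau> * \<tau> = (b + \<mu>) * b * \<tau>"
    by (simp only: power2_eq_square[of \<tau>] mult.assoc)
  hence "((b + \<mu>) * (1 + \<beta>\<^sup>2 * (1 - c\<^sup>2)) - \<mu> * (c + \<beta> * (1 - c\<^sup>2))\<^sup>2) * \<tau> = (b + \<mu>) * b"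
    using \<tau> by simp
  thus ?thesis using \<tau> unfolding \<tau>_def[symmetric] by (simp only: eq_divide_eq not_False_eq_True if_True)
qed

context dpc_setup
begin

definition \<mu> :: real where "\<mu> = p * gain"
definition S1 :: real where "S1 = 1 + \<mu>"
text \<open>The coordinates of the inflated beam \<open>xv\<close>, that is omega_i plus the
  combination of earlier beams given by the conjugates of W_i. By orthonormality its squared norm is
  \<open>Sf\<close>, which is 1 plus the squared norm of W_i.\<close>

definition gcoef :: "nat \<Rightarrow> 'w \<Rightarrow> nat \<Rightarrow> complex" where
  "gcoef i w j = (if j = i then 1 else of_real (bet i w) * v i w j)"
definition xv :: "nat \<Rightarrow> 'w \<Rightarrow> nat \<Rightarrow> complex" where
  "xv i w = (\<lambda>l. \<Sum>j<Suc i. gcoef i w j * om w j l)"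
definition Sf :: "nat \<Rightarrow> 'w \<Rightarrow> real" where "Sf i w = 1 + (bet i w)\<^sup>2 * (1 - c2 i w)"
definition den :: "nat \<Rightarrow> 'w \<Rightarrow> real" where
  "den i w = nrf i w * Sf i w - p * (cmod (cip K (($) (h i w)) (xv i w)))\<^sup>2"
definition Zs :: "nat \<Rightarrow> 'w \<Rightarrow> real" where
  "Zs i w = (\<Sum>j<s. (cmod (cip K (($) (e i w)) (om w j)))\<^sup>2)"

lemma \<mu>0: "\<mu> \<ge> 0" using p0 gain_nonneg by (simp add: \<mu>_def)

definition good :: "nat \<Rightarrow> 'w \<Rightarrow> bool" where
  "good i w \<longleftrightarrow> w \<in> space M \<and> sqn K (($) (hh i w)) = 1 \<and>
     (\<forall>j<K. \<forall>l<K. cip K (om w j) (om w l) = (if j = l then 1 else 0))"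

lemma AE_good: "i < K \<Longrightarrow> AE w in M. good i w"
  unfolding good_def using om_orthonormal hh_unit[of i] AE_space by (auto elim!: eventually_elim2 eventually_conj)

lemma c2_le_1: "good i w \<Longrightarrow> c2 i w \<le> 1"
  by (simp add: c2_eq good_def sum_nonneg)

lemma Sf_ge_1: "good i w \<Longrightarrow> Sf i w \<ge> 1"
  using c2_le_1[of i w] by (simp add: Sf_def)

text \<open>With t = \<mu> c2 the square of \<open>bet\<close> is \<mu> t / (b1 + t)^2, and b1 >= 1
  gives t <= (b1 + t)^2. The bound is uniform in the user and the outcome and stays bounded in K
  because \<mu> converges.\<close>

lemma Sf_le: "good i w \<Longrightarrow> Sf i w \<le> S1"
proof -
  assume g: "good i w"
  define t where "t = \<mu> * c2 i w"
  have t: "t \<ge> 0" using \<mu>0 c2_nonneg[of i w] by (simp add: t_def)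
  have T: "b1 + t > 0" using b1_ge t by simp
  have "(bet i w)\<^sup>2 = \<mu> * t / (b1 + t)\<^sup>2"
    using c2_nonneg[of i w] by (simp add: bet_def \<mu>_def[symmetric] t_def power_divide power_mult_distrib) (simp add: power2_eq_square)
  also have "\<dots> \<le> \<mu>"
  proof -
    have "t \<le> (b1 + t) * 1" using b1_ge by simp
    also have "\<dots> \<le> (b1 + t) * (b1 + t)" using b1_ge t by (intro mult_left_mono) auto
    finally have "\<mu> * t \<le> \<mu> * (b1 + t)\<^sup>2" using \<mu>0 by (intro mult_left_mono) (auto simp: power2_eq_square)
    thus ?thesis using T by (simp add: divide_le_eq)
  qed
  finally have "(bet i w)\<^sup>2 * (1 - c2 i w) \<le> \<mu> * 1"
    using c2_le_1[OF g] c2_nonneg[of i w] \<mu>0 by (intro mult_mono) auto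
  thus ?thesis by (simp add: Sf_def S1_def)
qed

lemma sum_v: "good i w \<Longrightarrow> (\<Sum>l<i. (cmod (v i w l))\<^sup>2) = 1 - c2 i w"
  using c2_eq[of i w] by (simp add: good_def)

lemma sqn_gcoef: "good i w \<Longrightarrow> sqn (Suc i) (gcoef i w) = Sf i w"
proof -
  assume g: "good i w"
  have "sqn (Suc i) (gcoef i w) = (\<Sum>j<i. (bet i w)\<^sup>2 * (cmod (v i w j))\<^sup>2) + 1"
    by (simp add: sqn_def gcoef_def norm_mult power_mult_distrib)
  thus ?thesis using sum_v[OF g] by (simp add: Sf_def sum_distrib_left[symmetric])
qed

lemma cip_xv: "cip K y (xv i w) = cip (Suc i) (\<lambda>j. cip K y (om w j)) (gcoef i w)"
  unfolding xv_def cip_sum_right cip_scale_right by (simp add: cip_def[of "Suc i"] mult.commute)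

lemma sqn_xv: "i < K \<Longrightarrow> good i w \<Longrightarrow> sqn K (xv i w) = Sf i w"
proof -
  assume i: "i < K" and g: "good i w"
  have "cip K (xv i w) (om w j) = gcoef i w j" if "j < Suc i" for j
  proof -
    have "cip K (xv i w) (om w j) = (\<Sum>l<Suc i. gcoef i w l * cip K (om w l) (om w j))"
      unfolding xv_def cip_sum_left cip_scale_left ..
    also have "\<dots> = (\<Sum>l<Suc i. if l = j then gcoef i w j else 0)"
      using g i that by (intro sum.cong) (auto simp: good_def)
    finally show ?thesis using that by simp
  qed
  hence "cip K (xv i w) (xv i w) = cip (Suc i) (gcoef i w) (gcoef i w)"
    unfolding cip_xv by (intro cip_cong) auto
  thus ?thesis using sqn_gcoef[OF g] by (simp add: cip_self)
qed

lemma cip_hh_xv: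
  assumes g: "good i w"
  shows "cip K (($) (hh i w)) (xv i w) = of_real (sqrt (c2 i w) + bet i w * (1 - c2 i w))"
proof -
  have "cip K (($) (hh i w)) (xv i w) = (\<Sum>j<i. of_real (bet i w) * (v i w j * cnj (v i w j))) + v i w i"
    unfolding cip_xv by (simp add: cip_def[of "Suc i"] gcoef_def v_def[symmetric] algebra_simps)
  also have "\<dots> = of_real (sqrt (c2 i w) + bet i w * (\<Sum>j<i. (cmod (v i w j))\<^sup>2))"
    by (simp add: v_self complex_norm_square sum_distrib_left del: of_real_power)
  finally show ?thesis using sum_v[OF g] by simp
qed

lemma nrf_ge_1: "nrf i w \<ge> 1"
  using p0 by (simp add: nrf_def sum_nonneg)

text \<open>Cauchy-Schwarz in the coordinates of \<open>xv\<close> bounds the signal by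
  \<open>Sf\<close> times the power received on the first i + 1 beams, which nr contains. The noise
  term 1 of nr leaves \<open>Sf\<close>, and this is at least 1.\<close>

lemma den_ge_1:
  assumes i: "i < s" and g: "good i w"
  shows "den i w \<ge> 1"
proof -
  let ?f = "\<lambda>j. cip K (($) (h i w)) (om w j)"
  have "(cmod (cip K (($) (h i w)) (xv i w)))\<^sup>2 \<le> sqn (Suc i) ?f * Sf i w"
    unfolding cip_xv sqn_gcoef[OF g, symmetric] by (rule cip_Cauchy_Schwarz)
  also have "\<dots> \<le> (\<Sum>j<s. (cmod (?f j))\<^sup>2) * Sf i w"
    unfolding sqn_def using i Sf_ge_1[OF g] by (intro mult_right_mono sum_mono2) auto
  finally have "p * (cmod (cip K (($) (h i w)) (xv i w)))\<^sup>2 \<le> p * ((\<Sum>j<s. (cmod (?f j))\<^sup>2) * Sf i w)"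
    using p0 by (intro mult_left_mono) auto
  hence "den i w \<ge> Sf i w" unfolding den_def nrf_def by (simp add: algebra_simps)
  thus ?thesis using Sf_ge_1[OF g] by linarith
qed

text \<open>Almost sure properties under the kernel pass to e because a nonnegative function that
  measures their violation has integral 0.\<close>

lemma e_unit: assumes i: "i < K"
  shows "AE w in M. cip K (($) (e i w)) (($) (hh i w)) = 0 \<and> sqn K (($) (e i w)) = 1"
proof -
  let ?f = "\<lambda>z. ennreal ((cmod (cip K (($) (fst z)) (($) (snd z))))\<^sup>2) + ennreal \<bar>sqn K (($) (fst z)) - 1\<bar>"
  have f: "?f \<in> borel_measurable (C \<Otimes>\<^sub>M C)" by measurable
  have "(\<integral>\<^sup>+w. ?f (e i w, hh i w) \<partial>M) = (\<integral>\<^sup>+w. \<integral>\<^sup>+x. ?f (x, hh i w) \<partial>kap i (hh i w) \<partial>M)"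
    by (rule e_hh_kernel[OF i f])
  also have "\<dots> = (\<integral>\<^sup>+w. 0 \<partial>M)"
  proof (rule nn_integral_cong_AE, use hh_unit[OF i] AE_space in eventually_elim)
    case (elim w)
    interpret U: uniform_sphere K "hh i w" "kap i (hh i w)"
      by (rule kap(2)[OF i hh_carrier[OF i elim(2)] elim(1)])
    have "(\<integral>\<^sup>+x. ?f (x, hh i w) \<partial>kap i (hh i w)) = (\<integral>\<^sup>+x. 0 \<partial>kap i (hh i w))"
      by (rule nn_integral_cong_AE, use U.AE_unit in eventually_elim) simp
    thus ?case by simp
  qed
  finally have "(\<integral>\<^sup>+w. ?f (e i w, hh i w) \<partial>M) = 0" by simp
  moreover have "(\<lambda>w. ?f (e i w, hh i w)) \<in> borel_measurable M"
    by (rule measurable_compose[OF _ f]) (use i in measurable)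
  ultimately have "AE w in M. ?f (e i w, hh i w) = 0" by (simp add: nn_integral_0_iff_AE)
  thus ?thesis by eventually_elim auto
qed

lemma h_decomposition:
  assumes i: "i < K"
  shows "AE w in M. \<forall>z. cip K (($) (h i w)) z = of_real (cvec_norm (h i w)) *
    (of_real (sqrt (1 - d i w)) * cip K (($) (hh i w)) z + of_real (sqrt (d i w)) * cip K (($) (e i w)) z)"
  using decomposition_coord[OF i] AE_space
proof eventually_elim
  case (elim w)
  show ?case
  proof
    fix z
    show "cip K (($) (h i w)) z = of_real (cvec_norm (h i w)) *
      (of_real (sqrt (1 - d i w)) * cip K (($) (hh i w)) z + of_real (sqrt (d i w)) * cip K (($) (e i w)) z)"
      unfolding cip_scale_left[symmetric] cip_add_left[symmetric]
      by (rule cip_cong) (use elim norm_times_direction[OF h_carrier[OF i elim(2)]] in \<open>auto simp: algebra_simps\<close>)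
  qed
qed

definition Nh :: "nat \<Rightarrow> 'w \<Rightarrow> real" where "Nh i w = (cvec_norm (h i w))\<^sup>2"

lemma Zs_le_1: "sqn K (($) (e i w)) = 1 \<Longrightarrow> Zs i w \<le> 1"
  unfolding Zs_def using Bessel_onb[of K "($) (e i w)" "\<lambda>l. ($) (hh l w)" s] by simp

lemma Zs_nonneg: "0 \<le> Zs i w" by (simp add: Zs_def sum_nonneg)

lemma nrf_eq:
  assumes i: "i < s"
  shows "AE w in M. nrf i w = 1 + p * Nh i w * ((1 - d i w) + d i w * Zs i w)"
proof -
  have iK: "i < K" using i sK by simp
  show ?thesis using h_decomposition[OF iK] e_unit[OF iK] AE_good[OF iK]
  proof eventually_elim
    case (elim w)
    have w: "w \<in> space M" using elim(3) by (simp add: good_def)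
    let ?a = "sqrt (1 - d i w)" and ?b = "sqrt (d i w)"
    let ?e = "\<lambda>j. cip K (($) (e i w)) (om w j)"
    have ab: "?a\<^sup>2 = 1 - d i w" "?b\<^sup>2 = d i w" using d_bounds[OF iK w] by auto
    have cross: "(\<Sum>j<s. v i w j * cnj (?e j)) = 0"
    proof -
      have "(\<Sum>j<s. v i w j * cnj (?e j)) = cip K (\<lambda>k. \<Sum>j<s. v i w j * om w j k) (($) (e i w))"
        unfolding cip_sum_left cip_scale_left cnj_cip ..
      also have "\<dots> = cip K (($) (hh i w)) (($) (e i w))"
        by (rule cip_cong) (use H_expansion[OF i, of _ K "\<lambda>l. ($) (hh l w)"] in \<open>auto simp: v_def\<close>)
      also have "\<dots> = 0" using elim(2) cnj_cip[of K "($) (e i w)" "($) (hh i w)"] by simp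
      finally show ?thesis .
    qed
    have sv: "(\<Sum>j<s. (cmod (v i w j))\<^sup>2) = 1"
      using sum_cip_onb[OF i, of K "\<lambda>l. ($) (hh l w)"] elim(3) by (simp add: v_def good_def)
    have "(cmod (cip K (($) (h i w)) (om w j)))\<^sup>2
        = Nh i w * ((1 - d i w) * (cmod (v i w j))\<^sup>2 + d i w * (cmod (?e j))\<^sup>2 + 2 * (?a * ?b) * Re (v i w j * cnj (?e j)))" for j
    proof -
      have r: "Re (of_real x * z * cnj (of_real y * z')) = x * y * Re (z * cnj z')" for x y z z'
        by (simp add: algebra_simps)
      have "cip K (($) (h i w)) (om w j) = of_real (cvec_norm (h i w)) * (of_real ?a * v i w j + of_real ?b * ?e j)"
        using elim(1) by (simp add: v_def)
      hence "(cmod (cip K (($) (h i w)) (om w j)))\<^sup>2 = Nh i w * (cmod (of_real ?a * v i w j + of_real ?b * ?e j))\<^sup>2"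
        by (simp only: norm_mult power_mult_distrib Nh_def norm_of_real power2_abs)
      also have "(cmod (of_real ?a * v i w j + of_real ?b * ?e j))\<^sup>2
        = (1 - d i w) * (cmod (v i w j))\<^sup>2 + d i w * (cmod (?e j))\<^sup>2 + 2 * (?a * ?b) * Re (v i w j * cnj (?e j))"
        unfolding cmod_add_sq r norm_mult power_mult_distrib norm_of_real power2_abs ab by (simp only: mult.assoc)
      finally show ?thesis .
    qed
    hence "(\<Sum>j<s. (cmod (cip K (($) (h i w)) (om w j)))\<^sup>2)
        = Nh i w * ((1 - d i w) * (\<Sum>j<s. (cmod (v i w j))\<^sup>2) + d i w * (\<Sum>j<s. (cmod (?e j))\<^sup>2) + 2 * (?a * ?b) * Re (\<Sum>j<s. v i w j * cnj (?e j)))"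
      by (simp add: sum_distrib_left sum.distrib Re_sum distrib_left del: times_complex.simps)
    also have "\<dots> = Nh i w * ((1 - d i w) + d i w * Zs i w)"
      unfolding cross sv by (simp add: Zs_def)
    finally show ?case by (simp add: nrf_def)
  qed
qed

definition \<zeta> :: real where "\<zeta> = (real s - 1) / (real K - 1)"

text \<open>In the exact expression for nr, replace |h|^2 by K, d by D and \<open>Zs\<close> by its
  mean \<zeta>. The defect D - d is almost surely nonnegative and enters without absolute
  value.\<close>

lemma nrf_dev:
  assumes i: "i < s"
  shows "AE w in M. \<bar>nrf i w - (b1 + \<mu>)\<bar> \<le> p * \<bar>Nh i w - real K\<bar> + p * real K * (D - d i w) + p * real K * \<bar>Zs i w - \<zeta>\<bar> + p"
proof -
  have iK: "i < K" using i sK by simp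
  show ?thesis using nrf_eq[OF i] e_unit[OF iK] AE_good[OF iK] d_le_D[OF iK]
  proof eventually_elim
    case (elim w)
    have w: "w \<in> space M" using elim(3) by (simp add: good_def)
    note db = d_bounds[OF iK w] and Z1 = Zs_le_1[OF conjunct2[OF elim(2)]] and Z0 = Zs_nonneg[of i w]
    define q where "q = (1 - d i w) + d i w * Zs i w"
    have q: "\<bar>q\<bar> \<le> 1"
    proof -
      have "d i w * Zs i w \<le> d i w * 1" using db Z1 by (intro mult_left_mono) auto
      thus ?thesis using db Z0 by (simp add: q_def abs_le_iff)
    qed
    have a1: "\<bar>p * Nh i w * q - p * real K * q\<bar> \<le> p * \<bar>Nh i w - real K\<bar>"
    proof -
      have "p * Nh i w * q - p * real K * q = p * (Nh i w - real K) * q" by (simp add: algebra_simps)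
      hence "\<bar>p * Nh i w * q - p * real K * q\<bar> = p * \<bar>Nh i w - real K\<bar> * \<bar>q\<bar>" using p0 by (simp add: abs_mult)
      also have "\<dots> \<le> p * \<bar>Nh i w - real K\<bar> * 1" using q p0 by (intro mult_left_mono) auto
      finally show ?thesis by simp
    qed
    have a2: "\<bar>q - ((1 - D) + D * \<zeta>)\<bar> \<le> (D - d i w) + \<bar>Zs i w - \<zeta>\<bar>"
    proof -
      have "q - ((1 - D) + D * \<zeta>) = (D - d i w) * (1 - Zs i w) + D * (Zs i w - \<zeta>)"
        by (simp add: q_def algebra_simps)
      hence "\<bar>q - ((1 - D) + D * \<zeta>)\<bar> \<le> \<bar>(D - d i w) * (1 - Zs i w)\<bar> + \<bar>D * (Zs i w - \<zeta>)\<bar>" by linarith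
      also have "\<dots> \<le> (D - d i w) * 1 + 1 * \<bar>Zs i w - \<zeta>\<bar>"
        unfolding abs_mult using elim(4) Z0 Z1 D_pos D_le_1 by (intro add_mono mult_mono) auto
      finally show ?thesis by simp
    qed
    have a2': "\<bar>p * real K * q - p * real K * ((1 - D) + D * \<zeta>)\<bar> \<le> p * real K * ((D - d i w) + \<bar>Zs i w - \<zeta>\<bar>)"
      using mult_left_mono[OF a2, of "p * real K"] p0 by (simp add: abs_mult right_diff_distrib[symmetric])
    have K1: "real K - 1 > 0" using K2 by simp
    \<comment> \<open>K \<zeta> exceeds s - 1 by \<zeta>. The surplus p D \<zeta> is the origin of
      the final summand p.\<close>
    have "real K * \<zeta> - \<zeta> = (real K - 1) * \<zeta>" by (simp add: algebra_simps)
    also have "\<dots> = real s - 1" using K1 by (simp add: \<zeta>_def)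
    finally have Kz: "real K * \<zeta> = real s - 1 + \<zeta>" by simp
    have "p * real K * ((1 - D) + D * \<zeta>) = p * (real K * (1 - D)) + p * D * (real K * \<zeta>)"
      by (simp add: algebra_simps)
    hence a3: "p * real K * ((1 - D) + D * \<zeta>) = \<mu> + p * D * (real s - 1) + p * D * \<zeta>"
      unfolding Kz by (simp add: \<mu>_def gain_def distrib_left)
    have \<zeta>: "0 \<le> \<zeta>" "\<zeta> \<le> 1" using K1 s1 sK by (auto simp: \<zeta>_def)
    have a4: "0 \<le> p * D * \<zeta>" "p * D * \<zeta> \<le> p"
    proof -
      have "D * \<zeta> \<le> 1 * 1" using D_pos D_le_1 \<zeta> by (intro mult_mono) auto
      thus "p * D * \<zeta> \<le> p" using p0 by (simp add: mult.assoc)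
      show "0 \<le> p * D * \<zeta>" using p0 D_pos \<zeta> by simp
    qed
    have "nrf i w - (b1 + \<mu>) = (p * Nh i w * q - p * real K * q) + (p * real K * q - p * real K * ((1 - D) + D * \<zeta>)) + p * D * \<zeta>"
      unfolding a3 using elim(1) by (simp add: q_def b1_def)
    hence "\<bar>nrf i w - (b1 + \<mu>)\<bar> \<le> p * \<bar>Nh i w - real K\<bar> + p * real K * ((D - d i w) + \<bar>Zs i w - \<zeta>\<bar>) + p"
      using a1 a2' a4 by linarith
    thus ?case by (simp add: algebra_simps)
  qed
qed

end

context dpc_setup
begin

definition eps :: "nat \<Rightarrow> 'w \<Rightarrow> real" where "eps i w = cmod (cip K (($) (e i w)) (xv i w))"

text \<open>nr, |h|^2, the error form and d are replaced one after the other, with \<open>S1\<close>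
  bounding every cofactor up to a numerical constant. Unlike in nr, the cross term of u and e need
  not vanish, since \<open>xv\<close> is only one direction; it is controlled by \<open>eps\<close>,
  whose mean is of order K^(-1/2).\<close>

lemma den_dev:
  assumes i: "i < s"
  shows "AE w in M. \<bar>den i w - (b1 + \<mu>) * b1 / (b1 + \<mu> * c2 i w)\<bar> \<le> S1 * \<bar>nrf i w - (b1 + \<mu>)\<bar>
     + 2 * S1 * (p * \<bar>Nh i w - real K\<bar>) + 3 * S1 * (p * real K * eps i w) + S1 * (p * real K * (D - d i w))"
proof -
  have iK: "i < K" using i sK by simp
  show ?thesis using h_decomposition[OF iK] e_unit[OF iK] AE_good[OF iK] d_le_D[OF iK]
  proof eventually_elim
    case (elim w)
    have w: "w \<in> space M" using elim(3) by (simp add: good_def)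
    note db = d_bounds[OF iK w] and g = elim(3)
    define S where "S = Sf i w"
    define y where "y = sqrt (c2 i w) + bet i w * (1 - c2 i w)"
    define \<epsilon> where "\<epsilon> = cip K (($) (e i w)) (xv i w)"
    define a b where "a = sqrt (1 - d i w)" and "b = sqrt (d i w)"
    have S: "1 \<le> S" "S \<le> S1" using Sf_ge_1[OF g] Sf_le[OF g] by (simp_all add: S_def)
    have S10: "0 \<le> S1" using S by linarith
    have ab: "0 \<le> a" "a \<le> 1" "0 \<le> b" "b \<le> 1" "a\<^sup>2 = 1 - d i w" "b\<^sup>2 = d i w"
      using db by (auto simp: a_def b_def)
    have y2: "y\<^sup>2 \<le> S"
    proof -
      have "(cmod (cip K (($) (hh i w)) (xv i w)))\<^sup>2 \<le> sqn K (($) (hh i w)) * sqn K (xv i w)" by (rule cip_Cauchy_Schwarz)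
      thus ?thesis using g by (simp only: cip_hh_xv[OF g] sqn_xv[OF iK g] norm_of_real power2_abs y_def S_def good_def mult_1)
    qed
    have e2: "(cmod \<epsilon>)\<^sup>2 \<le> S"
      using cip_Cauchy_Schwarz[of K "($) (e i w)" "xv i w"] elim(2) by (simp add: sqn_xv[OF iK g] \<epsilon>_def S_def)
    \<comment> \<open>Since S >= 1, a square bounded by S is also bounded by S^2, which avoids
      square roots of \<open>S1\<close>.\<close>
    have le_S1: "x \<le> S1" if "x\<^sup>2 \<le> S" "0 \<le> x" for x
    proof -
      have "x\<^sup>2 \<le> S\<^sup>2" using that(1) S(1) self_le_power[of S 2] by linarith
      hence "x \<le> S" using S(1) by (auto dest: power2_le_imp_le)
      thus ?thesis using S by simp
    qed
    have yS: "\<bar>y\<bar> \<le> S1" by (rule le_S1) (use y2 in auto)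
    have eS: "cmod \<epsilon> \<le> S1" by (rule le_S1) (use e2 in auto)
    define Y where "Y = (cmod (of_real (a * y) + of_real b * \<epsilon>))\<^sup>2"
    have hx: "(cmod (cip K (($) (h i w)) (xv i w)))\<^sup>2 = Nh i w * Y"
    proof -
      have "cip K (($) (h i w)) (xv i w) = of_real (cvec_norm (h i w)) * (of_real (a * y) + of_real b * \<epsilon>)"
        using elim(1) by (simp add: cip_hh_xv[OF g] a_def b_def y_def \<epsilon>_def)
      thus ?thesis by (simp only: norm_mult power_mult_distrib Nh_def Y_def norm_of_real power2_abs)
    qed
    have Y0: "0 \<le> Y" by (simp add: Y_def)
    have n1: "cmod (of_real (a * y)) = a * \<bar>y\<bar>" "cmod (of_real b * \<epsilon>) = b * cmod \<epsilon>"
      using ab by (simp_all add: norm_mult abs_mult)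
    have Y1: "Y \<le> 2 * S1"
    proof -
      have "Y \<le> 2 * ((cmod (of_real (a * y)))\<^sup>2 + (cmod (of_real b * \<epsilon>))\<^sup>2)"
        unfolding Y_def using cmod_parallelogram[of "of_real (a * y)" "of_real b * \<epsilon>"]
          zero_le_power2[of "cmod (of_real (a * y) - of_real b * \<epsilon>)"] by linarith
      also have "\<dots> = 2 * ((1 - d i w) * y\<^sup>2 + d i w * (cmod \<epsilon>)\<^sup>2)"
        unfolding n1 power_mult_distrib ab by simp
      also have "\<dots> \<le> 2 * ((1 - d i w) * S + d i w * S)"
        using y2 e2 db by (intro mult_left_mono add_mono) auto
      also have "\<dots> = 2 * S" by (simp add: algebra_simps)
      finally show ?thesis using S by simp
    qed
    have Yd: "\<bar>Y - (1 - d i w) * y\<^sup>2\<bar> \<le> 3 * S1 * cmod \<epsilon>"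
    proof -
      have "\<bar>Y - (cmod (of_real (a * y)))\<^sup>2\<bar> \<le> 2 * cmod (of_real (a * y)) * cmod (of_real b * \<epsilon>) + (cmod (of_real b * \<epsilon>))\<^sup>2"
        unfolding Y_def by (rule abs_cmod_sq_diff)
      hence "\<bar>Y - (1 - d i w) * y\<^sup>2\<bar> \<le> 2 * (a * \<bar>y\<bar>) * (b * cmod \<epsilon>) + (b * cmod \<epsilon>)\<^sup>2"
        unfolding n1 power_mult_distrib ab by simp
      also have "\<dots> = (2 * (a * \<bar>y\<bar>) * b + b\<^sup>2 * cmod \<epsilon>) * cmod \<epsilon>" by (simp add: power2_eq_square algebra_simps)
      also have "\<dots> \<le> (3 * S1) * cmod \<epsilon>"
      proof (rule mult_right_mono)
        have "a * \<bar>y\<bar> \<le> 1 * S1" using ab yS by (intro mult_mono) auto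
        hence "a * \<bar>y\<bar> * b \<le> S1 * 1" using ab S10 by (intro mult_mono) auto
        moreover have "b\<^sup>2 * cmod \<epsilon> \<le> 1 * S1" using ab db eS by (intro mult_mono) auto
        ultimately show "2 * (a * \<bar>y\<bar>) * b + b\<^sup>2 * cmod \<epsilon> \<le> 3 * S1" by simp
      qed simp
      finally show ?thesis .
    qed
    have c: "c2 i w = (sqrt (c2 i w))\<^sup>2" using c2_nonneg[of i w] by simp
    have id: "(b1 + \<mu>) * S - \<mu> * y\<^sup>2 = (b1 + \<mu>) * b1 / (b1 + \<mu> * c2 i w)"
      using dpc_denominator_identity[of b1 \<mu> "sqrt (c2 i w)"] tau_pos[of i w] c2_nonneg[of i w]
      by (simp add: S_def Sf_def y_def bet_def \<mu>_def)
    have \<mu>K: "\<mu> = p * real K * (1 - D)" by (simp add: \<mu>_def gain_def)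
    have "den i w - ((b1 + \<mu>) * S - \<mu> * y\<^sup>2) = (nrf i w - (b1 + \<mu>)) * S - p * (Nh i w - real K) * Y
       - p * real K * (Y - (1 - d i w) * y\<^sup>2) - p * real K * (D - d i w) * y\<^sup>2"
      unfolding den_def hx S_def[symmetric] \<mu>K by (simp add: algebra_simps)
    hence "\<bar>den i w - ((b1 + \<mu>) * S - \<mu> * y\<^sup>2)\<bar> \<le> \<bar>(nrf i w - (b1 + \<mu>)) * S\<bar> + \<bar>p * (Nh i w - real K) * Y\<bar>
       + \<bar>p * real K * (Y - (1 - d i w) * y\<^sup>2)\<bar> + \<bar>p * real K * (D - d i w) * y\<^sup>2\<bar>"
      by linarith
    also have "\<bar>(nrf i w - (b1 + \<mu>)) * S\<bar> \<le> S1 * \<bar>nrf i w - (b1 + \<mu>)\<bar>"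
    proof -
      have "\<bar>(nrf i w - (b1 + \<mu>)) * S\<bar> = S * \<bar>nrf i w - (b1 + \<mu>)\<bar>" using S by (simp add: abs_mult)
      also have "\<dots> \<le> S1 * \<bar>nrf i w - (b1 + \<mu>)\<bar>" using S by (intro mult_right_mono) auto
      finally show ?thesis .
    qed
    also have "\<bar>p * (Nh i w - real K) * Y\<bar> \<le> 2 * S1 * (p * \<bar>Nh i w - real K\<bar>)"
    proof -
      have "\<bar>p * (Nh i w - real K) * Y\<bar> = Y * (p * \<bar>Nh i w - real K\<bar>)" using p0 Y0 by (simp add: abs_mult)
      also have "\<dots> \<le> 2 * S1 * (p * \<bar>Nh i w - real K\<bar>)" using Y1 p0 by (intro mult_right_mono) auto
      finally show ?thesis .
    qed
    also have "\<bar>p * real K * (Y - (1 - d i w) * y\<^sup>2)\<bar> \<le> 3 * S1 * (p * real K * eps i w)"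
    proof -
      have "\<bar>p * real K * (Y - (1 - d i w) * y\<^sup>2)\<bar> = p * real K * \<bar>Y - (1 - d i w) * y\<^sup>2\<bar>" using p0 by (simp add: abs_mult)
      also have "\<dots> \<le> p * real K * (3 * S1 * cmod \<epsilon>)" using Yd p0 by (intro mult_left_mono) auto
      finally show ?thesis by (simp add: eps_def \<epsilon>_def algebra_simps)
    qed
    also have "\<bar>p * real K * (D - d i w) * y\<^sup>2\<bar> \<le> S1 * (p * real K * (D - d i w))"
    proof -
      have "\<bar>p * real K * (D - d i w) * y\<^sup>2\<bar> = y\<^sup>2 * (p * real K * (D - d i w))" using p0 elim(4) by (simp add: abs_mult)
      also have "\<dots> \<le> S1 * (p * real K * (D - d i w))" using y2 S p0 elim(4) by (intro mult_right_mono) auto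
      finally show ?thesis .
    qed
    finally show ?case unfolding id by simp
  qed
qed

definition Err :: "nat \<Rightarrow> 'w \<Rightarrow> real" where
  "Err i w = p * \<bar>Nh i w - real K\<bar> + p * real K * (D - d i w) + p * real K * \<bar>Zs i w - \<zeta>\<bar> + p
     + p * real K * eps i w + \<bar>c2 i w - (1 - real i / real K)\<bar>"

definition alpha :: real where "alpha = \<mu> / b1"

lemma alpha0: "0 \<le> alpha" using \<mu>0 b1_ge by (simp add: alpha_def)

text \<open>nr and the denominator are compared separately with b1 + \<mu> and D0, whose quotient is
  exactly 1 + alpha * c2. Only then is c2 replaced by its mean 1 - i / K.\<close>

lemma ln_ratio_dev:
  assumes i: "i < s"
  shows "AE w in M. \<bar>ln (nrf i w / den i w) - ln (1 + alpha * (1 - real i / real K))\<bar> \<le> (1 + 3 * S1) * Err i w"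
proof -
  have iK: "i < K" using i sK by simp
  show ?thesis using nrf_dev[OF i] den_dev[OF i] AE_good[OF iK] d_le_D[OF iK]
  proof eventually_elim
    case (elim w)
    note g = elim(3)
    define \<tau> where "\<tau> = b1 + \<mu> * c2 i w"
    have S1: "1 \<le> S1" "\<mu> \<le> S1" using \<mu>0 by (simp_all add: S1_def)
    have \<tau>: "\<tau> > 0" "b1 \<le> \<tau>" using b1_ge \<mu>0 c2_nonneg[of i w] by (auto simp: \<tau>_def add_pos_nonneg)
    have t1: "\<tau> \<le> b1 + \<mu>" using c2_le_1[OF g] \<mu>0 mult_left_mono[of "c2 i w" 1 \<mu>] by (simp add: \<tau>_def)
    define D0 where "D0 = (b1 + \<mu>) * b1 / \<tau>"
    have D01: "D0 \<ge> 1"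
    proof -
      have "\<tau> * 1 \<le> (b1 + \<mu>) * b1" using t1 b1_ge \<tau> by (intro mult_mono) auto
      thus ?thesis using \<tau> by (simp add: D0_def)
    qed
    have d1: "den i w \<ge> 1" by (rule den_ge_1[OF i g])
    note n1 = nrf_ge_1[of i w]
    have b\<mu>: "b1 + \<mu> \<ge> 1" using b1_ge \<mu>0 by simp
    have L1: "ln (nrf i w / den i w) = ln (nrf i w) - ln (den i w)"
      using d1 n1 by (subst ln_div) auto
    have L2: "ln (b1 + \<mu>) - ln D0 = ln (1 + alpha * c2 i w)"
    proof -
      have "ln (b1 + \<mu>) - ln D0 = ln ((b1 + \<mu>) / D0)" using b\<mu> D01 by (subst ln_div) auto
      also have "(b1 + \<mu>) / D0 = 1 + alpha * c2 i w"
        using b\<mu> b1_ge \<tau> by (simp add: D0_def alpha_def \<tau>_def add_divide_distrib)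
      finally show ?thesis .
    qed
    have i1: "0 \<le> 1 - real i / real K" using iK by simp
    have L3: "\<bar>ln (1 + alpha * c2 i w) - ln (1 + alpha * (1 - real i / real K))\<bar> \<le> S1 * \<bar>c2 i w - (1 - real i / real K)\<bar>"
    proof -
      have "\<bar>ln (1 + alpha * c2 i w) - ln (1 + alpha * (1 - real i / real K))\<bar>
         \<le> \<bar>(1 + alpha * c2 i w) - (1 + alpha * (1 - real i / real K))\<bar>"
        by (rule abs_ln_diff_le) (use alpha0 c2_nonneg[of i w] i1 in auto)
      also have "\<dots> = alpha * \<bar>c2 i w - (1 - real i / real K)\<bar>"
        using alpha0 by (simp add: right_diff_distrib[symmetric] abs_mult)
      also have "alpha \<le> S1"
      proof -
        have "alpha \<le> \<mu> / 1" unfolding alpha_def using b1_ge \<mu>0 by (intro divide_left_mono) auto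
        thus ?thesis using S1 by simp
      qed
      finally show ?thesis by (simp add: mult_right_mono)
    qed
    have L4: "\<bar>ln (nrf i w) - ln (b1 + \<mu>)\<bar> \<le> \<bar>nrf i w - (b1 + \<mu>)\<bar>" by (rule abs_ln_diff_le[OF n1 b\<mu>])
    have L5: "\<bar>ln (den i w) - ln D0\<bar> \<le> \<bar>den i w - D0\<bar>" by (rule abs_ln_diff_le[OF d1 D01])
    define A1 A2 A3 A5 A6 where "A1 = p * \<bar>Nh i w - real K\<bar>" and "A2 = p * real K * (D - d i w)"
      and "A3 = p * real K * \<bar>Zs i w - \<zeta>\<bar>" and "A5 = p * real K * eps i w" and "A6 = \<bar>c2 i w - (1 - real i / real K)\<bar>"
    have A0: "0 \<le> A1" "0 \<le> A2" "0 \<le> A3" "0 \<le> A5" "0 \<le> A6"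
      using p0 elim(4) by (simp_all add: A1_def A2_def A3_def A5_def A6_def eps_def)
    define n where "n = \<bar>nrf i w - (b1 + \<mu>)\<bar>"
    have n: "n \<le> A1 + A2 + A3 + p" using elim(1) by (simp add: n_def A1_def A2_def A3_def)
    have dd: "\<bar>den i w - D0\<bar> \<le> S1 * n + 2 * S1 * A1 + 3 * S1 * A5 + S1 * A2"
      using elim(2) by (simp add: D0_def \<tau>_def n_def A1_def A2_def A5_def)
    have Sn: "S1 * n \<le> S1 * (A1 + A2 + A3 + p)" using n S1 by (intro mult_left_mono) auto
    have "\<bar>ln (nrf i w / den i w) - ln (1 + alpha * (1 - real i / real K))\<bar> \<le> n + \<bar>den i w - D0\<bar> + S1 * A6"
      using L1 L2 L3 L4 L5 unfolding n_def A6_def by linarith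
    also have "\<dots> \<le> (A1 + A2 + A3 + p) + (S1 * (A1 + A2 + A3 + p) + 2 * S1 * A1 + 3 * S1 * A5 + S1 * A2) + S1 * A6"
      using n dd Sn by linarith
    \<comment> \<open>The coefficient 1 + 3 * S1 is that of A1, which occurs in the bound for nr and
      in both uses within the bound for the denominator.\<close>
    also have "\<dots> \<le> (1 + 3 * S1) * (A1 + A2 + A3 + p + A5 + A6)"
    proof -
      have nn: "0 \<le> S1 * A1" "0 \<le> S1 * A2" "0 \<le> S1 * A3" "0 \<le> S1 * p" "0 \<le> S1 * A5" "0 \<le> S1 * A6"
        using S1 A0 p0 by simp_all
      have "(1 + 3 * S1) * (A1 + A2 + A3 + p + A5 + A6) - ((A1 + A2 + A3 + p) + (S1 * (A1 + A2 + A3 + p) + 2 * S1 * A1 + 3 * S1 * A5 + S1 * A2) + S1 * A6)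
        = A5 + A6 + S1 * A2 + 2 * (S1 * A3) + 2 * (S1 * p) + 2 * (S1 * A6)"
        by (simp add: algebra_simps)
      thus ?thesis using nn A0 by linarith
    qed
    finally show ?case by (simp add: Err_def A1_def A2_def A3_def A5_def A6_def)
  qed
qed

section \<open>Expected size of the error terms\<close>

lemma Nh_measurable [measurable]: "i < K \<Longrightarrow> Nh i \<in> borel_measurable M"
  unfolding Nh_def[abs_def] by measurable

lemma E_Nh:
  assumes i: "i < K"
  shows "integrable M (\<lambda>w. Nh i w - real K)" "(\<integral>w. \<bar>Nh i w - real K\<bar> \<partial>M) \<le> sqrt (real K)"
proof -
  note [measurable] = Nh_measurable[OF i]
  have m: "(\<lambda>w. Nh i w - real K) \<in> borel_measurable M" by measurable
  have v: "(\<integral>\<^sup>+w. ennreal ((Nh i w - real K)\<^sup>2) \<partial>M) \<le> ennreal (real K)"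
    unfolding Nh_def using nn_integral_norm_var[OF i] by simp
  show "integrable M (\<lambda>w. Nh i w - real K)" "(\<integral>w. \<bar>Nh i w - real K\<bar> \<partial>M) \<le> sqrt (real K)"
    using expectation_abs_le_sqrt[OF m v] by auto
qed

lemma Zs_measurable [measurable]: "i < K \<Longrightarrow> Zs i \<in> borel_measurable M"
proof -
  assume i: "i < K"
  have "(\<lambda>w. cip K (($) (e i w)) (om w j)) \<in> borel_measurable M" if "j < s" for j
    by (rule measurable_cip) (use i that sK in auto)
  thus ?thesis unfolding Zs_def[abs_def]
    by (intro borel_measurable_sum borel_measurable_power borel_measurable_norm) auto
qed

lemma E_Zs:
  assumes i: "i < s"
  shows "integrable M (\<lambda>w. Zs i w - \<zeta>)" "(\<integral>w. \<bar>Zs i w - \<zeta>\<bar> \<partial>M) \<le> sqrt (1 / (real K - 1))"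
proof -
  have iK: "i < K" using i sK by simp
  note [measurable] = Zs_measurable[OF iK]
  have m: "(\<lambda>w. Zs i w - \<zeta>) \<in> borel_measurable M" by measurable
  have v: "(\<integral>\<^sup>+w. ennreal ((Zs i w - \<zeta>)\<^sup>2) \<partial>M) \<le> ennreal (1 / (real K - 1))"
    unfolding Zs_def \<zeta>_def by (rule e_frame_variance[OF i sK])
  show "integrable M (\<lambda>w. Zs i w - \<zeta>)" "(\<integral>w. \<bar>Zs i w - \<zeta>\<bar> \<partial>M) \<le> sqrt (1 / (real K - 1))"
    using expectation_abs_le_sqrt[OF m v] K2 by auto
qed

lemma E_c2:
  assumes i: "i < K"
  shows "integrable M (\<lambda>w. c2 i w - (1 - real i / real K))" "(\<integral>w. \<bar>c2 i w - (1 - real i / real K)\<bar> \<partial>M) \<le> sqrt (1 / real K)"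
proof -
  note [measurable] = c2_measurable[OF i]
  have m: "(\<lambda>w. c2 i w - (1 - real i / real K)) \<in> borel_measurable M" by measurable
  have "(\<integral>\<^sup>+w. ennreal ((c2 i w - (1 - real i / real K))\<^sup>2) \<partial>M)
     = (\<integral>\<^sup>+w. ennreal (((\<Sum>l<i. (cmod (cip K (($) (hh i w)) (om w l)))\<^sup>2) - real i / real K)\<^sup>2) \<partial>M)"
  proof (rule nn_integral_cong_AE, use hh_unit[OF i] in eventually_elim)
    case (elim w)
    have "c2 i w - (1 - real i / real K) = - ((\<Sum>l<i. (cmod (cip K (($) (hh i w)) (om w l)))\<^sup>2) - real i / real K)"
      unfolding c2_eq[OF elim] v_def by simp
    thus ?case by (simp only: power2_minus)
  qed
  also have "\<dots> \<le> ennreal (1 / real K)" by (rule hh_frame_variance[OF i])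
  finally have v: "(\<integral>\<^sup>+w. ennreal ((c2 i w - (1 - real i / real K))\<^sup>2) \<partial>M) \<le> ennreal (1 / real K)" .
  show "integrable M (\<lambda>w. c2 i w - (1 - real i / real K))" "(\<integral>w. \<bar>c2 i w - (1 - real i / real K)\<bar> \<partial>M) \<le> sqrt (1 / real K)"
    using expectation_abs_le_sqrt[OF m v] by auto
qed

text \<open>The vector xv as a function of the tuple of quantized directions, as e_cip_bound requires.\<close>
definition xH :: "nat \<Rightarrow> (nat \<Rightarrow> cvec) \<Rightarrow> nat \<Rightarrow> complex" where
  "xH i H = (let c = sqn K (gsv K (\<lambda>l. ($) (H l)) i); b = p * gain * sqrt c / (b1 + p * gain * c)
     in (\<lambda>l. \<Sum>j<Suc i. (if j = i then 1 else of_real b * cip K (($) (H i)) (omH H j)) * omH H j l))"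

lemma xH_Hv: assumes i: "i < K" shows "xH i (Hv w) = xv i w"
proof -
  have o: "omH (Hv w) j = om w j" if "j < Suc i" for j using that i by (intro omH_Hv) simp
  have "gsv K (\<lambda>l. ($) (Hv w l)) i = gsv K (\<lambda>l. ($) (hh l w)) i"
    using i by (intro gsv_cong) (simp add: Hv_def)
  moreover have "Hv w i = hh i w" using i by (simp add: Hv_def)
  ultimately show ?thesis
    unfolding xH_def xv_def Let_def gcoef_def v_def c2_def[symmetric] bet_def[symmetric]
    by (intro ext sum.cong refl) (simp add: o c2_def[symmetric] bet_def[symmetric])
qed

lemma xH_measurable: assumes i: "i < K" and k: "k < K" shows "(\<lambda>H. xH i H k) \<in> borel_measurable PH"
proof -
  note [measurable] = gsvH_measurable[OF i]
  have [measurable]: "(\<lambda>H. sqn K (gsv K (\<lambda>l. ($) (H l)) i)) \<in> borel_measurable PH"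
    by (rule measurable_sqn) measurable
  have [measurable]: "(\<lambda>H. cip K (($) (H i)) (omH H j)) \<in> borel_measurable PH" if "j < K" for j
    by (rule measurable_cip) (use i that in measurable)
  show ?thesis unfolding xH_def Let_def
  proof (rule borel_measurable_sum)
    fix j assume "j \<in> {..<Suc i}"
    hence j: "j < K" using i by simp
    note [measurable] = omH_measurable[OF j k]
    show "(\<lambda>H. (if j = i then 1 else of_real (p * gain * sqrt (sqn K (gsv K (\<lambda>l. ($) (H l)) i)) / (b1 + p * gain * sqn K (gsv K (\<lambda>l. ($) (H l)) i))) * cip K (($) (H i)) (omH H j)) * omH H j k) \<in> borel_measurable PH"
      using j omH_measurable[OF i k] by (cases "j = i") simp_all
  qed
qed

lemma xv_measurable [measurable]: "i < K \<Longrightarrow> k < K \<Longrightarrow> (\<lambda>w. xv i w k) \<in> borel_measurable M"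
  using measurable_compose[OF Hv_measurable xH_measurable[of i k]] by (simp add: xH_Hv)

lemma E_eps:
  assumes i: "i < K"
  shows "integrable M (eps i)" "(\<integral>w. eps i w \<partial>M) \<le> sqrt (S1 / (real K - 1))"
proof -
  have [measurable]: "(\<lambda>w. cip K (($) (e i w)) (xv i w)) \<in> borel_measurable M"
    by (rule measurable_cip) (use i in auto)
  have m: "eps i \<in> borel_measurable M" unfolding eps_def[abs_def] by measurable
  have B: "AE w in M. sqn K (xH i (Hv w)) \<le> S1"
    using AE_good[OF i] by eventually_elim (simp add: xH_Hv[OF i] sqn_xv[OF i] Sf_le)
  have v: "(\<integral>\<^sup>+w. ennreal ((eps i w)\<^sup>2) \<partial>M) \<le> ennreal (S1 / (real K - 1))"
    using e_cip_bound[of i "xH i", OF i xH_measurable[OF i] B] by (simp add: xH_Hv[OF i] eps_def)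
  have "S1 / (real K - 1) \<ge> 0" using K2 \<mu>0 by (simp add: S1_def)
  from expectation_abs_le_sqrt[OF m v this] show "integrable M (eps i)" "(\<integral>w. eps i w \<partial>M) \<le> sqrt (S1 / (real K - 1))"
    by (simp_all add: eps_def[abs_def])
qed

text \<open>With p of order 1 / K and \<mu> convergent, each summand is O(K^(-1/2)). One of the two
  p comes from \<open>Err\<close> itself, the other from p K (D - E d) = p D.\<close>

definition errK :: real where
  "errK = p * sqrt (real K) + 2 * p + p * real K * sqrt (1 / (real K - 1)) + p * real K * sqrt (S1 / (real K - 1)) + sqrt (1 / real K)"

lemma E_Err:
  assumes i: "i < s"
  shows "integrable M (Err i)" "(\<integral>w. Err i w \<partial>M) \<le> errK"
proof -
  have iK: "i < K" using i sK by simp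
  note i1 = E_Nh[OF iK] and i2 = E_Zs[OF i] and i3 = E_c2[OF iK] and i4 = E_eps[OF iK] and i5 = integral_d[OF iK]
  have a: "integrable M (\<lambda>w. \<bar>Nh i w - real K\<bar>)" "integrable M (\<lambda>w. D - d i w)" "integrable M (\<lambda>w. \<bar>Zs i w - \<zeta>\<bar>)"
    "integrable M (\<lambda>w. \<bar>c2 i w - (1 - real i / real K)\<bar>)"
    using integrable_abs[OF i1(1)] integrable_abs[OF i2(1)] integrable_abs[OF i3(1)] i5(1) by auto
  have a': "integrable M (\<lambda>w. p * \<bar>Nh i w - real K\<bar>)" "integrable M (\<lambda>w. p * real K * (D - d i w))" "integrable M (\<lambda>w. p * real K * \<bar>Zs i w - \<zeta>\<bar>)"
    "integrable M (\<lambda>w. p)" "integrable M (\<lambda>w. p * real K * eps i w)"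
    using a i4(1) by (auto intro: integrable_mult_right)
  note b1' = Bochner_Integration.integrable_add[OF a'(1,2)]
  note b2' = Bochner_Integration.integrable_add[OF b1' a'(3)]
  note b3' = Bochner_Integration.integrable_add[OF b2' a'(4)]
  note b4' = Bochner_Integration.integrable_add[OF b3' a'(5)]
  note b5' = Bochner_Integration.integrable_add[OF b4' a(4)]
  show "integrable M (Err i)" unfolding Err_def[abs_def] by (rule b5')
  have "(\<integral>w. Err i w \<partial>M) = p * (\<integral>w. \<bar>Nh i w - real K\<bar> \<partial>M) + p * real K * (\<integral>w. D - d i w \<partial>M) + p * real K * (\<integral>w. \<bar>Zs i w - \<zeta>\<bar> \<partial>M) + p
     + p * real K * (\<integral>w. eps i w \<partial>M) + (\<integral>w. \<bar>c2 i w - (1 - real i / real K)\<bar> \<partial>M)"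
    unfolding Err_def Bochner_Integration.integral_add[OF b4' a(4)] Bochner_Integration.integral_add[OF b3' a'(5)]
      Bochner_Integration.integral_add[OF b2' a'(4)] Bochner_Integration.integral_add[OF b1' a'(3)] Bochner_Integration.integral_add[OF a'(1,2)]
    by (simp only: integral_mult_right_zero) (simp add: prob_space)
  also have "(\<integral>w. D - d i w \<partial>M) = D / real K"
    using i5 K2 by (simp add: prob_space of_nat_diff field_simps)
  also have "p * real K * (D / real K) \<le> p" using p0 D_le_1 K2 by simp
  also have "p * (\<integral>w. \<bar>Nh i w - real K\<bar> \<partial>M) \<le> p * sqrt (real K)" using i1(2) p0 by simp
  also have "p * real K * (\<integral>w. \<bar>Zs i w - \<zeta>\<bar> \<partial>M) \<le> p * real K * sqrt (1 / (real K - 1))"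
    using i2(2) p0 by (intro mult_left_mono) auto
  also have "p * real K * (\<integral>w. eps i w \<partial>M) \<le> p * real K * sqrt (S1 / (real K - 1))"
    using i4(2) p0 by (intro mult_left_mono) auto
  also note i3(2)
  finally show "(\<integral>w. Err i w \<partial>M) \<le> errK" by (simp add: errK_def)
qed

text \<open>The matrix products are written out but \<open>W\<close> is kept. This form equals the
  integrand of the rate at every outcome and is measurable, as \<open>rce_cong\<close> requires,
  whereas the closed form of W_i holds only almost surely.\<close>

definition Iw :: "nat \<Rightarrow> 'w \<Rightarrow> real" where
  "Iw i w = log 2 (nrf i w / (nrf i w * (1 + (\<Sum>k<i. (cmod (Z.W i w $$ (0, k)))\<^sup>2))
     - p * (cmod (cip K (($) (h i w)) (\<lambda>l. om w i l + (\<Sum>k<i. cnj (Z.W i w $$ (0, k)) * om w k l))))\<^sup>2))"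

lemma Iw_eq:
  assumes w: "w \<in> space M" and i: "i < K"
  shows "log 2 (Z.nr i w / (Z.nr i w * (1 + (Z.W_norm i w)\<^sup>2) - P / real s * (cmod (Z.signal_term i w))\<^sup>2)) = Iw i w"
proof -
  have nr: "Z.nr i w = nrf i w" using nr_eq[OF w i] by (simp add: nrf_def)
  note Wc = W_carrier[of i w]
  have Wd: "dim_row (Z.W i w) = 1" "dim_col (Z.W i w) = i" using Wc by auto
  have Wn: "(Z.W_norm i w)\<^sup>2 = (\<Sum>k<i. (cmod (Z.W i w $$ (0, k)))\<^sup>2)"
  proof -
    have rc: "Matrix.row (Z.W i w) 0 \<in> carrier_vec i" by (rule row_carrier_vec[OF _ Wc]) simp
    have r: "Matrix.row (Z.W i w) 0 $ k = Z.W i w $$ (0, k)" if "k < i" for k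
      by (rule index_row(1)) (simp_all only: Wd that zero_less_one)
    have "(Z.W_norm i w)\<^sup>2 = sqn i (($) (Matrix.row (Z.W i w) 0))"
      unfolding Z.W_norm_def by (rule cvec_norm_sq[OF rc])
    also have "\<dots> = (\<Sum>k<i. (cmod (Z.W i w $$ (0, k)))\<^sup>2)"
      unfolding sqn_def by (rule sum.cong) (simp_all only: r lessThan_iff)
    finally show ?thesis .
  qed
  have hc: "Z.h_col i w \<in> carrier_mat K 1" unfolding Z.h_col_def by (rule carrier_matI) simp_all
  have oc: "Z.omega_col i w \<in> carrier_mat K 1" unfolding Z.omega_col_def by (rule carrier_matI) simp_all
  have ob: "Z.omega_before i w \<in> carrier_mat K i"
    unfolding Z.omega_before_def by (rule carrier_matI) simp_all
  have oW: "Z.omega_before i w * mat_adjoint (Z.W i w) \<in> carrier_mat K 1" by (rule mult_carrier_mat[OF ob mat_adjoint_carrier[OF Wc]])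
  have "Z.signal_term i w = (\<Sum>l<K. mat_adjoint (Z.h_col i w) $$ (0, l) * (Z.omega_col i w + Z.omega_before i w * mat_adjoint (Z.W i w)) $$ (l, 0))"
    unfolding Z.signal_term_def
    by (rule index_mult_sum[OF mat_adjoint_carrier[OF hc] add_carrier_mat[OF oW]]) auto
  also have "\<dots> = (\<Sum>l<K. cnj (h i w $ l) * (om w i l + (\<Sum>k<i. cnj (Z.W i w $$ (0, k)) * om w k l)))"
  proof (rule sum.cong[OF refl])
    fix l assume "l \<in> {..<K}"
    hence l: "l < K" by simp
    have 1: "mat_adjoint (Z.h_col i w) $$ (0, l) = cnj (h i w $ l)"
      using l hc h_carrier[OF i w] by (subst mat_adjoint_index) (auto simp: Z.h_col_def mat_of_cols_index')
    have 2: "Z.omega_col i w $$ (l, 0) = om w i l"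
      using l omega_carrier[OF w i] omega_om[OF w i l] by (simp add: Z.omega_col_def mat_of_cols_index')
    have "(Z.omega_before i w * mat_adjoint (Z.W i w)) $$ (l, 0) = (\<Sum>k<i. Z.omega_before i w $$ (l, k) * mat_adjoint (Z.W i w) $$ (k, 0))"
      by (rule index_mult_sum[OF ob mat_adjoint_carrier[OF Wc] l]) simp
    also have "\<dots> = (\<Sum>k<i. cnj (Z.W i w $$ (0, k)) * om w k l)"
    proof (rule sum.cong[OF refl])
      fix k assume "k \<in> {..<i}"
      hence k: "k < i" by simp
      have "set (map (\<lambda>j. Z.omega j w) [0..<i]) \<subseteq> carrier_vec K" using omega_carrier[OF w] i by auto
      hence "Z.omega_before i w $$ (l, k) = om w k l"
        using k l i omega_om[OF w, of k l] by (simp add: Z.omega_before_def mat_of_cols_index')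
      thus "Z.omega_before i w $$ (l, k) * mat_adjoint (Z.W i w) $$ (k, 0) = cnj (Z.W i w $$ (0, k)) * om w k l"
        using k Wd by (simp add: mat_adjoint_index)
    qed
    finally show "mat_adjoint (Z.h_col i w) $$ (0, l) * (Z.omega_col i w + Z.omega_before i w * mat_adjoint (Z.W i w)) $$ (l, 0)
      = cnj (h i w $ l) * (om w i l + (\<Sum>k<i. cnj (Z.W i w $$ (0, k)) * om w k l))"
      using l oW oc by (subst index_add_mat) (auto simp: 1 2)
  qed
  also have "\<dots> = cnj (cip K (($) (h i w)) (\<lambda>l. om w i l + (\<Sum>k<i. cnj (Z.W i w $$ (0, k)) * om w k l)))"
    by (simp add: cip_def)
  finally have sg: "cmod (Z.signal_term i w) = cmod (cip K (($) (h i w)) (\<lambda>l. om w i l + (\<Sum>k<i. cnj (Z.W i w $$ (0, k)) * om w k l)))"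
    by (simp only: complex_mod_cnj)
  show ?thesis unfolding nr Wn sg Iw_def p_def ..
qed

lemma Iw_measurable: assumes i: "i < K" shows "Iw i \<in> borel_measurable M"
proof -
  note [measurable] = nrf_measurable[OF i] rv_h[OF i]
  have w [measurable]: "(\<lambda>w. Z.W i w $$ (0, k)) \<in> borel_measurable M" if "k < i" for k using W_measurable[OF i that] .
  have 1 [measurable]: "(\<lambda>w. \<Sum>k<i. (cmod (Z.W i w $$ (0, k)))\<^sup>2) \<in> borel_measurable M"
    by (intro borel_measurable_sum borel_measurable_power borel_measurable_norm w) auto
  have y: "(\<lambda>w. om w i l + (\<Sum>k<i. cnj (Z.W i w $$ (0, k)) * om w k l)) \<in> borel_measurable M" if l: "l < K" for l
    by (intro borel_measurable_add borel_measurable_sum borel_measurable_times om_measurable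
        measurable_compose[OF w, of _ cnj] borel_measurable_continuous_onI continuous_intros)
       (use i l in auto)
  have [measurable]: "(\<lambda>w. cip K (($) (h i w)) (\<lambda>l. om w i l + (\<Sum>k<i. cnj (Z.W i w $$ (0, k)) * om w k l))) \<in> borel_measurable M"
    by (rule measurable_cip) (use i y in auto)
  show ?thesis unfolding Iw_def[abs_def] by measurable
qed

lemma Iw_ae:
  assumes i: "i < s"
  shows "AE w in M. Iw i w = ln (nrf i w / den i w) / ln 2"
proof -
  have iK: "i < K" using i sK by simp
  show ?thesis using W_eq[OF i] AE_good[OF iK]
  proof eventually_elim
    case (elim w)
    have 1: "1 + (\<Sum>k<i. (cmod (Z.W i w $$ (0, k)))\<^sup>2) = Sf i w"
    proof -
      have "(\<Sum>k<i. (cmod (Z.W i w $$ (0, k)))\<^sup>2) = (\<Sum>k<i. (bet i w)\<^sup>2 * (cmod (v i w k))\<^sup>2)"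
        using elim(1) by (intro sum.cong) (auto simp: norm_mult power_mult_distrib)
      thus ?thesis using sum_v[OF elim(2)] by (simp add: Sf_def sum_distrib_left[symmetric])
    qed
    have 2: "(\<lambda>l. om w i l + (\<Sum>k<i. cnj (Z.W i w $$ (0, k)) * om w k l)) = xv i w"
    proof
      fix l
      have "(\<Sum>k<i. cnj (Z.W i w $$ (0, k)) * om w k l) = (\<Sum>k<i. gcoef i w k * om w k l)"
        using elim(1) by (intro sum.cong) (auto simp: gcoef_def)
      thus "om w i l + (\<Sum>k<i. cnj (Z.W i w $$ (0, k)) * om w k l) = xv i w l"
        by (simp add: xv_def gcoef_def)
    qed
    show ?case unfolding Iw_def 1 2 den_def log_def ..
  qed
qed

text \<open>The integrable bound on the deviation makes the logarithm integrable. The conditional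
  expectation then disappears under the outer integral.\<close>

lemma rate_approx:
  assumes i: "i < s"
  shows "\<bar>Z.rate i - ln (1 + alpha * (1 - real i / real K)) / ln 2\<bar> \<le> (1 + 3 * S1) * errK / ln 2"
proof -
  have iK: "i < K" using i sK by simp
  define L where "L = ln (1 + alpha * (1 - real i / real K))"
  have l2: "ln 2 > (0::real)" by simp
  have S1: "0 \<le> S1" using \<mu>0 by (simp add: S1_def)
  note m = Iw_measurable[OF iK]
  have dev: "AE w in M. \<bar>Iw i w - L / ln 2\<bar> \<le> (1 + 3 * S1) * Err i w / ln 2"
    using Iw_ae[OF i] ln_ratio_dev[OF i]
  proof eventually_elim
    case (elim w)
    have "\<bar>Iw i w - L / ln 2\<bar> = \<bar>ln (nrf i w / den i w) - L\<bar> / ln 2"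
      unfolding elim(1) diff_divide_distrib[symmetric] abs_divide by simp
    also have "\<dots> \<le> (1 + 3 * S1) * Err i w / ln 2"
      using elim(2) l2 by (intro divide_right_mono) (auto simp: L_def)
    finally show ?case .
  qed
  have bi: "integrable M (\<lambda>w. (1 + 3 * S1) * Err i w / ln 2)" using E_Err(1)[OF i] by auto
  have di: "integrable M (\<lambda>w. Iw i w - L / ln 2)"
  proof (rule Bochner_Integration.integrable_bound[OF bi])
    show "AE w in M. norm (Iw i w - L / ln 2) \<le> norm ((1 + 3 * S1) * Err i w / ln 2)"
      using dev by eventually_elim (unfold real_norm_def, rule order_trans[OF _ abs_ge_self])
  qed (use m in measurable)
  hence "integrable M (\<lambda>w. (Iw i w - L / ln 2) + L / ln 2)" by (intro Bochner_Integration.integrable_add) auto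
  hence Ii: "integrable M (Iw i)" by simp
  have "Z.rate i = (\<integral>w. real_cond_exp M sgm (Iw i) w \<partial>M)"
    unfolding Z.rate_def sigma_hh_sgm
  proof (rule integral_cong_AE)
    show "AE w in M. real_cond_exp M sgm (\<lambda>w. log 2 (Z.nr i w / (Z.nr i w * (1 + (Z.W_norm i w)\<^sup>2) - P / real s * (cmod (Z.signal_term i w))\<^sup>2))) w
       = real_cond_exp M sgm (Iw i) w"
      by (rule rce_cong[OF Iw_eq[OF _ iK] m])
  qed (auto intro: borel_measurable_cond_exp2)
  also have "\<dots> = (\<integral>w. Iw i w \<partial>M)" by (rule F.real_cond_exp_int(2)[OF Ii])
  finally have "Z.rate i - L / ln 2 = (\<integral>w. Iw i w - L / ln 2 \<partial>M)"
    using Ii by (simp add: prob_space)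
  hence "\<bar>Z.rate i - L / ln 2\<bar> \<le> (\<integral>w. \<bar>Iw i w - L / ln 2\<bar> \<partial>M)"
    using integral_abs_bound[of M "\<lambda>w. Iw i w - L / ln 2"] by simp
  also have "\<dots> \<le> (\<integral>w. (1 + 3 * S1) * Err i w / ln 2 \<partial>M)"
    by (rule integral_mono_AE[OF integrable_abs[OF di] bi dev])
  also have "\<dots> = (1 + 3 * S1) * (\<integral>w. Err i w \<partial>M) / ln 2" by simp
  also have "\<dots> \<le> (1 + 3 * S1) * errK / ln 2"
    using E_Err(2)[OF i] S1 by (intro divide_right_mono mult_left_mono) auto
  finally show ?thesis by (simp add: L_def)
qed

end

subsection \<open>Passage to the limit\<close>

lemma ln_affine_lipschitz:
  fixes a b y :: real
  assumes "0 \<le> a" "0 \<le> b" "0 \<le> y" "y \<le> 1"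
  shows "\<bar>ln (1 + a * y) - ln (1 + b * y)\<bar> \<le> \<bar>a - b\<bar>"
proof -
  have "\<bar>ln (1 + a * y) - ln (1 + b * y)\<bar> \<le> \<bar>(1 + a * y) - (1 + b * y)\<bar>"
    by (rule abs_ln_diff_le) (use assms in auto)
  also have "\<dots> = \<bar>a - b\<bar> * y" using assms by (simp add: left_diff_distrib[symmetric] abs_mult)
  also have "\<dots> \<le> \<bar>a - b\<bar> * 1" using assms by (intro mult_left_mono) auto
  finally show ?thesis by simp
qed

text \<open>By the mean value theorem for the antiderivative G, each cell of length 1 / K has error
  at most L / K^2, and there are at most K cells. The end point s K / K moves with K, which
  continuity of G absorbs.\<close>

lemma riemann_sum_left:
  fixes g :: "real \<Rightarrow> real" and s :: "nat \<Rightarrow> nat"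
  assumes lip: "\<And>x y. x \<in> {0..1} \<Longrightarrow> y \<in> {0..1} \<Longrightarrow> \<bar>g x - g y\<bar> \<le> L * \<bar>x - y\<bar>"
    and s: "\<And>K. K \<ge> 1 \<Longrightarrow> s K \<le> K" and lim: "(\<lambda>K. real (s K) / real K) \<longlonglongrightarrow> sb"
    and sb: "0 \<le> sb" "sb \<le> 1"
  shows "(\<lambda>K. 1 / real K * (\<Sum>i<s K. g (real i / real K))) \<longlonglongrightarrow> integral {0..sb} g"
proof -
  have cont: "continuous_on {0..1} g"
  proof (rule continuous_onI)
    fix x e :: real assume x: "x \<in> {0..1}" and e: "e > 0"
    show "\<exists>d>0. \<forall>x'\<in>{0..1}. dist x' x < d \<longrightarrow> dist (g x') (g x) \<le> e"
    proof (intro exI conjI ballI impI)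
      show "e / (\<bar>L\<bar> + 1) > 0" using e by simp
      fix x' assume x': "x' \<in> {0..1}" "dist x' x < e / (\<bar>L\<bar> + 1)"
      have "\<bar>g x' - g x\<bar> \<le> L * \<bar>x' - x\<bar>" by (rule lip[OF x'(1) x])
      also have "\<dots> \<le> (\<bar>L\<bar> + 1) * \<bar>x' - x\<bar>" by (intro mult_right_mono) auto
      also have "\<dots> \<le> e" using x'(2) by (simp add: dist_real_def field_simps)
      finally show "dist (g x') (g x) \<le> e" by (simp add: dist_real_def)
    qed
  qed
  define G where "G x = integral {0..x} g" for x
  have Gd: "(G has_real_derivative g x) (at x within {0..1})" if "x \<in> {0..1}" for x
    unfolding G_def by (rule integral_has_real_derivative[OF cont that])
  have Gc: "continuous_on {0..1} G" by (rule DERIV_continuous_on[OF Gd])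
  have L0: "0 \<le> L" using lip[of 0 1] by simp
  have step: "\<bar>(G y - G x) - (y - x) * g x\<bar> \<le> (y - x) * (L * (y - x))" if xy: "0 \<le> x" "x \<le> y" "y \<le> 1" for x y
  proof (cases "x = y")
    case False
    hence lt: "x < y" using xy by simp
    have d: "(G has_derivative (*) (g z)) (at z within {x..y})" if "x \<le> z" "z \<le> y" for z
      by (rule has_derivative_subset[OF Gd[unfolded has_field_derivative_def, of z]]) (use that xy in auto)
    obtain z where z: "z \<in> {x..y}" "G y - G x = (y - x) * g z"
      using mvt_very_simple[OF xy(2) d] by (auto simp: mult.commute)
    have "\<bar>(G y - G x) - (y - x) * g x\<bar> = (y - x) * \<bar>g z - g x\<bar>"
      unfolding z(2) using lt by (simp add: right_diff_distrib[symmetric] abs_mult)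
    also have "\<dots> \<le> (y - x) * (L * \<bar>z - x\<bar>)" using lip[of z x] z(1) xy lt by (intro mult_left_mono) auto
    also have "\<dots> \<le> (y - x) * (L * (y - x))" using z(1) lt L0 by (intro mult_left_mono) auto
    finally show ?thesis .
  qed simp
  have G0: "G 0 = 0" by (simp add: G_def)
  have dev: "\<bar>G (real (s K) / real K) - 1 / real K * (\<Sum>i<s K. g (real i / real K))\<bar> \<le> L / real K" if K: "K \<ge> 1" for K
  proof -
    have tel: "G (real n / real K) = (\<Sum>i<n. G (real (Suc i) / real K) - G (real i / real K))" for n
      using sum_lessThan_telescope[of "\<lambda>i. G (real i / real K)" n] G0 by simp
    have "G (real (s K) / real K) - 1 / real K * (\<Sum>i<s K. g (real i / real K))
       = (\<Sum>i<s K. (G (real (Suc i) / real K) - G (real i / real K)) - 1 / real K * g (real i / real K))"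
      by (simp only: tel[of "s K"] sum_subtractf sum_distrib_left)
    hence "\<bar>G (real (s K) / real K) - 1 / real K * (\<Sum>i<s K. g (real i / real K))\<bar>
       \<le> (\<Sum>i<s K. \<bar>(G (real (Suc i) / real K) - G (real i / real K)) - 1 / real K * g (real i / real K)\<bar>)"
      by (simp only: sum_abs)
    also have "\<dots> \<le> (\<Sum>i<s K. 1 / real K * (L * (1 / real K)))"
    proof (rule sum_mono)
      fix i assume "i \<in> {..<s K}"
      hence i: "Suc i \<le> K" using s[OF K] by simp
      have e: "real (Suc i) / real K - real i / real K = 1 / real K" using K by (simp add: field_simps)
      have "real (Suc i) / real K \<le> 1" using i K by (simp add: divide_le_eq)
      moreover have "real i / real K \<le> real (Suc i) / real K" by (intro divide_right_mono) auto
      ultimately show "\<bar>(G (real (Suc i) / real K) - G (real i / real K)) - 1 / real K * g (real i / real K)\<bar> \<le> 1 / real K * (L * (1 / real K))"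
        using step[of "real i / real K" "real (Suc i) / real K"] unfolding e by simp
    qed
    also have "\<dots> = real (s K) / real K * (L / real K)" by simp
    also have "\<dots> \<le> 1 * (L / real K)" using s[OF K] K L0 by (intro mult_right_mono) (auto simp: divide_le_eq)
    finally show ?thesis by simp
  qed
  have "(\<lambda>K. G (real (s K) / real K)) \<longlonglongrightarrow> G sb"
  proof (rule continuous_on_tendsto_compose[OF Gc lim])
    show "sb \<in> {0..1}" using sb by simp
    show "\<forall>\<^sub>F K in sequentially. real (s K) / real K \<in> {0..1}"
      by (rule eventually_sequentiallyI[of 1]) (use s in \<open>auto simp: divide_le_eq\<close>)
  qed
  moreover have "(\<lambda>K. G (real (s K) / real K) - 1 / real K * (\<Sum>i<s K. g (real i / real K))) \<longlonglongrightarrow> 0"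
  proof (rule Lim_null_comparison)
    show "\<forall>\<^sub>F K in sequentially. norm (G (real (s K) / real K) - 1 / real K * (\<Sum>i<s K. g (real i / real K))) \<le> L / real K"
      by (rule eventually_sequentiallyI[of 1]) (use dev in auto)
    show "(\<lambda>K. L / real K) \<longlonglongrightarrow> 0" by (rule lim_const_over_n)
  qed
  ultimately have "(\<lambda>K. G (real (s K) / real K) - (G (real (s K) / real K) - 1 / real K * (\<Sum>i<s K. g (real i / real K)))) \<longlonglongrightarrow> G sb - 0"
    by (rule tendsto_diff)
  thus ?thesis by (simp add: G_def)
qed

text \<open>With b = B, \<mu> = A and c^2 = 1 - t * sb the integrand of rho is the left side of
  \<open>dpc_denominator_identity\<close>. The term log NR cancels, and the factor sb is the
  Jacobian of y = t * sb.\<close>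

lemma rho_eq:
  fixes P sb rb :: real
  assumes P: "P > 0" and sb: "0 < sb" "sb \<le> 1" and rb: "0 \<le> rb"
  defines "A \<equiv> P / sb * (1 - 2 powr (- rb))" and "B \<equiv> 1 + P * 2 powr (- rb)"
  shows "rho P sb rb = integral {0..sb} (\<lambda>y. ln (1 + A / B * (1 - y))) / ln 2"
proof -
  have "2 powr (- rb) \<le> 1" using powr_mono[of "- rb" 0 2] rb by simp
  hence A: "A \<ge> 0" using P sb by (simp add: A_def)
  have B: "B \<ge> 1" using P by (simp add: B_def)
  define f where "f t = log 2 (NR P sb rb * x_inf P sb rb t -
          P / sb * (1 - 2 powr (- rb)) * (1 - t * sb) *
          (P / sb * (1 - 2 powr (- rb)) * (t * sb) /
             (1 + P / sb * (1 - 2 powr (- rb)) * (1 - t * sb) + P * 2 powr (- rb)) + 1)\<^sup>2)" for t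
  define g where "g y = ln (1 + A / B * (1 - y))" for y
  have NR: "NR P sb rb = B + A" by (simp add: NR_def A_def B_def)
  have ft: "f t = log 2 (B + A) - g (t * sb) / ln 2" if t: "t \<in> {0..1}" for t
  proof -
    define y where "y = t * sb"
    have y: "0 \<le> y" "y \<le> 1" using t sb mult_mono[of t 1 sb 1] by (auto simp: y_def)
    define q where "q = B + A * (1 - y)"
    have q: "q > 0" using A B y by (simp add: q_def add_pos_nonneg)
    define c where "c = sqrt (1 - y)"
    have c2: "c\<^sup>2 = 1 - y" using y by (simp add: c_def)
    have x: "x_inf P sb rb t = 1 + (A * c / q)\<^sup>2 * y"
    proof -
      have "x_inf P sb rb t = 1 + A\<^sup>2 * (1 - y) * y / q\<^sup>2"
        by (simp add: x_inf_def A_def B_def q_def y_def power_mult_distrib power_divide mult_ac)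
      thus ?thesis by (simp add: power_divide power_mult_distrib c2)
    qed
    \<comment> \<open>One factor c is moved into the square, so that the expression matches c + beta
      (1 - c^2) with beta = A c / q.\<close>
    have z: "A * (1 - y) * (A * y / q + 1)\<^sup>2 = A * (c + A * c / q * y)\<^sup>2"
    proof -
      have "c + A * c / q * y = c * (A * y / q + 1)" by (simp add: algebra_simps)
      thus ?thesis by (simp add: power_mult_distrib c2)
    qed
    have q': "1 + A * (1 - y) + P * 2 powr (- rb) = q" by (simp add: q_def B_def)
    have "f t = log 2 ((B + A) * (1 + (A * c / q)\<^sup>2 * y) - A * (c + A * c / q * y)\<^sup>2)"
      unfolding f_def NR x A_def[symmetric] y_def[symmetric] q' z ..
    also have "(B + A) * (1 + (A * c / q)\<^sup>2 * y) - A * (c + A * c / q * y)\<^sup>2 = (B + A) * B / q"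
      using dpc_denominator_identity[of B A c] q unfolding c2 q_def[symmetric] by simp
    also have "log 2 ((B + A) * B / q) = log 2 (B + A) - log 2 (q / B)"
    proof -
      have "(B + A) * B / q = (B + A) / (q / B)" using B q by (simp add: field_simps)
      thus ?thesis using A B q by (simp only:) (rule log_divide_pos, auto)
    qed
    also have "q / B = 1 + A / B * (1 - y)" using B by (simp add: q_def add_divide_distrib)
    finally show ?thesis by (simp add: g_def log_def y_def)
  qed
  have cg: "continuous_on {0..sb} g"
    unfolding g_def using A B sb by (intro continuous_intros) (auto simp: add_pos_nonneg less_imp_neq[symmetric])
  define G where "G x = integral {0..x} g" for x
  have Gd: "(G has_real_derivative g x) (at x within {0..sb})" if "x \<in> {0..sb}" for x
    unfolding G_def by (rule integral_has_real_derivative[OF cg that])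
  \<comment> \<open>The substitution y = t * sb is carried out on the explicit antiderivative G (t *
    sb) / (sb * ln 2).\<close>
  have "((\<lambda>t. log 2 (B + A) - g (t * sb) / ln 2) has_integral
     (log 2 (B + A) * 1 - G (1 * sb) / (sb * ln 2)) - (log 2 (B + A) * 0 - G (0 * sb) / (sb * ln 2))) {0..1}"
  proof (rule fundamental_theorem_of_calculus)
    fix t :: real assume t: "t \<in> {0..1}"
    have ts: "t * sb \<in> {0..sb}" using t sb by (auto simp: mult_le_cancel_right1)
    have img: "(\<lambda>t. t * sb) ` {0..1} \<subseteq> {0..sb}" using sb by (auto simp: mult_le_cancel_right1)
    have lin: "((\<lambda>t. t * sb) has_real_derivative sb) (at t within {0..1})" by (auto intro!: derivative_eq_intros)
    have "((\<lambda>t. G (t * sb)) has_real_derivative g (t * sb) * sb) (at t within {0..1})"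
      using DERIV_image_chain[OF has_field_derivative_subset[OF Gd[OF ts] img] lin]
      by (simp add: comp_def)
    hence "((\<lambda>t. log 2 (B + A) * t - G (t * sb) / (sb * ln 2)) has_real_derivative log 2 (B + A) * 1 - g (t * sb) * sb / (sb * ln 2)) (at t within {0..1})"
      by (intro DERIV_diff DERIV_cmult DERIV_cdivide DERIV_ident)
    thus "((\<lambda>t. log 2 (B + A) * t - G (t * sb) / (sb * ln 2)) has_vector_derivative log 2 (B + A) - g (t * sb) / ln 2) (at t within {0..1})"
      using sb by (simp add: has_real_derivative_iff_has_vector_derivative)
  qed simp
  hence "((\<lambda>t. log 2 (B + A) - g (t * sb) / ln 2) has_integral log 2 (B + A) - G sb / (sb * ln 2)) {0..1}"
    by (simp add: G_def)
  hence "(f has_integral log 2 (B + A) - G sb / (sb * ln 2)) {0..1}"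
    by (rule has_integral_eq[rotated]) (simp add: ft)
  hence I: "integral {0..1} f = log 2 (B + A) - G sb / (sb * ln 2)" by (rule integral_unique)
  have "rho P sb rb = sb * (log 2 (NR P sb rb) - integral {0..1} f)" unfolding rho_def f_def[abs_def] ..
  also have "\<dots> = sb * (log 2 (B + A) - (log 2 (B + A) - G sb / (sb * ln 2)))" by (simp only: NR I)
  also have "\<dots> = G sb / ln 2" using sb by simp
  finally show ?thesis unfolding G_def g_def[abs_def] .
qed

theorem mainTheorem1:
  fixes P rbar sbar :: real
    and r :: "nat \<Rightarrow> real"
    and s :: "nat \<Rightarrow> nat"
    and M :: "nat \<Rightarrow> 'w measure"
    and h hh e :: "nat \<Rightarrow> nat \<Rightarrow> 'w \<Rightarrow> cvec"
  assumes "P > 0" and "rbar \<ge> 0" and "0 < sbar" and "sbar \<le> 1"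
    and "\<And>K. K \<ge> 2 \<Longrightarrow> r K \<ge> 0"
    and "\<And>K. K \<ge> 2 \<Longrightarrow> 1 \<le> s K \<and> s K \<le> K"
    and "\<And>K. K \<ge> 2 \<Longrightarrow> qub_feedback (M K) K (r K) (h K) (hh K) (e K)"
    and "(\<lambda>K. r K / real K) \<longlonglongrightarrow> rbar"
    and "(\<lambda>K. real (s K) / real K) \<longlonglongrightarrow> sbar"
  shows "(\<lambda>K. 1 / real K * (\<Sum>i<s K. zf_dpc.rate (M K) K (s K) P (h K) (hh K) i))
           \<longlonglongrightarrow> rho P sbar rbar"
proof -
  define q where "q = 2 powr (- rbar)"
  define A where "A = P / sbar * (1 - q)"
  define B where "B = 1 + P * q"
  \<comment> \<open>These sequences mirror \<open>D\<close>, \<open>p\<close>, \<open>\<mu>\<close>,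
    \<open>b1\<close> and \<open>errK\<close>, which are available only inside an interpretation for
    a fixed K, while their limits are needed.\<close>
  define Dk where "Dk K = 2 powr (- r K / real (K - 1))" for K
  define pk where "pk K = P / real (s K)" for K
  define mk where "mk K = pk K * (real K * (1 - Dk K))" for K
  define bk where "bk K = 1 + pk K * Dk K * (real (s K) - 1)" for K
  define ek where "ek K = pk K * sqrt (real K) + 2 * pk K + pk K * real K * sqrt (1 / (real K - 1))
     + pk K * real K * sqrt ((1 + mk K) / (real K - 1)) + sqrt (1 / real K)" for K
  have q: "0 < q" "q \<le> 1" using powr_mono[of "- rbar" 0 2] assms(2) by (auto simp: q_def)
  have A0: "A \<ge> 0" using assms(1,3) q by (simp add: A_def)
  have B1: "B \<ge> 1" using assms(1) q by (simp add: B_def)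
  have iK: "(\<lambda>K. 1 / real K) \<longlonglongrightarrow> 0" by (rule lim_const_over_n)
  have iK1: "(\<lambda>K. 1 / (real K - 1)) \<longlonglongrightarrow> 0"
  proof -
    have "(\<lambda>K. 1 / real (K - 1)) \<longlonglongrightarrow> 0"
      using iK by (rule filterlim_compose) (rule filterlim_minus_const_nat_at_top)
    thus ?thesis
      by (rule Lim_transform_eventually) (rule eventually_sequentiallyI[of 1], simp add: of_nat_diff)
  qed
  have KK1: "(\<lambda>K. real K / real (K - 1)) \<longlonglongrightarrow> 1"
  proof -
    have "(\<lambda>K. 1 + 1 / (real K - 1)) \<longlonglongrightarrow> 1 + 0" by (intro tendsto_intros iK1)
    hence "(\<lambda>K. 1 + 1 / (real K - 1)) \<longlonglongrightarrow> 1" by simp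
    thus ?thesis
      by (rule Lim_transform_eventually)
         (rule eventually_sequentiallyI[of 2], simp add: of_nat_diff field_simps)
  qed
  have "(\<lambda>K. r K / real K * (real K / real (K - 1))) \<longlonglongrightarrow> rbar * 1" by (rule tendsto_mult[OF assms(8) KK1])
  hence "(\<lambda>K. r K / real K * (real K / real (K - 1))) \<longlonglongrightarrow> rbar" by simp
  hence "(\<lambda>K. r K / real (K - 1)) \<longlonglongrightarrow> rbar"
    by (rule Lim_transform_eventually) (rule eventually_sequentiallyI[of 1], simp)
  hence "(\<lambda>K. 2 powr (- (r K / real (K - 1)))) \<longlonglongrightarrow> 2 powr (- rbar)" by (intro tendsto_intros) auto
  hence Dl: "Dk \<longlonglongrightarrow> q" by (simp add: Dk_def[abs_def] q_def)
  have "(\<lambda>K. P / (real (s K) / real K)) \<longlonglongrightarrow> P / sbar"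
    by (intro tendsto_divide tendsto_const assms(9)) (use assms(3) in auto)
  hence pKl: "(\<lambda>K. pk K * real K) \<longlonglongrightarrow> P / sbar" by (simp add: pk_def)
  have "(\<lambda>K. pk K * real K * (1 / real K)) \<longlonglongrightarrow> P / sbar * 0" by (intro tendsto_mult pKl iK)
  hence "(\<lambda>K. pk K * real K * (1 / real K)) \<longlonglongrightarrow> 0" by simp
  hence pl: "pk \<longlonglongrightarrow> 0"
    by (rule Lim_transform_eventually) (rule eventually_sequentiallyI[of 1], simp)
  have "(\<lambda>K. pk K * real K * (1 - Dk K)) \<longlonglongrightarrow> P / sbar * (1 - q)" by (intro tendsto_intros pKl Dl)
  hence ml: "mk \<longlonglongrightarrow> A" by (simp add: mk_def[abs_def] A_def mult.assoc)
  have "(\<lambda>K. 1 + Dk K * (P - pk K)) \<longlonglongrightarrow> 1 + q * (P - 0)" by (intro tendsto_intros Dl pl)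
  hence "(\<lambda>K. 1 + Dk K * (P - pk K)) \<longlonglongrightarrow> B" by (simp add: B_def mult.commute)
  hence bl: "bk \<longlonglongrightarrow> B"
  proof (rule Lim_transform_eventually)
    show "\<forall>\<^sub>F K in sequentially. 1 + Dk K * (P - pk K) = bk K"
    proof (rule eventually_sequentiallyI[of 2])
      fix K :: nat assume "2 \<le> K"
      hence "real (s K) > 0" using assms(6)[of K] by simp
      hence "pk K * real (s K) = P" by (simp add: pk_def)
      hence "bk K = 1 + Dk K * (pk K * real (s K) - pk K)" by (simp add: bk_def algebra_simps)
      thus "1 + Dk K * (P - pk K) = bk K" using \<open>pk K * real (s K) = P\<close> by simp
    qed
  qed
  have al: "(\<lambda>K. mk K / bk K) \<longlonglongrightarrow> A / B" by (intro tendsto_divide ml bl) (use B1 in auto)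
  have sK: "(\<lambda>K. sqrt (1 / real K)) \<longlonglongrightarrow> 0" using tendsto_real_sqrt[OF iK] by simp
  have sK1: "(\<lambda>K. sqrt (1 / (real K - 1))) \<longlonglongrightarrow> 0" using tendsto_real_sqrt[OF iK1] by simp
  have "(\<lambda>K. (1 + mk K) * (1 / (real K - 1))) \<longlonglongrightarrow> (1 + A) * 0" by (intro tendsto_intros ml iK1)
  hence sK2: "(\<lambda>K. sqrt ((1 + mk K) / (real K - 1))) \<longlonglongrightarrow> 0" using tendsto_real_sqrt by fastforce
  \<comment> \<open>Here sqrt K is written as K * sqrt (1 / K), so that p always appears multiplied
    by K, and p K converges.\<close>
  have "(\<lambda>K. pk K * real K * sqrt (1 / real K) + 2 * pk K + pk K * real K * sqrt (1 / (real K - 1))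
     + pk K * real K * sqrt ((1 + mk K) / (real K - 1)) + sqrt (1 / real K)) \<longlonglongrightarrow> P / sbar * 0 + 2 * 0 + P / sbar * 0 + P / sbar * 0 + 0"
    by (intro tendsto_intros pKl pl sK sK1 sK2)
  hence "(\<lambda>K. pk K * real K * sqrt (1 / real K) + 2 * pk K + pk K * real K * sqrt (1 / (real K - 1))
     + pk K * real K * sqrt ((1 + mk K) / (real K - 1)) + sqrt (1 / real K)) \<longlonglongrightarrow> 0"
    by (simp only: mult_zero_right add_0_right)
  hence el: "ek \<longlonglongrightarrow> 0"
  proof (rule Lim_transform_eventually)
    show "\<forall>\<^sub>F K in sequentially. pk K * real K * sqrt (1 / real K) + 2 * pk K + pk K * real K * sqrt (1 / (real K - 1))
     + pk K * real K * sqrt ((1 + mk K) / (real K - 1)) + sqrt (1 / real K) = ek K"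
    proof (rule eventually_sequentiallyI[of 1])
      fix K :: nat assume "1 \<le> K"
      have "real K * sqrt (1 / real K) = sqrt (real K)"
        using \<open>1 \<le> K\<close> by (simp add: real_sqrt_divide real_div_sqrt)
      thus "pk K * real K * sqrt (1 / real K) + 2 * pk K + pk K * real K * sqrt (1 / (real K - 1))
       + pk K * real K * sqrt ((1 + mk K) / (real K - 1)) + sqrt (1 / real K) = ek K"
        unfolding ek_def by (simp only: mult.assoc)
    qed
  qed
  let ?rate = "\<lambda>K i. zf_dpc.rate (M K) K (s K) P (h K) (hh K) i"
  define g where "g y = ln (1 + A / B * (1 - y)) / ln 2" for y
  have AB: "0 \<le> A / B" using A0 B1 by simp
  have l2: "ln 2 > (0::real)" by simp
  have rate: "\<bar>?rate K i - g (real i / real K)\<bar> \<le> ((1 + 3 * (1 + mk K)) * ek K + \<bar>mk K / bk K - A / B\<bar>) / ln 2"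
    if K: "K \<ge> 2" and i: "i < s K" for K i
  proof -
    interpret Q: dpc_setup "M K" K "r K" "h K" "hh K" "e K" "s K" P
      by (intro dpc_setup.intro qub_setup.intro qub_setup_axioms.intro dpc_setup_axioms.intro)
         (use assms K in auto)
    have eqs: "Q.p = pk K" "Q.D = Dk K" "Q.\<mu> = mk K" "Q.b1 = bk K" "Q.S1 = 1 + mk K" "Q.alpha = mk K / bk K"
      by (simp_all add: Q.p_def pk_def Q.D_def Dk_def Q.\<mu>_def Q.gain_def mk_def Q.b1_def bk_def Q.S1_def Q.alpha_def)
    have errK: "Q.errK = ek K" unfolding Q.errK_def ek_def eqs ..
    have 1: "\<bar>?rate K i - ln (1 + mk K / bk K * (1 - real i / real K)) / ln 2\<bar> \<le> (1 + 3 * (1 + mk K)) * ek K / ln 2"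
      using Q.rate_approx[OF i] unfolding eqs errK .
    have y: "0 \<le> 1 - real i / real K" "1 - real i / real K \<le> 1" using i assms(6)[OF K] K by (auto simp: divide_le_eq)
    have "\<bar>ln (1 + mk K / bk K * (1 - real i / real K)) - ln (1 + A / B * (1 - real i / real K))\<bar> \<le> \<bar>mk K / bk K - A / B\<bar>"
      by (rule ln_affine_lipschitz) (use Q.alpha0 AB y eqs in auto)
    hence "\<bar>ln (1 + mk K / bk K * (1 - real i / real K)) - ln (1 + A / B * (1 - real i / real K))\<bar> / ln 2 \<le> \<bar>mk K / bk K - A / B\<bar> / ln 2"
      using l2 by (intro divide_right_mono) auto
    moreover have "\<bar>ln (1 + mk K / bk K * (1 - real i / real K)) - ln (1 + A / B * (1 - real i / real K))\<bar> / ln 2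
       = \<bar>ln (1 + mk K / bk K * (1 - real i / real K)) / ln 2 - g (real i / real K)\<bar>"
      unfolding g_def diff_divide_distrib[symmetric] abs_divide by simp
    ultimately have "\<bar>ln (1 + mk K / bk K * (1 - real i / real K)) / ln 2 - g (real i / real K)\<bar> \<le> \<bar>mk K / bk K - A / B\<bar> / ln 2"
      by simp
    with 1 show ?thesis unfolding add_divide_distrib by linarith
  qed
  \<comment> \<open>The sequence s is set to 0 below K = 2, because s K <= K is assumed only from 2
    on; this does not affect the limit.\<close>
  have riem: "(\<lambda>K. 1 / real K * (\<Sum>i<s K. g (real i / real K))) \<longlonglongrightarrow> integral {0..sbar} g"
  proof (rule riemann_sum_left[where L = "A / B / ln 2" and s = "\<lambda>K. if K \<ge> 2 then s K else 0", THEN Lim_transform_eventually])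
    fix x y :: real assume xy: "x \<in> {0..1}" "y \<in> {0..1}"
    have "\<bar>ln (1 + A / B * (1 - x)) - ln (1 + A / B * (1 - y))\<bar> \<le> \<bar>(1 + A / B * (1 - x)) - (1 + A / B * (1 - y))\<bar>"
      by (rule abs_ln_diff_le) (use mult_nonneg_nonneg[OF AB, of "1 - x"] mult_nonneg_nonneg[OF AB, of "1 - y"] xy in auto)
    also have "(1 + A / B * (1 - x)) - (1 + A / B * (1 - y)) = A / B * (y - x)" by (simp only: right_diff_distrib)
    also have "\<bar>A / B * (y - x)\<bar> = A / B * \<bar>x - y\<bar>" unfolding abs_mult using A0 B1 by (simp add: abs_minus_commute)
    finally have "\<bar>ln (1 + A / B * (1 - x)) - ln (1 + A / B * (1 - y))\<bar> / ln 2 \<le> A / B * \<bar>x - y\<bar> / ln 2"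
      using l2 by (intro divide_right_mono) auto
    thus "\<bar>g x - g y\<bar> \<le> A / B / ln 2 * \<bar>x - y\<bar>"
      unfolding g_def diff_divide_distrib[symmetric] abs_divide by simp
  next
    show "(if K \<ge> 2 then s K else 0) \<le> K" for K using assms(6)[of K] by auto
    show "(\<lambda>K. real (if K \<ge> 2 then s K else 0) / real K) \<longlonglongrightarrow> sbar"
      using assms(9) by (rule Lim_transform_eventually) (rule eventually_sequentiallyI[of 2], simp)
    show "0 \<le> sbar" "sbar \<le> 1" using assms(3,4) by auto
    show "\<forall>\<^sub>F K in sequentially. 1 / real K * (\<Sum>i<(if K \<ge> 2 then s K else 0). g (real i / real K)) = 1 / real K * (\<Sum>i<s K. g (real i / real K))"
      by (rule eventually_sequentiallyI[of 2]) simp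
  qed
  have bnd: "(\<lambda>K. ((1 + 3 * (1 + mk K)) * ek K + \<bar>mk K / bk K - A / B\<bar>) / ln 2) \<longlonglongrightarrow> ((1 + 3 * (1 + A)) * 0 + \<bar>A / B - A / B\<bar>) / ln 2"
    by (intro tendsto_intros ml el al) auto
  have "(\<lambda>K. 1 / real K * (\<Sum>i<s K. ?rate K i) - 1 / real K * (\<Sum>i<s K. g (real i / real K))) \<longlonglongrightarrow> 0"
  proof (rule Lim_null_comparison)
    show "(\<lambda>K. ((1 + 3 * (1 + mk K)) * ek K + \<bar>mk K / bk K - A / B\<bar>) / ln 2) \<longlonglongrightarrow> 0" using bnd by simp
    show "\<forall>\<^sub>F K in sequentially. norm (1 / real K * (\<Sum>i<s K. ?rate K i) - 1 / real K * (\<Sum>i<s K. g (real i / real K)))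
       \<le> ((1 + 3 * (1 + mk K)) * ek K + \<bar>mk K / bk K - A / B\<bar>) / ln 2"
    proof (rule eventually_sequentiallyI[of 2])
      fix K :: nat assume K: "2 \<le> K"
      let ?b = "((1 + 3 * (1 + mk K)) * ek K + \<bar>mk K / bk K - A / B\<bar>) / ln 2"
      have s: "1 \<le> s K" "s K \<le> K" using assms(6)[OF K] by auto
      \<comment> \<open>User 0 is always on, so the bound dominates an absolute value and is
        nonnegative. That allows the factor s K / K <= 1 to be dropped.\<close>
      have b0: "0 \<le> ?b" using rate[OF K, of 0] s by linarith
      have "1 / real K * (\<Sum>i<s K. ?rate K i) - 1 / real K * (\<Sum>i<s K. g (real i / real K)) = 1 / real K * (\<Sum>i<s K. ?rate K i - g (real i / real K))"
        by (simp add: sum_subtractf right_diff_distrib)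
      hence "norm (1 / real K * (\<Sum>i<s K. ?rate K i) - 1 / real K * (\<Sum>i<s K. g (real i / real K))) = 1 / real K * \<bar>\<Sum>i<s K. ?rate K i - g (real i / real K)\<bar>"
        by (simp add: abs_mult)
      also have "\<dots> \<le> 1 / real K * (\<Sum>i<s K. ?b)"
      proof (rule mult_left_mono)
        have "\<bar>\<Sum>i<s K. ?rate K i - g (real i / real K)\<bar> \<le> (\<Sum>i<s K. \<bar>?rate K i - g (real i / real K)\<bar>)" by (rule sum_abs)
        also have "\<dots> \<le> (\<Sum>i<s K. ?b)" by (rule sum_mono) (use rate[OF K] in auto)
        finally show "\<bar>\<Sum>i<s K. ?rate K i - g (real i / real K)\<bar> \<le> (\<Sum>i<s K. ?b)" .
      qed simp
      also have "\<dots> = real (s K) / real K * ?b" by simp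
      also have "\<dots> \<le> 1 * ?b" using s b0 by (intro mult_right_mono) (auto simp: divide_le_eq)
      finally show "norm (1 / real K * (\<Sum>i<s K. ?rate K i) - 1 / real K * (\<Sum>i<s K. g (real i / real K))) \<le> ?b" by simp
    qed
  qed
  from tendsto_add[OF this riem]
  have "(\<lambda>K. 1 / real K * (\<Sum>i<s K. ?rate K i)) \<longlonglongrightarrow> integral {0..sbar} g" by simp
  moreover have "integral {0..sbar} g = rho P sbar rbar"
    unfolding rho_eq[OF assms(1) assms(3) assms(4) assms(2)] g_def A_def B_def q_def by simp
  ultimately show ?thesis by simp
qed

end
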